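(* Let $(R,m,k)$ be a complete regular local ring with algebraically closed residue field $k$. Suppose that for every $r\ge 1$, every choice of monic polynomials $f_i(y_i)=y_i^{n_i}+a_{i,1}y_i^{n_i-1}+\cdots+a_{i,n_i}\in R[y_i]$ ($i=1,\dots,r$, $n_i\ge 1$) with all $a_{i,j}\in m$, and every ideal $J$ of height zero in $$T=R[y_1,\dots,y_r]/(f_1(y_1),\dots,f_r(y_r))$$ such that the natural map $R\to T/J$ is injective, the ring $R$ is a direct summand of $T/J$ as an $R$-module. Then for every module-finite ring extension $R\hookrightarrow S$, $R$ is a direct summand of $S$ as an $R$-module (i.e. there is an $R$-linear map $\rho:S\to R$ with $\rho(1)=1$).
   Context: All rings are commutative Noetherian with identity. *)

theory Defs
  imports "HOL-Algebra.Algebra" "HOL-Library.Extended_Nat"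
begin

definition local_ring :: "('a, 'b) ring_scheme \<Rightarrow> bool" where
  "local_ring R \<longleftrightarrow> cring R \<and> (\<exists>!M. maximalideal M R)"

definition max_ideal :: "('a, 'b) ring_scheme \<Rightarrow> 'a set" where
  "max_ideal R = (THE M. maximalideal M R)"

definition prime_chain :: "('a, 'b) ring_scheme \<Rightarrow> 'a set list \<Rightarrow> bool" where
  "prime_chain R ps \<longleftrightarrow> ps \<noteq> [] \<and> (\<forall>P \<in> set ps. primeideal P R) \<and> sorted_wrt (\<subset>) ps"

definition krull_dim :: "('a, 'b) ring_scheme \<Rightarrow> enat" where
  "krull_dim R = Sup {enat (length ps - 1) | ps. prime_chain R ps}"

definition prime_height :: "('a, 'b) ring_scheme \<Rightarrow> 'a set \<Rightarrow> enat" where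
  "prime_height R P = Sup {enat (length ps - 1) | ps. prime_chain R ps \<and> last ps = P}"

text \<open>Height of an ideal: infimum of the heights of the primes containing it
  (the unit ideal has height \<open>\<infinity>\<close>).\<close>
definition ideal_height :: "('a, 'b) ring_scheme \<Rightarrow> 'a set \<Rightarrow> enat" where
  "ideal_height R J = Inf {prime_height R P | P. primeideal P R \<and> J \<subseteq> P}"

definition emb_dim :: "('a, 'b) ring_scheme \<Rightarrow> nat" where
  "emb_dim R = (LEAST n. \<exists>G. finite G \<and> card G = n \<and> G \<subseteq> carrier R \<and> Idl\<^bsub>R\<^esub> G = max_ideal R)"

definition regular_local_ring :: "('a, 'b) ring_scheme \<Rightarrow> bool" where
  "regular_local_ring R \<longleftrightarrow> local_ring R \<and> noetherian_ring R \<and> krull_dim R = enat (emb_dim R)"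

primrec ideal_pow :: "('a, 'b) ring_scheme \<Rightarrow> 'a set \<Rightarrow> nat \<Rightarrow> 'a set" where
  "ideal_pow R I 0 = carrier R"
| "ideal_pow R I (Suc k) = ideal_prod R I (ideal_pow R I k)"

definition madic_complete :: "('a, 'b) ring_scheme \<Rightarrow> bool" where
  "madic_complete R \<longleftrightarrow>
     (\<Inter>k. ideal_pow R (max_ideal R) k) = {\<zero>\<^bsub>R\<^esub>} \<and>
     (\<forall>x::nat \<Rightarrow> 'a. (\<forall>n. x n \<in> carrier R) \<and>
          (\<forall>k. \<exists>N. \<forall>p\<ge>N. \<forall>q\<ge>N. x p \<ominus>\<^bsub>R\<^esub> x q \<in> ideal_pow R (max_ideal R) k)
        \<longrightarrow> (\<exists>l\<in>carrier R. \<forall>k. \<exists>N. \<forall>n\<ge>N. x n \<ominus>\<^bsub>R\<^esub> l \<in> ideal_pow R (max_ideal R) k))"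

text \<open>Monomials in the variables y_0,...,y_(r-1) are exponent functions vanishing from r on;
  a polynomial is a finitely supported coefficient function on monomials.\<close>
definition monomials :: "nat \<Rightarrow> (nat \<Rightarrow> nat) set" where
  "monomials r = {m. \<forall>i\<ge>r. m i = 0}"

definition mpoly_ring :: "('a, 'b) ring_scheme \<Rightarrow> nat \<Rightarrow> ((nat \<Rightarrow> nat) \<Rightarrow> 'a) ring" where
  "mpoly_ring R r =
    \<lparr>carrier = {p. (\<forall>m. p m \<in> carrier R) \<and> (\<forall>m. m \<notin> monomials r \<longrightarrow> p m = \<zero>\<^bsub>R\<^esub>)
                   \<and> finite {m. p m \<noteq> \<zero>\<^bsub>R\<^esub>}},
     monoid.mult = (\<lambda>p q m. if m \<in> monomials r
                     then (\<Oplus>\<^bsub>R\<^esub> a \<in> {a. a \<le> m}. p a \<otimes>\<^bsub>R\<^esub> q (\<lambda>i. m i - a i))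
                     else \<zero>\<^bsub>R\<^esub>),
     monoid.one = (\<lambda>m. if m = (\<lambda>i. 0) then \<one>\<^bsub>R\<^esub> else \<zero>\<^bsub>R\<^esub>),
     ring.zero = (\<lambda>m. \<zero>\<^bsub>R\<^esub>),
     ring.add = (\<lambda>p q m. p m \<oplus>\<^bsub>R\<^esub> q m)\<rparr>"

definition mp_const :: "('a, 'b) ring_scheme \<Rightarrow> 'a \<Rightarrow> ((nat \<Rightarrow> nat) \<Rightarrow> 'a)" where
  "mp_const R c = (\<lambda>m. if m = (\<lambda>i. 0) then c else \<zero>\<^bsub>R\<^esub>)"

definition mp_var :: "('a, 'b) ring_scheme \<Rightarrow> nat \<Rightarrow> ((nat \<Rightarrow> nat) \<Rightarrow> 'a)" where
  "mp_var R i = (\<lambda>m. if m = (\<lambda>j. if j = i then 1 else 0) then \<one>\<^bsub>R\<^esub> else \<zero>\<^bsub>R\<^esub>)"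

definition monic_in_var ::
  "('a, 'b) ring_scheme \<Rightarrow> nat \<Rightarrow> nat \<Rightarrow> nat \<Rightarrow> (nat \<Rightarrow> 'a) \<Rightarrow> ((nat \<Rightarrow> nat) \<Rightarrow> 'a)" where
  "monic_in_var R r i n a =
     (let P = mpoly_ring R r in
      (mp_var R i [^]\<^bsub>P\<^esub> n) \<oplus>\<^bsub>P\<^esub>
      (\<Oplus>\<^bsub>P\<^esub> j \<in> {1..n}. mp_const R (a j) \<otimes>\<^bsub>P\<^esub> (mp_var R i [^]\<^bsub>P\<^esub> (n - j))))"

definition T_ring ::
  "('a, 'b) ring_scheme \<Rightarrow> nat \<Rightarrow> (nat \<Rightarrow> nat) \<Rightarrow> (nat \<Rightarrow> nat \<Rightarrow> 'a)
     \<Rightarrow> ((nat \<Rightarrow> nat) \<Rightarrow> 'a) set ring" where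
  "T_ring R r n a =
     mpoly_ring R r Quot (Idl\<^bsub>mpoly_ring R r\<^esub> {monic_in_var R r i (n i) (a i) | i. i < r})"

definition T_quot_map ::
  "('a, 'b) ring_scheme \<Rightarrow> nat \<Rightarrow> (nat \<Rightarrow> nat) \<Rightarrow> (nat \<Rightarrow> nat \<Rightarrow> 'a)
     \<Rightarrow> ((nat \<Rightarrow> nat) \<Rightarrow> 'a) set set \<Rightarrow> 'a \<Rightarrow> ((nat \<Rightarrow> nat) \<Rightarrow> 'a) set set" where
  "T_quot_map R r n a J x =
     J +>\<^bsub>T_ring R r n a\<^esub>
       (Idl\<^bsub>mpoly_ring R r\<^esub> {monic_in_var R r i (n i) (a i) | i. i < r} +>\<^bsub>mpoly_ring R r\<^esub> mp_const R x)"

definition direct_summand_via ::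
  "('a, 'b) ring_scheme \<Rightarrow> ('c, 'd) ring_scheme \<Rightarrow> ('a \<Rightarrow> 'c) \<Rightarrow> bool" where
  "direct_summand_via R S \<iota> \<longleftrightarrow>
     (\<exists>\<rho>. (\<forall>s\<in>carrier S. \<rho> s \<in> carrier R)
        \<and> (\<forall>s\<in>carrier S. \<forall>t\<in>carrier S. \<rho> (s \<oplus>\<^bsub>S\<^esub> t) = \<rho> s \<oplus>\<^bsub>R\<^esub> \<rho> t)
        \<and> (\<forall>x\<in>carrier R. \<forall>s\<in>carrier S. \<rho> (\<iota> x \<otimes>\<^bsub>S\<^esub> s) = x \<otimes>\<^bsub>R\<^esub> \<rho> s)
        \<and> \<rho> \<one>\<^bsub>S\<^esub> = \<one>\<^bsub>R\<^esub>)"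

definition module_finite_via ::
  "('a, 'b) ring_scheme \<Rightarrow> ('c, 'd) ring_scheme \<Rightarrow> ('a \<Rightarrow> 'c) \<Rightarrow> bool" where
  "module_finite_via R S \<iota> \<longleftrightarrow>
     (\<exists>G. finite G \<and> G \<subseteq> carrier S \<and>
        (\<forall>s\<in>carrier S. \<exists>c. (\<forall>g\<in>G. c g \<in> carrier R) \<and> s = (\<Oplus>\<^bsub>S\<^esub> g\<in>G. \<iota> (c g) \<otimes>\<^bsub>S\<^esub> g)))"

end

theory Submission
  imports Defs
begin

text \<open>
  A regular local ring is a domain, so \<open>S\<close> has a prime \<open>Q\<close> lying over zero, and it suffices to
  retract the domain \<open>D = S/Q\<close> onto \<open>R\<close>. Let \<open>s \<in> D\<close> be a root of a monic polynomial \<open>p\<close> over \<open>R\<close>.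
  Modulo the maximal ideal, \<open>p\<close> is the product of a power of a linear factor and a coprime
  cofactor. By Hensel's lemma this factorization lifts to \<open>R\<close>, and since \<open>D\<close> is a domain, one of
  the two lifted factors vanishes at \<open>s\<close>. By induction on the degree some translate \<open>s - c\<close>, with \<open>c \<in> R\<close>,
  is a root of a monic polynomial whose lower coefficients lie in the maximal ideal. Translating
  the generators of \<open>D\<close> in this way presents \<open>D\<close> as \<open>T/J\<close>. Here \<open>J\<close> is a prime of \<open>T\<close> contracting to
  zero in \<open>R\<close>, hence a minimal prime by incomparability, so the hypothesis applies.

  That a regular local ring is a domain follows from Krull's principal ideal theorem: if the
  maximal ideal is generated by \<open>d\<close> elements and \<open>P\<^sub>0 \<subset> \<dots> \<subset> P\<^sub>d\<close> is a chain of primes, choose a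
  generator \<open>x \<notin> P\<^sub>0\<close> and a chain \<open>P\<^sub>0 \<subset> P\<^sub>1' \<subset> \<dots> \<subset> P\<^sub>d'\<close> with \<open>x \<in> P\<^sub>1'\<close>; by induction \<open>P\<^sub>1' = (x)\<close>,
  so \<open>P\<^sub>0 = x P\<^sub>0\<close> and \<open>P\<^sub>0 = 0\<close> by Nakayama's lemma.
\<close>

section \<open>Ideals and primes of commutative rings\<close>

lemmas ideal_zero_closed = additive_subgroup.zero_closed[OF ideal.axioms(1)]
  and ideal_add_closed = additive_subgroup.a_closed[OF ideal.axioms(1)]
  and ideal_neg_closed = additive_subgroup.a_inv_closed[OF ideal.axioms(1)]

context cring
begin

lemma ideal_minus_closed:
  assumes "ideal I R" "a \<in> I" "b \<in> I"
  shows "a \<ominus> b \<in> I"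
  unfolding a_minus_def using assms by (simp add: ideal_add_closed ideal_neg_closed)

lemma ideal_subset_carrier: "ideal I R \<Longrightarrow> I \<subseteq> carrier R"
  by (rule subsetI) (rule ideal.Icarr)

lemma ideal_cancel_add:
  assumes "ideal I R" "a \<oplus> b \<in> I" "a \<in> I" "b \<in> carrier R"
  shows "b \<in> I"
proof -
  have "a \<in> carrier R" using assms(1,3) by (rule ideal.Icarr)
  then have "b = (a \<oplus> b) \<ominus> a" using assms(4) by algebra
  then show ?thesis using ideal_minus_closed[OF assms(1-3)] by simp
qed

lemma cring_idealI:
  assumes "I \<subseteq> carrier R" "\<zero> \<in> I" "\<And>a b. a \<in> I \<Longrightarrow> b \<in> I \<Longrightarrow> a \<oplus> b \<in> I"
    and mult: "\<And>r a. r \<in> carrier R \<Longrightarrow> a \<in> I \<Longrightarrow> r \<otimes> a \<in> I"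
  shows "ideal I R"
proof (rule idealI[OF ring_axioms])
  have neg: "\<ominus> a \<in> I" if "a \<in> I" for a
  proof -
    have "\<ominus> a = (\<ominus> \<one>) \<otimes> a" using that assms(1) by (simp add: l_minus subset_iff)
    then show ?thesis using mult[OF _ that, of "\<ominus> \<one>"] by simp
  qed
  show "subgroup I (add_monoid R)"
    by (rule add.subgroupI) (use assms neg in \<open>auto simp flip: a_inv_def\<close>)
  show "x \<otimes> a \<in> I" if "a \<in> I" "x \<in> carrier R" for a x using mult that by simp
  show "a \<otimes> x \<in> I" if "a \<in> I" "x \<in> carrier R" for a x
    using mult[of x a] assms(1) m_comm[of a x] that by auto
qed

lemma primeideal_one_notin: "primeideal P R \<Longrightarrow> \<one> \<notin> P"
  using ideal.one_imp_carrier primeideal.I_notcarr primeideal.axioms(1) by metis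

lemma primeideal_nat_pow_mem:
  assumes "primeideal P R" "a \<in> carrier R" "a [^] (n::nat) \<in> P"
  shows "a \<in> P"
  using assms(3)
proof (induction n)
  case 0
  then show ?case using primeideal_one_notin[OF assms(1)] by simp
next
  case (Suc n)
  then show ?case using primeideal.I_prime[OF assms(1), of "a [^] n" a] assms(2) by auto
qed

definition adjoin_ideal :: "'a set \<Rightarrow> 'a \<Rightarrow> 'a set" where
  "adjoin_ideal I x = {i \<oplus> r \<otimes> x | i r. i \<in> I \<and> r \<in> carrier R}"

lemma adjoin_idealE:
  assumes "a \<in> adjoin_ideal I x"
  obtains i r where "i \<in> I" "r \<in> carrier R" "a = i \<oplus> r \<otimes> x"
  using assms unfolding adjoin_ideal_def by blast

lemma
  assumes I_ideal: "ideal I R" and x_closed: "x \<in> carrier R"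
  shows adjoin_ideal_ideal: "ideal (adjoin_ideal I x) R"
    and subset_adjoin_ideal: "I \<subseteq> adjoin_ideal I x"
    and mem_adjoin_ideal: "x \<in> adjoin_ideal I x"
proof -
  have "adjoin_ideal I x = I <+> PIdl x"
    unfolding adjoin_ideal_def set_add_def' cgenideal_def by blast
  then show "ideal (adjoin_ideal I x) R"
    using add_ideals[OF I_ideal cgenideal_ideal[OF x_closed]] by simp
  show "I \<subseteq> adjoin_ideal I x"
  proof
    fix i assume i_mem: "i \<in> I"
    then have "i = i \<oplus> \<zero> \<otimes> x" using x_closed ideal.Icarr[OF I_ideal] by simp
    then show "i \<in> adjoin_ideal I x" unfolding adjoin_ideal_def using i_mem by blast
  qed
  have "x = \<zero> \<oplus> \<one> \<otimes> x" using x_closed by simp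
  then show "x \<in> adjoin_ideal I x"
    unfolding adjoin_ideal_def using ideal_zero_closed[OF I_ideal] by blast
qed

lemma adjoin_ideal_minimal:
  assumes "ideal K R" "I \<subseteq> K" "x \<in> K"
  shows "adjoin_ideal I x \<subseteq> K"
  unfolding adjoin_ideal_def
  using assms by (auto intro!: ideal_add_closed[OF assms(1)] ideal.I_l_closed[OF assms(1)])

lemma adjoin_ideal_mono: "I \<subseteq> K \<Longrightarrow> adjoin_ideal I x \<subseteq> adjoin_ideal K x"
  unfolding adjoin_ideal_def by blast

lemma primeideal_if_maximal_disjoint:
  assumes U_submonoid: "submonoid U R" and M: "ideal M R" "M \<inter> U = {}"
    and max: "\<And>K. ideal K R \<Longrightarrow> M \<subseteq> K \<Longrightarrow> K \<inter> U = {} \<Longrightarrow> K = M"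
  shows "primeideal M R"
proof (rule primeidealI[OF M(1) is_cring])
  have meets: "\<exists>m r. m \<in> M \<and> r \<in> carrier R \<and> m \<oplus> r \<otimes> a \<in> U" if a: "a \<in> carrier R" "a \<notin> M" for a
  proof (rule ccontr)
    assume "\<not> ?thesis"
    then have "adjoin_ideal M a \<inter> U = {}" unfolding adjoin_ideal_def by blast
    then have "adjoin_ideal M a = M"
      using max adjoin_ideal_ideal subset_adjoin_ideal M(1) a(1) by blast
    then show False using mem_adjoin_ideal[OF M(1) a(1)] a(2) by blast
  qed
  show "carrier R \<noteq> M" using M(2) submonoid.one_closed[OF U_submonoid] by blast
  fix a b assume ab: "a \<in> carrier R" "b \<in> carrier R" "a \<otimes> b \<in> M"
  show "a \<in> M \<or> b \<in> M"
  proof (rule ccontr)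
    assume "\<not> (a \<in> M \<or> b \<in> M)"
    then obtain m r m' r' where m: "m \<in> M" "r \<in> carrier R" "m \<oplus> r \<otimes> a \<in> U"
      and m': "m' \<in> M" "r' \<in> carrier R" "m' \<oplus> r' \<otimes> b \<in> U"
      using meets ab by metis
    have in_carrier: "m \<in> carrier R" "m' \<in> carrier R" using m(1) m'(1) ideal.Icarr[OF M(1)] by auto
    have "(m \<oplus> r \<otimes> a) \<otimes> (m' \<oplus> r' \<otimes> b) =
        (m' \<oplus> r' \<otimes> b) \<otimes> m \<oplus> ((r \<otimes> a) \<otimes> m' \<oplus> (r \<otimes> r') \<otimes> (a \<otimes> b))"
      using in_carrier m(2) m'(2) ab by algebra
    also have "\<dots> \<in> M"
      using m m' ab in_carrier by (simp add: ideal_add_closed[OF M(1)] ideal.I_l_closed[OF M(1)])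
    finally show False using submonoid.m_closed[OF U_submonoid m(3) m'(3)] M(2) by blast
  qed
qed

lemma exists_maximal_ideal_disjoint:
  assumes "ideal I R" "I \<inter> U = {}"
  shows "\<exists>M. ideal M R \<and> I \<subseteq> M \<and> M \<inter> U = {} \<and> (\<forall>K. ideal K R \<longrightarrow> M \<subseteq> K \<longrightarrow> K \<inter> U = {} \<longrightarrow> K = M)"
proof -
  define F where "F = {K. ideal K R \<and> I \<subseteq> K \<and> K \<inter> U = {}}"
  have "\<exists>M\<in>F. \<forall>K\<in>F. M \<subseteq> K \<longrightarrow> K = M"
  proof (rule subset_Zorn_nonempty)
    show "F \<noteq> {}" using assms unfolding F_def by blast
    fix C assume C: "C \<noteq> {}" "subset.chain F C"
    then have "subset.chain {I. ideal I R} C"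
      unfolding F_def pred_on.chain_def by blast
    then have "ideal (\<Union>C) R" using chain_Union_is_ideal[of C] C(1) by simp
    then show "\<Union>C \<in> F" using C unfolding F_def pred_on.chain_def by blast
  qed
  then obtain M where M_mem: "M \<in> F" and maximal: "\<forall>K\<in>F. M \<subseteq> K \<longrightarrow> K = M" by (elim bexE)
  have "K = M" if "ideal K R" "M \<subseteq> K" "K \<inter> U = {}" for K
    using maximal M_mem that unfolding F_def by blast
  then show ?thesis using M_mem unfolding F_def by blast
qed

lemma exists_primeideal_disjoint:
  assumes I_ideal: "ideal I R" and U_submonoid: "submonoid U R" and disjoint: "I \<inter> U = {}"
  shows "\<exists>P. primeideal P R \<and> I \<subseteq> P \<and> P \<inter> U = {}"
proof -
  obtain M where M: "ideal M R" "I \<subseteq> M" "M \<inter> U = {}"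
    and "\<forall>K. ideal K R \<longrightarrow> M \<subseteq> K \<longrightarrow> K \<inter> U = {} \<longrightarrow> K = M"
    using exists_maximal_ideal_disjoint[OF I_ideal disjoint] by (elim exE conjE)
  then have "primeideal M R" by (intro primeideal_if_maximal_disjoint[OF U_submonoid M(1,3)]) simp
  then show ?thesis using M by blast
qed

lemma
  assumes "ideal I R" "ideal J R"
  shows subset_ideal_sum: "I \<subseteq> I <+>\<^bsub>R\<^esub> J" "J \<subseteq> I <+>\<^bsub>R\<^esub> J"
    and ideal_sum_minimal: "ideal M R \<Longrightarrow> I \<subseteq> M \<Longrightarrow> J \<subseteq> M \<Longrightarrow> I <+>\<^bsub>R\<^esub> J \<subseteq> M"
proof -
  have eq: "Idl (I \<union> J) = I <+>\<^bsub>R\<^esub> J" by (rule union_genideal[OF assms])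
  have "I \<union> J \<subseteq> Idl (I \<union> J)"
    by (rule genideal_self) (use assms ideal_subset_carrier in auto)
  then show "I \<subseteq> I <+>\<^bsub>R\<^esub> J" "J \<subseteq> I <+>\<^bsub>R\<^esub> J" unfolding eq by auto
  show "I <+>\<^bsub>R\<^esub> J \<subseteq> M" if "ideal M R" "I \<subseteq> M" "J \<subseteq> M"
    unfolding eq[symmetric] by (rule genideal_minimal) (use that in auto)
qed

lemma set_add_mono: "A \<subseteq> A' \<Longrightarrow> B \<subseteq> B' \<Longrightarrow> A <+>\<^bsub>R\<^esub> B \<subseteq> A' <+>\<^bsub>R\<^esub> B'"
  unfolding set_add_def' by blast

lemma ideal_prod_minimal:
  assumes "ideal M R" "\<And>i j. i \<in> I \<Longrightarrow> j \<in> J \<Longrightarrow> i \<otimes> j \<in> M"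
  shows "I \<cdot> J \<subseteq> M"
proof
  fix a assume "a \<in> I \<cdot> J"
  then show "a \<in> M"
    by (induction rule: ideal_prod.induct) (simp_all add: assms ideal_add_closed[OF assms(1)])
qed

lemma ideal_prod_mono:
  assumes "I \<subseteq> I'" "J \<subseteq> J'"
  shows "I \<cdot> J \<subseteq> I' \<cdot> J'"
proof
  fix a assume "a \<in> I \<cdot> J"
  then show "a \<in> I' \<cdot> J'"
    by (induction rule: ideal_prod.induct) (use assms in \<open>auto intro: ideal_prod.intros\<close>)
qed

lemma ideal_pow_ideal: "ideal I R \<Longrightarrow> ideal (ideal_pow R I n) R"
  by (induction n) (simp_all add: oneideal ideal_prod_is_ideal)

lemma pow_mem_ideal_pow:
  assumes "ideal I R" "y \<in> I"
  shows "y [^] n \<in> ideal_pow R I n"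
proof (induction n)
  case (Suc n)
  have "y \<otimes> y [^] n \<in> I \<cdot> ideal_pow R I n" by (rule ideal_prod.prod[OF assms(2) Suc])
  then show ?case using ideal.Icarr[OF assms] by (simp add: m_comm)
qed simp

lemma ideal_pow_Suc_subset: "ideal I R \<Longrightarrow> ideal_pow R I (Suc n) \<subseteq> ideal_pow R I n"
  using ideal_prod_inter[OF _ ideal_pow_ideal] by auto

text \<open>The contraction to \<open>R\<close> of the extension of \<open>K\<close> to the localisation at \<open>P\<close>. Ideals of the
  localisation correspond to the ideals of \<open>R\<close> that equal their saturation.\<close>

definition saturation :: "'a set \<Rightarrow> 'a set \<Rightarrow> 'a set" where
  "saturation P K = {a \<in> carrier R. \<exists>u \<in> carrier R - P. u \<otimes> a \<in> K}"

definition saturated_ideal :: "'a set \<Rightarrow> 'a set \<Rightarrow> bool" where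
  "saturated_ideal P K \<longleftrightarrow> ideal K R \<and> saturation P K \<subseteq> K"

lemma saturationI: "a \<in> carrier R \<Longrightarrow> u \<in> carrier R \<Longrightarrow> u \<notin> P \<Longrightarrow> u \<otimes> a \<in> K \<Longrightarrow> a \<in> saturation P K"
  unfolding saturation_def by blast

lemma saturationE:
  assumes "a \<in> saturation P K"
  obtains u where "a \<in> carrier R" "u \<in> carrier R" "u \<notin> P" "u \<otimes> a \<in> K"
  using assms unfolding saturation_def by blast

lemma saturation_mono: "K \<subseteq> L \<Longrightarrow> saturation P K \<subseteq> saturation P L"
  unfolding saturation_def by blast

lemma saturation_antimono: "Q \<subseteq> P \<Longrightarrow> saturation P K \<subseteq> saturation Q K"
  unfolding saturation_def by blast

lemma subset_saturation:
  assumes "primeideal P R" "ideal K R"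
  shows "K \<subseteq> saturation P K"
  using saturationI[of _ \<one>] primeideal_one_notin[OF assms(1)] ideal.Icarr[OF assms(2)] by auto

lemma saturation_ideal:
  assumes P_prime: "primeideal P R" and K_ideal: "ideal K R"
  shows "ideal (saturation P K) R"
proof (rule cring_idealI)
  show "saturation P K \<subseteq> carrier R" unfolding saturation_def by blast
  show "\<zero> \<in> saturation P K"
    using subset_saturation[OF P_prime K_ideal] ideal_zero_closed[OF K_ideal] by blast
next
  fix a b assume "a \<in> saturation P K" "b \<in> saturation P K"
  then obtain u v where u: "a \<in> carrier R" "u \<in> carrier R" "u \<notin> P" "u \<otimes> a \<in> K"
    and v: "b \<in> carrier R" "v \<in> carrier R" "v \<notin> P" "v \<otimes> b \<in> K"
    by (metis saturationE)
  have "(u \<otimes> v) \<otimes> (a \<oplus> b) = v \<otimes> (u \<otimes> a) \<oplus> u \<otimes> (v \<otimes> b)" using u v by algebra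
  also have "\<dots> \<in> K"
    using u v by (simp add: ideal_add_closed[OF K_ideal] ideal.I_l_closed[OF K_ideal])
  finally show "a \<oplus> b \<in> saturation P K"
    using primeideal.I_prime[OF P_prime] u v by (intro saturationI[of _ "u \<otimes> v"]) auto
next
  fix r a assume r_closed: "r \<in> carrier R" and "a \<in> saturation P K"
  then obtain u where u: "a \<in> carrier R" "u \<in> carrier R" "u \<notin> P" "u \<otimes> a \<in> K" by (metis saturationE)
  have "u \<otimes> (r \<otimes> a) = r \<otimes> (u \<otimes> a)" using u r_closed by algebra
  then show "r \<otimes> a \<in> saturation P K"
    using u r_closed ideal.I_l_closed[OF K_ideal] by (intro saturationI[of _ u]) auto
qed

lemma saturated_ideal_saturation:
  assumes P_prime: "primeideal P R" and K_ideal: "ideal K R"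
  shows "saturated_ideal P (saturation P K)"
proof -
  have "saturation P (saturation P K) \<subseteq> saturation P K"
  proof
    fix a assume "a \<in> saturation P (saturation P K)"
    then obtain u v where u: "a \<in> carrier R" "u \<in> carrier R" "u \<notin> P"
      and v: "v \<in> carrier R" "v \<notin> P" "v \<otimes> (u \<otimes> a) \<in> K"
      by (metis saturationE)
    then have "(v \<otimes> u) \<otimes> a \<in> K" by (simp add: m_assoc)
    then show "a \<in> saturation P K"
      using u v primeideal.I_prime[OF P_prime] by (intro saturationI[of _ "v \<otimes> u"]) auto
  qed
  then show ?thesis
    using saturation_ideal[OF P_prime K_ideal] unfolding saturated_ideal_def by blast
qed

lemma
  assumes P_prime: "primeideal P R" and I_ideal: "ideal I R" and w_closed: "w \<in> carrier R"
  shows saturated_ideal_saturation_adjoin: "saturated_ideal P (saturation P (adjoin_ideal I w))"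
    and subset_saturation_adjoin: "I \<subseteq> saturation P (adjoin_ideal I w)"
    and mem_saturation_adjoin: "w \<in> saturation P (adjoin_ideal I w)"
  using saturated_ideal_saturation[OF P_prime adjoin_ideal_ideal[OF I_ideal w_closed]]
    subset_saturation[OF P_prime adjoin_ideal_ideal[OF I_ideal w_closed]]
    subset_adjoin_ideal[OF I_ideal w_closed] mem_adjoin_ideal[OF I_ideal w_closed] by blast+

lemma saturated_ideal_imp_ideal: "saturated_ideal P K \<Longrightarrow> ideal K R"
  unfolding saturated_ideal_def by blast

lemma saturated_ideal_cancel:
  assumes "saturated_ideal P K" "u \<in> carrier R" "u \<notin> P" "a \<in> carrier R" "u \<otimes> a \<in> K"
  shows "a \<in> K"
  using assms saturationI[of a u P K] unfolding saturated_ideal_def by blast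

lemma saturation_minimal:
  assumes "saturated_ideal P L" "K \<subseteq> L"
  shows "saturation P K \<subseteq> L"
  using saturation_mono[OF assms(2), of P] assms(1) unfolding saturated_ideal_def by blast

lemma primeideal_saturated:
  assumes "primeideal p R" "p \<subseteq> q"
  shows "saturated_ideal q p"
  unfolding saturated_ideal_def
  using primeideal.axioms(1)[OF assms(1)] primeideal.I_prime[OF assms(1)] assms(2)
  by (auto elim!: saturationE)

lemma saturated_ideal_eq_if_adjoin_eq:
  assumes K_saturated: "saturated_ideal P K" and K'_saturated: "saturated_ideal P K'"
    and sub: "K' \<subseteq> K"
    and w: "w \<in> carrier R" "\<And>r. r \<in> P \<Longrightarrow> r \<otimes> w \<in> K'" "w \<in> K \<Longrightarrow> w \<in> K'"
    and eq: "saturation P (adjoin_ideal K w) \<subseteq> saturation P (adjoin_ideal K' w)"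
    and P_prime: "primeideal P R"
  shows "K = K'"
proof
  note K_ideal = saturated_ideal_imp_ideal[OF K_saturated]
    and K'_ideal = saturated_ideal_imp_ideal[OF K'_saturated]
  show "K \<subseteq> K'"
  proof
    fix a assume a_mem: "a \<in> K"
    then have "a \<in> saturation P (adjoin_ideal K' w)"
      using subset_adjoin_ideal[OF K_ideal w(1)] eq
        subset_saturation[OF P_prime adjoin_ideal_ideal[OF K_ideal w(1)]] by blast
    then obtain u b r where u: "a \<in> carrier R" "u \<in> carrier R" "u \<notin> P"
      and b: "b \<in> K'" "r \<in> carrier R" "u \<otimes> a = b \<oplus> r \<otimes> w"
      by (metis saturationE adjoin_idealE)
    have "b \<oplus> r \<otimes> w \<in> K" using b(3) ideal.I_l_closed[OF K_ideal a_mem u(2)] by simp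
    then have rw_mem: "r \<otimes> w \<in> K"
      using ideal_cancel_add[OF K_ideal] b(1,2) sub w(1) by blast
    have "r \<otimes> w \<in> K'"
    proof (cases "r \<in> P")
      case True
      then show ?thesis by (rule w(2))
    next
      case False
      then have "w \<in> K'"
        using saturated_ideal_cancel[OF K_saturated b(2) _ w(1) rw_mem] w(3) by blast
      then show ?thesis using ideal.I_l_closed[OF K'_ideal] b(2) by blast
    qed
    then have "u \<otimes> a \<in> K'" using b ideal_add_closed[OF K'_ideal] by simp
    then show "a \<in> K'" using saturated_ideal_cancel[OF K'_saturated u(2,3,1)] by blast
  qed
qed (rule sub)

lemma saturated_ideals_stationary_if_adjoin_stationary:
  fixes K :: "nat \<Rightarrow> 'a set"
  assumes P_prime: "primeideal P R" and K: "\<And>n. saturated_ideal P (K n)" "decseq K"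
    and w: "w \<in> carrier R" "\<And>r n. r \<in> P \<Longrightarrow> r \<otimes> w \<in> K n"
    and stationary:
      "\<exists>N. \<forall>n\<ge>N. saturation P (adjoin_ideal (K n) w) = saturation P (adjoin_ideal (K N) w)"
  shows "\<exists>N. \<forall>n\<ge>N. K n = K N"
proof -
  obtain N1 where N1: "\<And>n. n \<ge> N1 \<Longrightarrow>
      saturation P (adjoin_ideal (K n) w) = saturation P (adjoin_ideal (K N1) w)"
    using stationary by blast
  have "\<exists>N. \<forall>n\<ge>N. w \<in> K N \<longrightarrow> w \<in> K n" by (cases "\<forall>n. w \<in> K n") auto
  then obtain N2 where N2: "\<And>n. n \<ge> N2 \<Longrightarrow> w \<in> K N2 \<Longrightarrow> w \<in> K n" by blast
  define N where "N = max N1 N2"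
  have "K N = K n" if n: "n \<ge> N" for n
  proof (rule saturated_ideal_eq_if_adjoin_eq[OF K(1,1) _ w(1,2) _ _ P_prime])
    show "K n \<subseteq> K N" by (rule decseqD[OF K(2) n])
    show "saturation P (adjoin_ideal (K N) w) \<subseteq> saturation P (adjoin_ideal (K n) w)"
      using N1[of n] N1[of N] n unfolding N_def by simp
    show "w \<in> K n" if "w \<in> K N"
      using that N2[of n] decseqD[OF K(2), of N2 N] n unfolding N_def by auto
  qed
  then show ?thesis by metis
qed

lemma mem_saturated_ideal_if_mem_adjoin_mult:
  assumes q_prime: "primeideal q R" and M_saturated: "saturated_ideal q M" and z_mem: "z \<in> q"
    and a: "a \<in> saturation q (adjoin_ideal M (z \<otimes> a))"
  shows "a \<in> M"
proof -
  note q_ideal = primeideal.axioms(1)[OF q_prime]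
  obtain u m r where u: "a \<in> carrier R" "u \<in> carrier R" "u \<notin> q"
    and m: "m \<in> M" "r \<in> carrier R" "u \<otimes> a = m \<oplus> r \<otimes> (z \<otimes> a)"
    using a by (metis saturationE adjoin_idealE)
  have in_carrier: "z \<in> carrier R" "m \<in> carrier R"
    using ideal.Icarr[OF q_ideal z_mem] ideal.Icarr[OF saturated_ideal_imp_ideal[OF M_saturated] m(1)]
    by auto
  have "(u \<ominus> r \<otimes> z) \<otimes> a = u \<otimes> a \<ominus> r \<otimes> (z \<otimes> a)" using u(1,2) m(2) in_carrier by algebra
  also have "\<dots> = m" unfolding m(3) using u(1) m(2) in_carrier by algebra
  finally have "(u \<ominus> r \<otimes> z) \<otimes> a \<in> M" using m(1) by simp
  moreover have "u \<ominus> r \<otimes> z \<notin> q"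
  proof
    assume "u \<ominus> r \<otimes> z \<in> q"
    then have "(u \<ominus> r \<otimes> z) \<oplus> r \<otimes> z \<in> q"
      using ideal_add_closed[OF q_ideal] ideal.I_l_closed[OF q_ideal z_mem m(2)] by blast
    moreover have "(u \<ominus> r \<otimes> z) \<oplus> r \<otimes> z = u" using u(2) m(2) in_carrier by algebra
    ultimately show False using u(3) by simp
  qed
  ultimately show "a \<in> M"
    using saturated_ideal_cancel[OF M_saturated, of "u \<ominus> r \<otimes> z" a] in_carrier u m(2) by simp
qed

lemma prime_height_eq_zero_if_minimal:
  assumes minimal: "\<And>Q. primeideal Q R \<Longrightarrow> Q \<subseteq> P \<Longrightarrow> Q = P"
  shows "prime_height R P = 0"
proof -
  have "length ps - 1 = 0" if ps: "prime_chain R ps" "last ps = P" for ps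
  proof (cases ps rule: rev_cases)
    case (snoc qs P')
    have "qs = []"
    proof (rule ccontr)
      assume "qs \<noteq> []"
      then have "last qs \<in> set qs" by simp
      then have "primeideal (last qs) R" "last qs \<subset> P"
        using ps unfolding snoc prime_chain_def by (auto simp: sorted_wrt_append)
      then show False using minimal by blast
    qed
    then show ?thesis using snoc by simp
  qed simp
  then have "prime_height R P \<le> 0"
    unfolding prime_height_def by (intro Sup_least) (auto simp: zero_enat_def)
  then show ?thesis by simp
qed

lemma ideal_height_eq_zero_if_minimal_prime:
  assumes P_prime: "primeideal P R" and minimal: "\<And>Q. primeideal Q R \<Longrightarrow> Q \<subseteq> P \<Longrightarrow> Q = P"
  shows "ideal_height R P = 0"
proof -
  have "ideal_height R P \<le> prime_height R P"
    unfolding ideal_height_def by (rule Inf_lower) (use P_prime in auto)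
  then show ?thesis using prime_height_eq_zero_if_minimal[OF minimal] by simp
qed

end

section \<open>Noetherian rings\<close>

locale noetherian_cring = cring R + noetherian_ring R for R (structure)
begin

lemma exists_maximal_ideal_in:
  assumes "F \<noteq> {}" "\<And>K. K \<in> F \<Longrightarrow> ideal K R"
  shows "\<exists>M\<in>F. \<forall>K\<in>F. M \<subseteq> K \<longrightarrow> K = M"
proof (rule subset_Zorn_nonempty[OF assms(1)])
  fix C assume C: "C \<noteq> {}" "subset.chain F C"
  then have "subset.chain {I. ideal I R} C"
    using assms(2) by (auto simp: pred_on.chain_def)
  then have "\<Union>C \<in> C" using ideal_chain_is_trivial C(1) by blast
  then show "\<Union>C \<in> F" using C(2) unfolding pred_on.chain_def by blast
qed

lemma noetherian_ideal_induct [consumes 1, case_names larger]: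
  assumes I_ideal: "ideal I R"
    and step: "\<And>I. ideal I R \<Longrightarrow> (\<And>K. ideal K R \<Longrightarrow> I \<subset> K \<Longrightarrow> Q K) \<Longrightarrow> Q I"
  shows "Q I"
proof (rule ccontr)
  assume "\<not> Q I"
  then have "\<exists>M\<in>{K. ideal K R \<and> \<not> Q K}. \<forall>K\<in>{K. ideal K R \<and> \<not> Q K}. M \<subseteq> K \<longrightarrow> K = M"
    using I_ideal by (intro exists_maximal_ideal_in) auto
  then show False using step by blast
qed

lemma ascending_ideals_stationary:
  fixes I :: "nat \<Rightarrow> 'a set"
  assumes "\<And>n. ideal (I n) R" "incseq I"
  shows "\<exists>N. \<forall>n\<ge>N. I n = I N"
proof -
  have "\<exists>M\<in>range I. \<forall>K\<in>range I. M \<subseteq> K \<longrightarrow> K = M"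
    by (rule exists_maximal_ideal_in) (use assms(1) in auto)
  then obtain N where maximal: "\<forall>K\<in>range I. I N \<subseteq> K \<longrightarrow> K = I N" by (elim bexE imageE) simp
  have "I n = I N" if "n \<ge> N" for n using maximal incseqD[OF assms(2) that] by simp
  then show ?thesis by blast
qed

lemma exists_associated_prime:
  assumes L: "ideal L R" "L \<noteq> carrier R"
  shows "\<exists>w\<in>carrier R - L. primeideal {r \<in> carrier R. w \<otimes> r \<in> L} R"
proof -
  define colon where "colon w = {r \<in> carrier R. w \<otimes> r \<in> L}" for w
  have colon_ideal: "ideal (colon w) R" if "w \<in> carrier R" for w
    unfolding colon_def by (rule ideal.helper_max_prime[OF L(1) is_cring that])
  have "\<exists>M\<in>colon ` (carrier R - L). \<forall>K\<in>colon ` (carrier R - L). M \<subseteq> K \<longrightarrow> K = M"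
    using L ideal_subset_carrier[OF L(1)]
    by (intro exists_maximal_ideal_in) (auto simp: colon_ideal)
  then obtain w where w: "w \<in> carrier R" "w \<notin> L"
    and "\<forall>K\<in>colon ` (carrier R - L). colon w \<subseteq> K \<longrightarrow> K = colon w"
    by (auto simp only: bex_simps ball_simps Diff_iff)
  then have maximal: "colon v = colon w" if "v \<in> carrier R" "v \<notin> L" "colon w \<subseteq> colon v" for v
    using that by simp
  have "primeideal (colon w) R"
  proof (rule primeidealI[OF colon_ideal[OF w(1)] is_cring])
    have "\<one> \<notin> colon w" using w unfolding colon_def by simp
    then show "carrier R \<noteq> colon w" by blast
    fix a b assume ab: "a \<in> carrier R" "b \<in> carrier R" "a \<otimes> b \<in> colon w"
    show "a \<in> colon w \<or> b \<in> colon w"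
    proof (cases "b \<in> colon w")
      case False
      then have "w \<otimes> b \<notin> L" using ab(2) unfolding colon_def by simp
      moreover have "colon w \<subseteq> colon (w \<otimes> b)"
      proof
        fix r assume r: "r \<in> colon w"
        then have "w \<otimes> b \<otimes> r = b \<otimes> (w \<otimes> r)" using ab w unfolding colon_def by (auto simp: m_ac)
        then show "r \<in> colon (w \<otimes> b)"
          using r ab ideal.I_l_closed[OF L(1)] unfolding colon_def by auto
      qed
      ultimately have "colon (w \<otimes> b) = colon w" using maximal ab w by auto
      moreover have "a \<in> colon (w \<otimes> b)" using ab w unfolding colon_def by (auto simp: m_ac)
      ultimately show ?thesis by blast
    qed simp
  qed
  then show ?thesis using w unfolding colon_def by blast
qed

lemma exists_annihilated_by_minimal_prime:
  assumes minimal: "\<And>Q. primeideal Q R \<Longrightarrow> J \<subseteq> Q \<Longrightarrow> Q \<subseteq> P \<Longrightarrow> Q = P"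
    and L: "saturated_ideal P L" "J \<subseteq> L" "L \<noteq> carrier R"
  shows "\<exists>w\<in>carrier R - L. \<forall>r\<in>P. r \<otimes> w \<in> L"
proof -
  note L_ideal = saturated_ideal_imp_ideal[OF L(1)]
  obtain w where w: "w \<in> carrier R" "w \<notin> L" and prime: "primeideal {r \<in> carrier R. w \<otimes> r \<in> L} R"
    using exists_associated_prime[OF L_ideal L(3)] by blast
  have "{r \<in> carrier R. w \<otimes> r \<in> L} = P"
  proof (rule minimal[OF prime])
    show "J \<subseteq> {r \<in> carrier R. w \<otimes> r \<in> L}"
      using L(2) w(1) ideal.Icarr[OF L_ideal] ideal.I_l_closed[OF L_ideal] by auto
    show "{r \<in> carrier R. w \<otimes> r \<in> L} \<subseteq> P"
      using saturated_ideal_cancel[OF L(1) _ _ w(1)] w m_comm by fastforce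
  qed
  then show ?thesis using w m_comm by fastforce
qed

text \<open>In other words, the localisation of \<open>R/J\<close> at a minimal prime \<open>P\<close> of \<open>J\<close> is Artinian.\<close>

lemma descending_saturated_ideals_stationary:
  fixes K :: "nat \<Rightarrow> 'a set"
  assumes P_prime: "primeideal P R"
    and minimal: "\<And>Q. primeideal Q R \<Longrightarrow> J \<subseteq> Q \<Longrightarrow> Q \<subseteq> P \<Longrightarrow> Q = P"
    and L: "saturated_ideal P L" "J \<subseteq> L"
    and K: "\<And>n. saturated_ideal P (K n)" "\<And>n. L \<subseteq> K n" "decseq K"
  shows "\<exists>N. \<forall>n\<ge>N. K n = K N"
  using saturated_ideal_imp_ideal[OF L(1)] L K
proof (induction L arbitrary: K rule: noetherian_ideal_induct)
  case (larger L)
  note K_ideal = saturated_ideal_imp_ideal[OF larger.prems(3)]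
  show ?case
  proof (cases "L = carrier R")
    case True
    then have "K n = carrier R" for n
      using larger.prems(4) ideal_subset_carrier[OF K_ideal] by blast
    then show ?thesis by simp
  next
    case False
    then obtain w where w: "w \<in> carrier R" "w \<notin> L" and P_annihilates: "\<forall>r\<in>P. r \<otimes> w \<in> L"
      using exists_annihilated_by_minimal_prime[OF minimal larger.prems(1,2)] by blast
    define S where "S I = saturation P (adjoin_ideal I w)" for I
    note S_saturated = saturated_ideal_saturation_adjoin[OF P_prime _ w(1), folded S_def]
      and subset_S = subset_saturation_adjoin[OF P_prime larger.hyps w(1), folded S_def]
      and w_mem_S = mem_saturation_adjoin[OF P_prime larger.hyps w(1), folded S_def]
    have S_mono: "I \<subseteq> I' \<Longrightarrow> S I \<subseteq> S I'" for I I'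
      unfolding S_def by (intro saturation_mono adjoin_ideal_mono)
    have "\<exists>N. \<forall>n\<ge>N. S (K n) = S (K N)"
    proof (rule larger.IH)
      show "L \<subset> S L" using subset_S w_mem_S w(2) by blast
      show "J \<subseteq> S L" using larger.prems(2) subset_S by blast
      show "decseq (\<lambda>n. S (K n))" using larger.prems(5) S_mono by (simp add: decseq_def)
      show "saturated_ideal P (S L)" by (rule S_saturated[OF larger.hyps])
      then show "ideal (S L) R" by (rule saturated_ideal_imp_ideal)
      show "saturated_ideal P (S (K n))" for n by (rule S_saturated[OF K_ideal])
      show "S L \<subseteq> S (K n)" for n by (rule S_mono[OF larger.prems(4)])
    qed
    then show ?thesis
      unfolding S_def using P_annihilates larger.prems(4)
      by (intro saturated_ideals_stationary_if_adjoin_stationary[OF P_prime larger.prems(3,5) w(1)])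
        blast
  qed
qed

lemma nakayama_saturation:
  assumes q_prime: "primeideal q R" and L_ideal: "ideal L R" and N_ideal: "ideal N R"
    and gen: "N \<subseteq> saturation q (L <+>\<^bsub>R\<^esub> q \<cdot> N)"
  shows "N \<subseteq> saturation q L"
proof -
  note q_ideal = primeideal.axioms(1)[OF q_prime]
  have "N \<subseteq> M" if "saturated_ideal q M" "L \<subseteq> M" for M
    using saturated_ideal_imp_ideal[OF that(1)] that
  proof (induction M rule: noetherian_ideal_induct)
    case (larger M)
    note M = larger.hyps and M_sat = larger.prems(1)
    have "z \<otimes> a \<in> M" if z_mem: "z \<in> q" and a_mem: "a \<in> N" for z a
    proof (rule ccontr)
      assume za_notin: "z \<otimes> a \<notin> M"
      have in_carrier: "z \<in> carrier R" "a \<in> carrier R"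
        using ideal.Icarr[OF q_ideal z_mem] ideal.Icarr[OF N_ideal a_mem] by auto
      define K where "K = saturation q (adjoin_ideal M (z \<otimes> a))"
      have "saturated_ideal q K" "M \<subseteq> K" "z \<otimes> a \<in> K"
        using saturated_ideal_saturation_adjoin[OF q_prime M] subset_saturation_adjoin[OF q_prime M]
          mem_saturation_adjoin[OF q_prime M] in_carrier unfolding K_def by auto
      then have "N \<subseteq> K"
        using larger.prems(2) za_notin by (intro larger.IH) (auto intro: saturated_ideal_imp_ideal)
      then have "a \<in> M" using mem_saturated_ideal_if_mem_adjoin_mult[OF q_prime M_sat z_mem] a_mem
        unfolding K_def by blast
      then show False using za_notin ideal.I_l_closed[OF M] in_carrier by simp
    qed
    then have "L <+>\<^bsub>R\<^esub> q \<cdot> N \<subseteq> M"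
      by (intro ideal_sum_minimal ideal_prod_minimal M L_ideal
        larger.prems(2) ideal_prod_is_ideal q_ideal N_ideal)
    then show "N \<subseteq> M" using gen saturation_minimal[OF M_sat] by blast
  qed
  then show ?thesis
    using saturated_ideal_saturation[OF q_prime L_ideal] subset_saturation[OF q_prime L_ideal]
    by blast
qed

lemma subset_saturation_if_subset_saturation_adjoin:
  assumes P_prime: "primeideal P R" and I: "ideal I R" "I \<subseteq> N"
    and N_saturated: "saturated_ideal q N"
    and x: "x \<in> P" "x \<notin> q" and sub: "N \<subseteq> saturation P (adjoin_ideal I x)"
  shows "N \<subseteq> saturation P I"
proof (rule nakayama_saturation[OF P_prime I(1)], safe)
  show N_ideal: "ideal N R" by (rule saturated_ideal_imp_ideal[OF N_saturated])
  have x_closed: "x \<in> carrier R" by (rule ideal.Icarr[OF primeideal.axioms(1)[OF P_prime] x(1)])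
  fix a assume a_mem: "a \<in> N"
  then have "a \<in> saturation P (adjoin_ideal I x)" using sub by blast
  then obtain u b c where u: "a \<in> carrier R" "u \<in> carrier R" "u \<notin> P"
    and b: "b \<in> I" "c \<in> carrier R" "u \<otimes> a = b \<oplus> c \<otimes> x"
    by (metis saturationE adjoin_idealE)
  have "b \<oplus> c \<otimes> x \<in> N" using ideal.I_l_closed[OF N_ideal a_mem u(2)] b(3) by simp
  then have "c \<otimes> x \<in> N" using ideal_cancel_add[OF N_ideal] b(1,2) I(2) x_closed by blast
  then have "c \<in> N"
    using saturated_ideal_cancel[OF N_saturated x_closed x(2) b(2)] m_comm[OF b(2) x_closed] by simp
  then have "x \<otimes> c \<in> P \<cdot> N" by (rule ideal_prod.prod[OF x(1)])
  then have "u \<otimes> a \<in> I <+>\<^bsub>R\<^esub> P \<cdot> N"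
    using b m_comm[OF b(2) x_closed] unfolding set_add_def' by auto
  then show "a \<in> saturation P (I <+>\<^bsub>R\<^esub> P \<cdot> N)" by (rule saturationI[OF u])
qed

end

section \<open>Krull's principal ideal theorem\<close>

context cring
begin

text \<open>The contraction to \<open>R\<close> of the symbolic power \<open>(q/p)\<^sup>(\<^sup>n\<^sup>)\<close> of the domain \<open>R/p\<close>.\<close>

definition symbolic_power :: "'a set \<Rightarrow> 'a set \<Rightarrow> nat \<Rightarrow> 'a set" where
  "symbolic_power p q n = saturation q (p <+>\<^bsub>R\<^esub> ideal_pow R q n)"

lemma
  assumes p_prime: "primeideal p R" and q_prime: "primeideal q R"
  shows symbolic_power_saturated: "saturated_ideal q (symbolic_power p q n)"
    and subset_symbolic_power: "p \<subseteq> symbolic_power p q n" "ideal_pow R q n \<subseteq> symbolic_power p q n"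
    and symbolic_power_Suc_subset: "symbolic_power p q (Suc n) \<subseteq> symbolic_power p q n"
proof -
  note p_ideal = primeideal.axioms(1)[OF p_prime] and q_ideal = primeideal.axioms(1)[OF q_prime]
  note pow_ideal = ideal_pow_ideal[OF q_ideal]
  note sum_ideal = add_ideals[OF p_ideal pow_ideal]
  show "saturated_ideal q (symbolic_power p q n)"
    unfolding symbolic_power_def by (rule saturated_ideal_saturation[OF q_prime sum_ideal])
  show "p \<subseteq> symbolic_power p q n" "ideal_pow R q n \<subseteq> symbolic_power p q n"
    unfolding symbolic_power_def
    using subset_saturation[OF q_prime sum_ideal, of n] subset_ideal_sum[OF p_ideal pow_ideal, of n]
    by blast+
  have "p <+>\<^bsub>R\<^esub> ideal_pow R q (Suc n) \<subseteq> p <+>\<^bsub>R\<^esub> ideal_pow R q n"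
    by (intro set_add_mono ideal_pow_Suc_subset q_ideal subset_refl)
  then show "symbolic_power p q (Suc n) \<subseteq> symbolic_power p q n"
    unfolding symbolic_power_def by (rule saturation_mono)
qed

end

context noetherian_cring
begin

lemma symbolic_power_Suc_neq:
  assumes p_prime: "primeideal p R" and q_prime: "primeideal q R" and pq: "p \<subset> q"
  shows "symbolic_power p q (Suc n) \<noteq> symbolic_power p q n"
proof
  note p_ideal = primeideal.axioms(1)[OF p_prime] and q_ideal = primeideal.axioms(1)[OF q_prime]
  define A where "A n = p <+>\<^bsub>R\<^esub> ideal_pow R q n" for n
  have A: "ideal (A n) R" "p \<subseteq> A n" "ideal_pow R q n \<subseteq> A n" for n
    unfolding A_def using add_ideals[OF p_ideal ideal_pow_ideal[OF q_ideal]]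
      subset_ideal_sum[OF p_ideal ideal_pow_ideal[OF q_ideal]] by auto
  assume "symbolic_power p q (Suc n) = symbolic_power p q n"
  then have "A n \<subseteq> saturation q (A (Suc n))"
    using subset_saturation[OF q_prime A(1)[of n]] unfolding symbolic_power_def A_def by simp
  also have "A (Suc n) \<subseteq> p <+>\<^bsub>R\<^esub> q \<cdot> A n"
    unfolding A_def ideal_pow.simps
    by (intro set_add_mono ideal_prod_mono subset_refl subset_ideal_sum ideal_pow_ideal p_ideal q_ideal)
  then have "saturation q (A (Suc n)) \<subseteq> saturation q (p <+>\<^bsub>R\<^esub> q \<cdot> A n)" by (rule saturation_mono)
  finally have "A n \<subseteq> saturation q p" by (rule nakayama_saturation[OF q_prime p_ideal A(1)])
  also have "\<dots> \<subseteq> p"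
    using primeideal_saturated[OF p_prime, of q] pq unfolding saturated_ideal_def by blast
  finally have "ideal_pow R q n \<subseteq> p" using A(3) by blast
  moreover obtain y where y: "y \<in> q" "y \<notin> p" using pq by auto
  ultimately have "y [^] n \<in> p" using pow_mem_ideal_pow[OF q_ideal] by blast
  then show False
    using primeideal_nat_pow_mem[OF p_prime] ideal.Icarr[OF q_ideal y(1)] y(2) by blast
qed

lemma symbolic_power_Suc_eq:
  assumes p_prime: "primeideal p R" and q_prime: "primeideal q R" and P_prime: "primeideal P R"
    and qP: "q \<subseteq> P" and x: "x \<in> P" "x \<notin> q"
    and minimal: "\<And>Q. primeideal Q R \<Longrightarrow> adjoin_ideal p x \<subseteq> Q \<Longrightarrow> Q \<subseteq> P \<Longrightarrow> Q = P"
  shows "\<exists>n. symbolic_power p q (Suc n) = symbolic_power p q n"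
proof -
  define s where "s n = symbolic_power p q n" for n
  note s_sat = symbolic_power_saturated[OF p_prime q_prime, folded s_def]
    and s_dec = symbolic_power_Suc_subset[OF p_prime q_prime, folded s_def]
  note s_ideal = saturated_ideal_imp_ideal[OF s_sat]
  define K where "K I = saturation P (adjoin_ideal I x)" for I
  have x_closed: "x \<in> carrier R" by (rule ideal.Icarr[OF primeideal.axioms(1)[OF P_prime] x(1)])
  note K_sat = saturated_ideal_saturation_adjoin[OF P_prime _ x_closed, folded K_def]
    and subset_K = subset_saturation_adjoin[OF P_prime _ x_closed, folded K_def]
  have p_ideal: "ideal p R" by (rule primeideal.axioms(1)[OF p_prime])
  have K_mono: "I \<subseteq> I' \<Longrightarrow> K I \<subseteq> K I'" for I I'
    unfolding K_def by (intro saturation_mono adjoin_ideal_mono)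
  have "\<exists>N. \<forall>n\<ge>N. K (s n) = K (s N)"
  proof (rule descending_saturated_ideals_stationary[OF P_prime minimal])
    show "adjoin_ideal p x \<subseteq> K p"
      unfolding K_def
      by (rule subset_saturation[OF P_prime adjoin_ideal_ideal[OF p_ideal x_closed]])
    show "K p \<subseteq> K (s n)" for n
      unfolding s_def by (rule K_mono[OF subset_symbolic_power(1)[OF p_prime q_prime]])
    show "decseq (\<lambda>n. K (s n))" by (intro decseq_SucI K_mono s_dec)
  qed (use K_sat p_ideal s_ideal in auto)
  then obtain n where "K (s (Suc n)) = K (s n)" by (metis le_SucI order_refl)
  then have "s n \<subseteq> saturation P (s (Suc n))"
    using subset_K[OF s_ideal, of n]
    by (intro subset_saturation_if_subset_saturation_adjoin[OF P_prime s_ideal s_dec s_sat x])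
      (simp add: K_def)
  also have "\<dots> \<subseteq> s (Suc n)"
    using saturation_antimono[OF qP] s_sat unfolding saturated_ideal_def by blast
  finally show ?thesis using s_dec unfolding s_def by blast
qed

lemma exists_primeideal_between_containing:
  assumes p_prime: "primeideal p R" and q_prime: "primeideal q R" and P_prime: "primeideal P R"
    and pq: "p \<subset> q" and qP: "q \<subset> P" and x_mem: "x \<in> P"
  shows "\<exists>Q. primeideal Q R \<and> p \<subset> Q \<and> Q \<subset> P \<and> x \<in> Q"
proof (rule ccontr)
  assume none: "\<not> ?thesis"
  then have x_notin_q: "x \<notin> q" using q_prime pq qP by auto
  have x_closed: "x \<in> carrier R" by (rule ideal.Icarr[OF primeideal.axioms(1)[OF P_prime] x_mem])
  have minimal: "Q = P" if Q: "primeideal Q R" "adjoin_ideal p x \<subseteq> Q" "Q \<subseteq> P" for Q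
  proof -
    have "p \<subseteq> Q" "x \<in> Q"
      using subset_adjoin_ideal mem_adjoin_ideal primeideal.axioms(1)[OF p_prime] x_closed Q(2)
      by blast+
    moreover have "x \<notin> p" using x_notin_q pq by auto
    ultimately show ?thesis using none Q by blast
  qed
  show False
    using symbolic_power_Suc_eq[OF p_prime q_prime P_prime _ x_mem x_notin_q minimal]
      symbolic_power_Suc_neq[OF p_prime q_prime pq] pq qP
    by blast
qed

lemma exists_prime_chain_containing:
  assumes "prime_chain R (p # ps)" "ps \<noteq> []" "x \<in> last ps"
  shows "\<exists>qs. prime_chain R (p # qs) \<and> length qs = length ps \<and> last qs = last ps \<and> x \<in> hd qs"
  using assms
proof (induction ps arbitrary: p)
  case (Cons p1 ps)
  show ?case
  proof (cases ps)
    case Nil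
    then show ?thesis using Cons.prems by (intro exI[of _ "[p1]"]) simp
  next
    case (Cons p2 ps')
    have "prime_chain R (p1 # ps)" using Cons.prems(1) unfolding prime_chain_def by simp
    then obtain qs where qs: "prime_chain R (p1 # qs)" "length qs = length ps"
      "last qs = last ps" "x \<in> hd qs"
      using Cons.IH[of p1] Cons.prems(3) Cons by auto
    then obtain q qs' where q: "qs = q # qs'" using Cons by (cases qs) auto
    have "\<exists>Q. primeideal Q R \<and> p \<subset> Q \<and> Q \<subset> q \<and> x \<in> Q"
      by (rule exists_primeideal_between_containing[of p p1])
        (use Cons.prems(1) qs q in \<open>auto simp: prime_chain_def\<close>)
    then obtain Q where Q: "primeideal Q R" "p \<subset> Q" "Q \<subset> q" "x \<in> Q" by blast
    have "transp ((\<subset>) :: 'a set \<Rightarrow> 'a set \<Rightarrow> bool)" by (rule transpI) (rule psubset_trans)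
    then have "prime_chain R (p # Q # qs)"
      using Cons.prems(1) qs(1) Q unfolding q prime_chain_def
      by (auto simp: sorted_wrt2 simp del: sorted_wrt.simps(2))
    then show ?thesis using qs Q(4) q Cons by (intro exI[of _ "Q # qs"]) auto
  qed
qed simp

end

section \<open>Regular local rings are domains\<close>

lemma (in ring) maximalideal_max_ideal: "local_ring R \<Longrightarrow> maximalideal (max_ideal R) R"
  unfolding local_ring_def max_ideal_def by (rule theI') simp

context cring
begin

lemma proper_ideal_subset_max_ideal:
  assumes loc: "local_ring R" and I: "ideal I R" "\<one> \<notin> I"
  shows "I \<subseteq> max_ideal R"
proof -
  obtain M where M: "ideal M R" "I \<subseteq> M" "\<one> \<notin> M"
    and maximal: "\<And>K. ideal K R \<Longrightarrow> M \<subseteq> K \<Longrightarrow> \<one> \<notin> K \<Longrightarrow> K = M"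
    using exists_maximal_ideal_disjoint[OF I(1), of "{\<one>}"] I(2) by auto
  have "maximalideal M R"
  proof (rule maximalidealI[OF M(1)])
    show "carrier R \<noteq> M" using M(3) by auto
    show "J = M \<or> J = carrier R" if "ideal J R" "M \<subseteq> J" "J \<subseteq> carrier R" for J
      using maximal that ideal.one_imp_carrier[OF that(1)] by blast
  qed
  then have "M = max_ideal R"
    using loc maximalideal_max_ideal[OF loc] unfolding local_ring_def by metis
  then show ?thesis using M(2) by simp
qed

lemma Units_if_notin_max_ideal:
  assumes loc: "local_ring R" and u: "u \<in> carrier R" "u \<notin> max_ideal R"
  shows "u \<in> Units R"
proof -
  have "\<one> \<in> PIdl u"
    using proper_ideal_subset_max_ideal[OF loc cgenideal_ideal[OF u(1)]] cgenideal_self[OF u(1)] u(2)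
    by auto
  then obtain v where "v \<in> carrier R" "\<one> = v \<otimes> u" unfolding cgenideal_def by auto
  then show ?thesis using u(1) m_comm[of v u] unfolding Units_def by auto
qed

lemma ideal_saturated_max_ideal:
  assumes loc: "local_ring R" and I_ideal: "ideal I R"
  shows "saturated_ideal (max_ideal R) I"
  unfolding saturated_ideal_def
proof (intro conjI I_ideal subsetI)
  fix a assume "a \<in> saturation (max_ideal R) I"
  then obtain u where u: "a \<in> carrier R" "u \<in> carrier R" "u \<notin> max_ideal R" "u \<otimes> a \<in> I"
    by (rule saturationE)
  then have U: "u \<in> Units R" using Units_if_notin_max_ideal[OF loc] by blast
  then have "a = inv u \<otimes> (u \<otimes> a)" using u(1,2) by (simp flip: m_assoc)
  then show "a \<in> I" using ideal.I_l_closed[OF I_ideal u(4), of "inv u"] U by simp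
qed

lemma Idl_adjoin_ideal:
  assumes I_ideal: "ideal I R" and G: "G \<subseteq> carrier R" "x \<in> G"
  shows "Idl (adjoin_ideal I x \<union> (G - {x})) = Idl (I \<union> G)"
proof
  have x_closed: "x \<in> carrier R" using G by blast
  have in_carrier: "I \<union> G \<subseteq> carrier R" "adjoin_ideal I x \<union> (G - {x}) \<subseteq> carrier R"
    using ideal_subset_carrier[OF I_ideal]
      ideal_subset_carrier[OF adjoin_ideal_ideal[OF I_ideal x_closed]] G
    by auto
  note self = genideal_self[OF in_carrier(1)] genideal_self[OF in_carrier(2)]
  have "adjoin_ideal I x \<subseteq> Idl (I \<union> G)"
    by (rule adjoin_ideal_minimal[OF genideal_ideal[OF in_carrier(1)]]) (use self(1) G(2) in auto)
  then show "Idl (adjoin_ideal I x \<union> (G - {x})) \<subseteq> Idl (I \<union> G)"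
    by (intro genideal_minimal[OF genideal_ideal[OF in_carrier(1)]]) (use self(1) in auto)
  show "Idl (I \<union> G) \<subseteq> Idl (adjoin_ideal I x \<union> (G - {x}))"
    by (rule genideal_minimal[OF genideal_ideal[OF in_carrier(2)]])
      (use self(2) subset_adjoin_ideal[OF I_ideal x_closed]
        mem_adjoin_ideal[OF I_ideal x_closed] in auto)
qed

lemma exists_maximal_prime_chain:
  assumes loc: "local_ring R" and dim: "krull_dim R = enat d"
  shows "\<exists>ps. prime_chain R ps \<and> length ps = Suc d \<and> last ps = max_ideal R"
proof -
  define lengths where "lengths = {enat (length ps - 1) | ps. prime_chain R ps}"
  have m: "primeideal (max_ideal R) R"
    by (rule maximalideal_prime[OF maximalideal_max_ideal[OF loc]])
  have Sup: "Sup lengths = enat d" using dim unfolding krull_dim_def lengths_def .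
  have "prime_chain R [max_ideal R]" using m unfolding prime_chain_def by simp
  then have nonempty: "lengths \<noteq> {}" unfolding lengths_def by blast
  then have "finite lengths" "Max lengths = enat d"
    using Sup by (simp_all add: Sup_enat_def split: if_splits)
  then have "enat d \<in> lengths" using Max_in[of lengths] nonempty by simp
  then obtain ps where ps: "prime_chain R ps" "length ps = Suc d"
    unfolding lengths_def prime_chain_def by auto
  have bound: "length qs - 1 \<le> d" if "prime_chain R qs" for qs
    using Sup_upper[of "enat (length qs - 1)" lengths] that Sup unfolding lengths_def by auto
  have last: "primeideal (last ps) R" and sorted: "sorted_wrt (\<subset>) ps"
    using ps(1) unfolding prime_chain_def by auto
  have "last ps \<subseteq> max_ideal R"
    using proper_ideal_subset_max_ideal[OF loc primeideal.axioms(1)[OF last]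
      primeideal_one_notin[OF last]] .
  moreover have "\<not> last ps \<subset> max_ideal R"
  proof
    assume less: "last ps \<subset> max_ideal R"
    have "Q \<subseteq> last ps" if "Q \<in> set ps" for Q
      using sorted that by (induction ps) auto
    then have "prime_chain R (ps @ [max_ideal R])"
      using ps(1) m less unfolding prime_chain_def by (auto simp: sorted_wrt_append)
    then show False using bound[of "ps @ [max_ideal R]"] ps(2) by simp
  qed
  ultimately show ?thesis using ps by blast
qed

end

context noetherian_cring
begin

lemma prime_chain_start_subset:
  assumes loc: "local_ring R"
    and "ideal I R" "finite G" "G \<subseteq> carrier R" "Idl (I \<union> G) = max_ideal R"
    and "prime_chain R (p # ps)" "last (p # ps) = max_ideal R" "I \<subseteq> p" "card G \<le> length ps"
  shows "p \<subseteq> I"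
  using assms(2-)
proof (induction "length ps" arbitrary: I G p ps)
  case 0
  then have "p = Idl I" by simp
  then show ?case using genideal_minimal[OF 0(2)] by simp
next
  case (Suc d)
  note I = \<open>ideal I R\<close> and m = maximalideal_prime[OF maximalideal_max_ideal[OF loc]]
  have p_prime: "primeideal p R" using Suc.prems(5) unfolding prime_chain_def by simp
  have nonempty: "ps \<noteq> []" using Suc.hyps(2) by auto
  then have "p \<subset> max_ideal R"
    using Suc.prems(5,6) last_in_set[of ps] unfolding prime_chain_def by auto
  then have "\<not> I \<union> G \<subseteq> p"
    using genideal_minimal[OF primeideal.axioms(1)[OF p_prime]] Suc.prems(4) by blast
  then obtain x where x: "x \<in> G" "x \<notin> p" using Suc.prems(7) by blast
  have x_closed: "x \<in> carrier R" and x_mem_max: "x \<in> max_ideal R"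
    using x(1) Suc.prems(3) genideal_self[of "I \<union> G"] ideal_subset_carrier[OF I]
    unfolding Suc.prems(4)[symmetric] by auto
  obtain qs where qs: "prime_chain R (p # qs)" "length qs = length ps"
    "last qs = max_ideal R" "x \<in> hd qs"
    using exists_prime_chain_containing[OF Suc.prems(5) nonempty, of x] Suc.prems(6) nonempty x_mem_max
    by auto
  then obtain q qs' where q: "qs = q # qs'" using nonempty by (cases qs) auto
  have q_prime: "primeideal q R" and pq: "p \<subset> q" using qs(1) unfolding q prime_chain_def by auto
  have "q \<subseteq> adjoin_ideal I x"
  proof (rule Suc.hyps(1)[of qs' _ "G - {x}"])
    show "Idl (adjoin_ideal I x \<union> (G - {x})) = max_ideal R"
      using Idl_adjoin_ideal[OF I Suc.prems(3) x(1)] Suc.prems(4) by simp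
    show "adjoin_ideal I x \<subseteq> q"
      by (rule adjoin_ideal_minimal[OF primeideal.axioms(1)[OF q_prime]])
        (use pq Suc.prems(7) qs(4) q in auto)
    show "prime_chain R (q # qs')" using qs(1) unfolding q prime_chain_def by simp
    show "card (G - {x}) \<le> length qs'" using Suc.prems(2,8) x(1) qs(2) q by simp
  qed (use Suc.hyps(2) Suc.prems qs q adjoin_ideal_ideal[OF I x_closed] in auto)
  then have "p \<subseteq> saturation (max_ideal R) (adjoin_ideal I x)"
    using pq subset_saturation[OF m adjoin_ideal_ideal[OF I x_closed]] by blast
  then have "p \<subseteq> saturation (max_ideal R) I"
    using subset_saturation_if_subset_saturation_adjoin[OF m I Suc.prems(7) _ x_mem_max x(2)]
      primeideal_saturated[OF p_prime] by blast
  then show ?case using ideal_saturated_max_ideal[OF loc I] unfolding saturated_ideal_def by blast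
qed

lemma exists_emb_dim_generators:
  assumes "local_ring R"
  shows "\<exists>G. finite G \<and> card G = emb_dim R \<and> G \<subseteq> carrier R \<and> Idl G = max_ideal R"
proof -
  have "\<exists>n G. finite G \<and> card G = n \<and> G \<subseteq> carrier R \<and> Idl G = max_ideal R"
    using finetely_gen[OF maximalideal.axioms(1)[OF maximalideal_max_ideal[OF assms]]] by auto
  then show ?thesis unfolding emb_dim_def by (rule LeastI_ex)
qed

end

theorem regular_local_ring_domain:
  fixes R (structure)
  assumes reg: "regular_local_ring R"
  shows "domain R"
proof -
  have loc: "local_ring R" and noeth: "noetherian_ring R" and dim: "krull_dim R = enat (emb_dim R)"
    using reg unfolding regular_local_ring_def by auto
  interpret noetherian_cring R
    using loc noeth unfolding local_ring_def by (simp add: noetherian_cring_def)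
  obtain G where G: "finite G" "card G = emb_dim R" "G \<subseteq> carrier R" "Idl G = max_ideal R"
    using exists_emb_dim_generators[OF loc] by blast
  obtain p ps where ps: "prime_chain R (p # ps)" "length ps = emb_dim R" "last (p # ps) = max_ideal R"
    using exists_maximal_prime_chain[OF loc dim] by (metis length_Suc_conv)
  have p_prime: "primeideal p R" using ps(1) unfolding prime_chain_def by simp
  have zero: "{\<zero>} \<subseteq> p" using ideal_zero_closed[OF primeideal.axioms(1)[OF p_prime]] by simp
  have "Idl ({\<zero>} \<union> G) = max_ideal R"
  proof
    show "Idl ({\<zero>} \<union> G) \<subseteq> max_ideal R"
      using genideal_self[OF G(3)] genideal_ideal[OF G(3)] ideal_zero_closed
      unfolding G(4)[symmetric] by (intro genideal_minimal) auto
    show "max_ideal R \<subseteq> Idl ({\<zero>} \<union> G)"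
      unfolding G(4)[symmetric] by (rule subset_Idl_subset) (use G(3) in auto)
  qed
  then have "p \<subseteq> {\<zero>}"
    using prime_chain_start_subset[OF loc zeroideal G(1,3) _ ps(1,3) zero] G(2) ps(2) by simp
  then show ?thesis using zeroprimeideal_domainI p_prime zero by (simp add: subset_antisym)
qed

section \<open>Finitely generated modules over Noetherian rings\<close>

context module
begin

definition span :: "'c set \<Rightarrow> 'c set" where
  "span G = \<Inter>{N. submodule N R M \<and> G \<subseteq> N}"

lemma submodule_zero_closed: "submodule N R M \<Longrightarrow> \<zero>\<^bsub>M\<^esub> \<in> N"
  using subgroup.one_closed[of N "add_monoid M"] unfolding submodule_def by simp

lemma submodule_minus_closed:
  assumes "submodule N R M" "a \<in> N" "b \<in> N"
  shows "a \<ominus>\<^bsub>M\<^esub> b \<in> N"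
  using submoduleE(3,5)[OF assms(1)] assms(2,3) unfolding a_minus_def by blast

lemma submodule_finsum_closed:
  assumes "submodule N R M" "\<And>i. i \<in> A \<Longrightarrow> f i \<in> N"
  shows "finsum M f A \<in> N"
  using assms(2)
proof (induction A rule: infinite_finite_induct)
  case (insert x A)
  have "f \<in> A \<rightarrow> carrier M" "f x \<in> carrier M" using insert.prems submoduleE(1)[OF assms(1)] by auto
  then show ?case using insert submoduleE(5)[OF assms(1)] by auto
qed (simp_all add: submodule_zero_closed[OF assms(1)])

lemma submodule_if_closed:
  assumes "N \<subseteq> carrier M" "\<zero>\<^bsub>M\<^esub> \<in> N" "\<And>a b. a \<in> N \<Longrightarrow> b \<in> N \<Longrightarrow> a \<oplus>\<^bsub>M\<^esub> b \<in> N"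
    and smult: "\<And>c a. c \<in> carrier R \<Longrightarrow> a \<in> N \<Longrightarrow> c \<odot>\<^bsub>M\<^esub> a \<in> N"
  shows "submodule N R M"
proof (rule submoduleI)
  show "\<ominus>\<^bsub>M\<^esub> a \<in> N" if "a \<in> N" for a
  proof -
    have "\<ominus>\<^bsub>M\<^esub> a = (\<ominus> \<one>) \<odot>\<^bsub>M\<^esub> a" using that assms(1) by (simp add: smult_l_minus subset_iff)
    then show ?thesis using smult[OF _ that, of "\<ominus> \<one>"] by simp
  qed
qed (use assms in auto)

lemma submodule_Int:
  assumes "submodule N R M" "submodule N' R M"
  shows "submodule (N \<inter> N') R M"
  by (rule submoduleI)
    (use submoduleE[OF assms(1)] submoduleE[OF assms(2)] submodule_zero_closed assms in auto)

lemma subset_span: "G \<subseteq> span G"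
  unfolding span_def by blast

lemma span_minimal: "submodule N R M \<Longrightarrow> G \<subseteq> N \<Longrightarrow> span G \<subseteq> N"
  unfolding span_def by blast

lemma span_submodule:
  assumes "G \<subseteq> carrier M"
  shows "submodule (span G) R M"
proof (rule submoduleI)
  show "span G \<subseteq> carrier M" by (rule span_minimal[OF carrier_is_submodule assms])
qed (auto simp: span_def submodule_zero_closed submoduleE)

lemma span_insert_subset:
  assumes G_subset: "G \<subseteq> carrier M" and g_closed: "g \<in> carrier M"
  shows "span (insert g G) \<subseteq> {c \<odot>\<^bsub>M\<^esub> g \<oplus>\<^bsub>M\<^esub> v | c v. c \<in> carrier R \<and> v \<in> span G}" (is "_ \<subseteq> ?N")
proof (rule span_minimal)
  note span_G = span_submodule[OF G_subset]
  note span_carrier = subsetD[OF submoduleE(1)[OF span_G]]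
  have memI: "x \<in> ?N" if "x = c \<odot>\<^bsub>M\<^esub> g \<oplus>\<^bsub>M\<^esub> v" "c \<in> carrier R" "v \<in> span G" for x c v
    using that by blast
  show "submodule ?N R M"
  proof (rule submodule_if_closed)
    show "?N \<subseteq> carrier M" using g_closed span_carrier by auto
    show "\<zero>\<^bsub>M\<^esub> \<in> ?N"
      by (rule memI[of _ \<zero> "\<zero>\<^bsub>M\<^esub>"]) (use g_closed submodule_zero_closed[OF span_G] in auto)
  next
    fix x y assume "x \<in> ?N" "y \<in> ?N"
    then obtain c v d w where x: "c \<in> carrier R" "v \<in> span G" "x = c \<odot>\<^bsub>M\<^esub> g \<oplus>\<^bsub>M\<^esub> v"
      and y: "d \<in> carrier R" "w \<in> span G" "y = d \<odot>\<^bsub>M\<^esub> g \<oplus>\<^bsub>M\<^esub> w"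
      by blast
    have "x \<oplus>\<^bsub>M\<^esub> y = (c \<oplus> d) \<odot>\<^bsub>M\<^esub> g \<oplus>\<^bsub>M\<^esub> (v \<oplus>\<^bsub>M\<^esub> w)"
      using x y g_closed span_carrier by (simp add: smult_l_distr M.a_ac)
    then show "x \<oplus>\<^bsub>M\<^esub> y \<in> ?N" by (rule memI) (use x y submoduleE(5)[OF span_G] in auto)
  next
    fix r x assume r_closed: "r \<in> carrier R" and "x \<in> ?N"
    then obtain c v where x: "c \<in> carrier R" "v \<in> span G" "x = c \<odot>\<^bsub>M\<^esub> g \<oplus>\<^bsub>M\<^esub> v" by blast
    have "r \<odot>\<^bsub>M\<^esub> x = (r \<otimes> c) \<odot>\<^bsub>M\<^esub> g \<oplus>\<^bsub>M\<^esub> r \<odot>\<^bsub>M\<^esub> v"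
      using r_closed x g_closed span_carrier by (simp add: smult_r_distr smult_assoc1)
    then show "r \<odot>\<^bsub>M\<^esub> x \<in> ?N" by (rule memI) (use r_closed x submoduleE(4)[OF span_G] in auto)
  qed
  show "insert g G \<subseteq> ?N"
  proof (intro insert_subsetI subsetI)
    show "g \<in> ?N"
      by (rule memI[of _ \<one> "\<zero>\<^bsub>M\<^esub>"]) (use g_closed submodule_zero_closed[OF span_G] in auto)
    fix x assume x: "x \<in> G"
    then show "x \<in> ?N"
      by (intro memI[of _ \<zero> x]) (use g_closed G_subset subset_span in auto)
  qed
qed

definition leading_ideal :: "'c \<Rightarrow> 'c set \<Rightarrow> 'c set \<Rightarrow> 'a set" where
  "leading_ideal g F N = {c \<in> carrier R. \<exists>v\<in>F. c \<odot>\<^bsub>M\<^esub> g \<oplus>\<^bsub>M\<^esub> v \<in> N}"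

lemma leading_ideal_ideal:
  assumes F_submodule: "submodule F R M" and N_submodule: "submodule N R M"
    and g_closed: "g \<in> carrier M"
  shows "ideal (leading_ideal g F N) R"
proof (rule R.cring_idealI)
  show "leading_ideal g F N \<subseteq> carrier R" unfolding leading_ideal_def by auto
  show "\<zero> \<in> leading_ideal g F N"
    unfolding leading_ideal_def using submodule_zero_closed[OF F_submodule]
      submodule_zero_closed[OF N_submodule] g_closed
    by (auto intro!: bexI[of _ "\<zero>\<^bsub>M\<^esub>"])
next
  note F_carrier = subsetD[OF submoduleE(1)[OF F_submodule]]
  fix c d assume "c \<in> leading_ideal g F N" "d \<in> leading_ideal g F N"
  then obtain v w where v: "c \<in> carrier R" "v \<in> F" "c \<odot>\<^bsub>M\<^esub> g \<oplus>\<^bsub>M\<^esub> v \<in> N"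
    and w: "d \<in> carrier R" "w \<in> F" "d \<odot>\<^bsub>M\<^esub> g \<oplus>\<^bsub>M\<^esub> w \<in> N" unfolding leading_ideal_def by auto
  have "(c \<oplus> d) \<odot>\<^bsub>M\<^esub> g \<oplus>\<^bsub>M\<^esub> (v \<oplus>\<^bsub>M\<^esub> w) = (c \<odot>\<^bsub>M\<^esub> g \<oplus>\<^bsub>M\<^esub> v) \<oplus>\<^bsub>M\<^esub> (d \<odot>\<^bsub>M\<^esub> g \<oplus>\<^bsub>M\<^esub> w)"
    using v w g_closed F_carrier by (simp add: smult_l_distr M.a_ac)
  then show "c \<oplus> d \<in> leading_ideal g F N"
    unfolding leading_ideal_def using v w submoduleE(5)[OF N_submodule] submoduleE(5)[OF F_submodule]
    by (auto intro!: bexI[of _ "v \<oplus>\<^bsub>M\<^esub> w"])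
next
  note F_carrier = subsetD[OF submoduleE(1)[OF F_submodule]]
  fix r c assume r_closed: "r \<in> carrier R" and "c \<in> leading_ideal g F N"
  then obtain v where v: "c \<in> carrier R" "v \<in> F" "c \<odot>\<^bsub>M\<^esub> g \<oplus>\<^bsub>M\<^esub> v \<in> N"
    unfolding leading_ideal_def by auto
  have "(r \<otimes> c) \<odot>\<^bsub>M\<^esub> g \<oplus>\<^bsub>M\<^esub> r \<odot>\<^bsub>M\<^esub> v = r \<odot>\<^bsub>M\<^esub> (c \<odot>\<^bsub>M\<^esub> g \<oplus>\<^bsub>M\<^esub> v)"
    using r_closed v g_closed F_carrier by (simp add: smult_r_distr smult_assoc1)
  then show "r \<otimes> c \<in> leading_ideal g F N"
    unfolding leading_ideal_def using r_closed v submoduleE(4)[OF N_submodule]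
      submoduleE(4)[OF F_submodule]
    by (auto intro!: bexI[of _ "r \<odot>\<^bsub>M\<^esub> v"])
qed

lemma submodule_eq_if_leading_ideal_eq:
  assumes F_submodule: "submodule F R M" and N_submodule: "submodule N R M"
    and N'_submodule: "submodule N' R M"
    and g_closed: "g \<in> carrier M" and sub: "N \<subseteq> N'"
    and N'_sub: "N' \<subseteq> {c \<odot>\<^bsub>M\<^esub> g \<oplus>\<^bsub>M\<^esub> v | c v. c \<in> carrier R \<and> v \<in> F}"
    and Int: "N' \<inter> F \<subseteq> N" and leading: "leading_ideal g F N' \<subseteq> leading_ideal g F N"
  shows "N = N'"
proof (intro equalityI sub subsetI)
  fix a assume a: "a \<in> N'"
  then obtain c v where cv: "c \<in> carrier R" "v \<in> F" "a = c \<odot>\<^bsub>M\<^esub> g \<oplus>\<^bsub>M\<^esub> v" using N'_sub by blast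
  then have "c \<in> leading_ideal g F N'" using a unfolding leading_ideal_def by blast
  then obtain w where w: "w \<in> F" "c \<odot>\<^bsub>M\<^esub> g \<oplus>\<^bsub>M\<^esub> w \<in> N"
    using leading unfolding leading_ideal_def by blast
  define b where "b = c \<odot>\<^bsub>M\<^esub> g \<oplus>\<^bsub>M\<^esub> w"
  have in_carrier: "v \<in> carrier M" "w \<in> carrier M" "c \<odot>\<^bsub>M\<^esub> g \<in> carrier M"
    using submoduleE(1)[OF F_submodule] cv w(1) g_closed by auto
  have "a \<ominus>\<^bsub>M\<^esub> b = v \<ominus>\<^bsub>M\<^esub> w"
    unfolding cv(3) b_def using in_carrier
    by (simp add: a_minus_def M.minus_add M.a_ac M.r_neg M.r_neg1 M.r_neg2)
  then have "a \<ominus>\<^bsub>M\<^esub> b \<in> F" using submodule_minus_closed[OF F_submodule cv(2) w(1)] by simp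
  moreover have "a \<ominus>\<^bsub>M\<^esub> b \<in> N'"
    using submodule_minus_closed[OF N'_submodule a] w(2) sub unfolding b_def by blast
  ultimately have "(a \<ominus>\<^bsub>M\<^esub> b) \<oplus>\<^bsub>M\<^esub> b \<in> N"
    using Int submoduleE(5)[OF N_submodule] w(2) unfolding b_def by blast
  moreover have "(a \<ominus>\<^bsub>M\<^esub> b) \<oplus>\<^bsub>M\<^esub> b = a"
    unfolding cv(3) b_def using in_carrier by (simp add: a_minus_def M.a_assoc M.l_neg)
  ultimately show "a \<in> N" by simp
qed

theorem ascending_submodules_stationary:
  fixes N :: "nat \<Rightarrow> 'c set"
  assumes noeth: "noetherian_ring R" and "finite G" "G \<subseteq> carrier M"
    and "\<And>n. submodule (N n) R M" "\<And>n. N n \<subseteq> span G" "incseq N"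
  shows "\<exists>k. \<forall>n\<ge>k. N n = N k"
  using assms(2-)
proof (induction G arbitrary: N)
  case empty
  have "submodule {\<zero>\<^bsub>M\<^esub>} R M" by (rule submoduleI) auto
  then have "N n = {\<zero>\<^bsub>M\<^esub>}" for n
    using span_minimal[of "{\<zero>\<^bsub>M\<^esub>}" "{}"] empty.prems(3)[of n]
      submodule_zero_closed[OF empty.prems(2)[of n]]
    by auto
  then show ?case by simp
next
  case (insert g G)
  interpret R: noetherian_cring R
    using noeth R.cring_axioms by (simp add: noetherian_cring_def)
  have G_subset: "G \<subseteq> carrier M" and g_closed: "g \<in> carrier M" using insert.prems(1) by auto
  note F = span_submodule[OF G_subset]
  have "\<exists>k. \<forall>n\<ge>k. N n \<inter> span G = N k \<inter> span G"
    using insert.prems(4)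
    by (intro insert.IH[OF G_subset] submodule_Int insert.prems F) (auto simp: incseq_def)
  then obtain k1 where k1: "\<And>n. n \<ge> k1 \<Longrightarrow> N n \<inter> span G = N k1 \<inter> span G" by auto
  have "incseq (\<lambda>n. leading_ideal g (span G) (N n))"
    using insert.prems(4) unfolding incseq_def leading_ideal_def by blast
  then obtain k2 where k2: "\<And>n. n \<ge> k2 \<Longrightarrow>
      leading_ideal g (span G) (N n) = leading_ideal g (span G) (N k2)"
    using R.ascending_ideals_stationary[of "\<lambda>n. leading_ideal g (span G) (N n)"]
      leading_ideal_ideal[OF F insert.prems(2) g_closed] by blast
  define k where "k = max k1 k2"
  have "N k = N n" if n: "n \<ge> k" for n
  proof (rule submodule_eq_if_leading_ideal_eq[OF F insert.prems(2,2) g_closed])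
    show "N k \<subseteq> N n" by (rule incseqD[OF insert.prems(4) n])
    show "N n \<subseteq> {c \<odot>\<^bsub>M\<^esub> g \<oplus>\<^bsub>M\<^esub> v | c v. c \<in> carrier R \<and> v \<in> span G}"
      using insert.prems(3) span_insert_subset[OF G_subset g_closed] by blast
    show "N n \<inter> span G \<subseteq> N k" using k1[of n] k1[of k] n unfolding k_def by auto
    show "leading_ideal g (span G) (N n) \<subseteq> leading_ideal g (span G) (N k)"
      using k2[of n] k2[of k] n unfolding k_def by auto
  qed
  then show ?case by metis
qed

end

definition restrict_scalars :: "('b, 'n) ring_scheme \<Rightarrow> ('a \<Rightarrow> 'b) \<Rightarrow> ('a, 'b) module" where
  "restrict_scalars S h =
    \<lparr>carrier = carrier S, monoid.mult = monoid.mult S, monoid.one = \<one>\<^bsub>S\<^esub>,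
     ring.zero = \<zero>\<^bsub>S\<^esub>, ring.add = ring.add S, smult = (\<lambda>c x. h c \<otimes>\<^bsub>S\<^esub> x)\<rparr>"

lemma restrict_scalars_simps [simp]:
  "carrier (restrict_scalars S h) = carrier S"
  "\<zero>\<^bsub>restrict_scalars S h\<^esub> = \<zero>\<^bsub>S\<^esub>"
  "ring.add (restrict_scalars S h) = ring.add S"
  "c \<odot>\<^bsub>restrict_scalars S h\<^esub> x = h c \<otimes>\<^bsub>S\<^esub> x"
  by (simp_all add: restrict_scalars_def)

lemma a_inv_restrict_scalars [simp]: "\<ominus>\<^bsub>restrict_scalars S h\<^esub> x = \<ominus>\<^bsub>S\<^esub> x"
  by (simp add: a_inv_def m_inv_def)

lemma finsum_restrict_scalars [simp]: "finsum (restrict_scalars S h) f A = finsum S f A"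
  by (simp add: finsum_def finprod_def)

sublocale ring_hom_cring \<subseteq> scalars: module R "restrict_scalars S h"
proof (rule moduleI[OF R.is_cring])
  show "abelian_group (restrict_scalars S h)"
  proof (rule abelian_groupI)
    fix x assume "x \<in> carrier (restrict_scalars S h)"
    then show "\<exists>y\<in>carrier (restrict_scalars S h).
        y \<oplus>\<^bsub>restrict_scalars S h\<^esub> x = \<zero>\<^bsub>restrict_scalars S h\<^esub>"
      by (intro bexI[of _ "\<ominus>\<^bsub>S\<^esub> x"]) (auto simp: S.l_neg)
  qed (auto simp: S.a_ac)
qed (auto simp: S.l_distr S.r_distr S.m_assoc)

context ring_hom_cring
begin

lemma submodule_restrict_scalarsI:
  assumes "N \<subseteq> carrier S" "\<zero>\<^bsub>S\<^esub> \<in> N" "\<And>a b. a \<in> N \<Longrightarrow> b \<in> N \<Longrightarrow> a \<oplus>\<^bsub>S\<^esub> b \<in> N"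
    and "\<And>c a. c \<in> carrier R \<Longrightarrow> a \<in> N \<Longrightarrow> h c \<otimes>\<^bsub>S\<^esub> a \<in> N"
  shows "submodule N R (restrict_scalars S h)"
  by (rule scalars.submodule_if_closed) (use assms in auto)

definition linear_combinations :: "'c set \<Rightarrow> 'c set" where
  "linear_combinations G = {\<Oplus>\<^bsub>S\<^esub>g\<in>G. h (c g) \<otimes>\<^bsub>S\<^esub> g | c. c \<in> G \<rightarrow> carrier R}"

lemma linear_combinationsI:
  "c \<in> G \<rightarrow> carrier R \<Longrightarrow> a = (\<Oplus>\<^bsub>S\<^esub>g\<in>G. h (c g) \<otimes>\<^bsub>S\<^esub> g) \<Longrightarrow> a \<in> linear_combinations G"
  unfolding linear_combinations_def by (intro CollectI exI conjI)

lemma linear_combinationsE: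
  assumes "a \<in> linear_combinations G"
  obtains c where "c \<in> G \<rightarrow> carrier R" "a = (\<Oplus>\<^bsub>S\<^esub>g\<in>G. h (c g) \<otimes>\<^bsub>S\<^esub> g)"
  using assms unfolding linear_combinations_def by (elim CollectE exE conjE)

lemma linear_combinations_submodule:
  assumes G: "finite G" "G \<subseteq> carrier S"
  shows "submodule (linear_combinations G) R (restrict_scalars S h)"
proof (rule submodule_restrict_scalarsI)
  have "(\<lambda>g. h (c g) \<otimes>\<^bsub>S\<^esub> g) \<in> G \<rightarrow> carrier S" if "c \<in> G \<rightarrow> carrier R" for c
    using that G(2) by auto
  then show "linear_combinations G \<subseteq> carrier S"
    by (auto elim!: linear_combinationsE intro: S.finsum_closed)
  have "(\<Oplus>\<^bsub>S\<^esub>g\<in>G. h \<zero> \<otimes>\<^bsub>S\<^esub> g) = (\<Oplus>\<^bsub>S\<^esub>g\<in>G. \<zero>\<^bsub>S\<^esub>)"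
    by (rule S.finsum_cong') (use G(2) in auto)
  then show "\<zero>\<^bsub>S\<^esub> \<in> linear_combinations G" by (intro linear_combinationsI[of "\<lambda>g. \<zero>"]) auto
next
  fix a b assume "a \<in> linear_combinations G" "b \<in> linear_combinations G"
  then obtain c d where c: "c \<in> G \<rightarrow> carrier R" "a = (\<Oplus>\<^bsub>S\<^esub>g\<in>G. h (c g) \<otimes>\<^bsub>S\<^esub> g)"
    and d: "d \<in> G \<rightarrow> carrier R" "b = (\<Oplus>\<^bsub>S\<^esub>g\<in>G. h (d g) \<otimes>\<^bsub>S\<^esub> g)"
    by (elim linear_combinationsE)
  have "(\<Oplus>\<^bsub>S\<^esub>g\<in>G. h (c g \<oplus> d g) \<otimes>\<^bsub>S\<^esub> g) = (\<Oplus>\<^bsub>S\<^esub>g\<in>G. h (c g) \<otimes>\<^bsub>S\<^esub> g \<oplus>\<^bsub>S\<^esub> h (d g) \<otimes>\<^bsub>S\<^esub> g)"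
    by (rule S.finsum_cong') (use c(1) d(1) G(2) in \<open>auto simp: S.l_distr Pi_iff subset_iff\<close>)
  also have "\<dots> = a \<oplus>\<^bsub>S\<^esub> b"
    unfolding c(2) d(2) by (rule S.finsum_addf) (use c(1) d(1) G(2) in auto)
  finally show "a \<oplus>\<^bsub>S\<^esub> b \<in> linear_combinations G"
    using c(1) d(1) by (intro linear_combinationsI[of "\<lambda>g. c g \<oplus> d g"]) auto
next
  fix r a assume r_closed: "r \<in> carrier R" and "a \<in> linear_combinations G"
  then obtain c where c: "c \<in> G \<rightarrow> carrier R" "a = (\<Oplus>\<^bsub>S\<^esub>g\<in>G. h (c g) \<otimes>\<^bsub>S\<^esub> g)"
    by (elim linear_combinationsE)
  have "h r \<otimes>\<^bsub>S\<^esub> a = (\<Oplus>\<^bsub>S\<^esub>g\<in>G. h r \<otimes>\<^bsub>S\<^esub> (h (c g) \<otimes>\<^bsub>S\<^esub> g))"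
    unfolding c(2) by (rule S.finsum_rdistr[OF G(1)]) (use r_closed c(1) G(2) in auto)
  also have "\<dots> = (\<Oplus>\<^bsub>S\<^esub>g\<in>G. h (r \<otimes> c g) \<otimes>\<^bsub>S\<^esub> g)"
    by (rule S.finsum_cong') (use r_closed c(1) G(2) in \<open>auto simp: S.m_assoc Pi_iff subset_iff\<close>)
  finally show "h r \<otimes>\<^bsub>S\<^esub> a \<in> linear_combinations G"
    using r_closed c(1) by (intro linear_combinationsI[of "\<lambda>g. r \<otimes> c g"]) auto
qed

lemma span_subset_linear_combinations:
  assumes G: "finite G" "G \<subseteq> carrier S"
  shows "scalars.span G \<subseteq> linear_combinations G"
proof (rule scalars.span_minimal[OF linear_combinations_submodule[OF G]])
  show "G \<subseteq> linear_combinations G"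
  proof
    fix x assume x_mem: "x \<in> G"
    have "(\<Oplus>\<^bsub>S\<^esub>g\<in>G. h (if x = g then \<one> else \<zero>) \<otimes>\<^bsub>S\<^esub> g) = (\<Oplus>\<^bsub>S\<^esub>g\<in>G. if x = g then g else \<zero>\<^bsub>S\<^esub>)"
      by (rule S.finsum_cong') (use G(2) in auto)
    also have "\<dots> = x" by (rule S.finsum_singleton[OF x_mem G(1)]) (use G(2) in auto)
    finally show "x \<in> linear_combinations G"
      by (intro linear_combinationsI[of "\<lambda>g. if x = g then \<one> else \<zero>"]) auto
  qed
qed

lemma module_finite_via_iff_span:
  "module_finite_via R S h \<longleftrightarrow> (\<exists>G. finite G \<and> G \<subseteq> carrier S \<and> carrier S \<subseteq> scalars.span G)"
proof
  assume "module_finite_via R S h"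
  then obtain G where G: "finite G" "G \<subseteq> carrier S"
    and gen: "\<forall>s\<in>carrier S. \<exists>c. (\<forall>g\<in>G. c g \<in> carrier R) \<and> s = (\<Oplus>\<^bsub>S\<^esub>g\<in>G. h (c g) \<otimes>\<^bsub>S\<^esub> g)"
    unfolding module_finite_via_def by blast
  have "s \<in> scalars.span G" if s_closed: "s \<in> carrier S" for s
  proof -
    note span_G = scalars.span_submodule[of G, unfolded restrict_scalars_simps, OF G(2)]
    obtain c where c: "\<forall>g\<in>G. c g \<in> carrier R" "s = (\<Oplus>\<^bsub>S\<^esub>g\<in>G. h (c g) \<otimes>\<^bsub>S\<^esub> g)"
      using bspec[OF gen s_closed] by (elim exE conjE)
    then show ?thesis
      using scalars.submodule_finsum_closed[OF span_G, of G "\<lambda>g. h (c g) \<otimes>\<^bsub>S\<^esub> g"]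
        scalars.submoduleE(4)[OF span_G] scalars.subset_span[of G] by auto
  qed
  then show "\<exists>G. finite G \<and> G \<subseteq> carrier S \<and> carrier S \<subseteq> scalars.span G" using G by blast
next
  assume "\<exists>G. finite G \<and> G \<subseteq> carrier S \<and> carrier S \<subseteq> scalars.span G"
  then obtain G where G: "finite G" "G \<subseteq> carrier S" and gen: "carrier S \<subseteq> scalars.span G" by blast
  have "\<exists>c. (\<forall>g\<in>G. c g \<in> carrier R) \<and> s = (\<Oplus>\<^bsub>S\<^esub>g\<in>G. h (c g) \<otimes>\<^bsub>S\<^esub> g)" if "s \<in> carrier S" for s
    using subsetD[OF span_subset_linear_combinations[OF G] subsetD[OF gen that]]
    by (elim linear_combinationsE) (intro exI conjI ballI, auto)
  then show "module_finite_via R S h" unfolding module_finite_via_def using G by blast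
qed

lemma module_finite_via_surj:
  assumes f_hom: "ring_hom_cring S T f" and surj: "carrier T \<subseteq> f ` carrier S"
    and fin: "module_finite_via R S h"
  shows "module_finite_via R T (\<lambda>x. f (h x))"
proof -
  interpret f: ring_hom_cring S T f by (rule f_hom)
  interpret fh: ring_hom_cring R T "\<lambda>x. f (h x)"
    by unfold_locales (auto intro!: ring_hom_memI)
  obtain G where G: "finite G" "G \<subseteq> carrier S" "carrier S \<subseteq> scalars.span G"
    using fin module_finite_via_iff_span by blast
  have fG_subset: "f ` G \<subseteq> carrier T" using G(2) by auto
  note span_fG = fh.scalars.span_submodule[of "f ` G", unfolded restrict_scalars_simps, OF fG_subset]
  have "submodule {s \<in> carrier S. f s \<in> fh.scalars.span (f ` G)} R (restrict_scalars S h)"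
    by (rule submodule_restrict_scalarsI)
      (use fh.scalars.submodule_zero_closed[OF span_fG] fh.scalars.submoduleE(4,5)[OF span_fG] in auto)
  then have "scalars.span G \<subseteq> {s \<in> carrier S. f s \<in> fh.scalars.span (f ` G)}"
    by (rule scalars.span_minimal) (use G(2) fh.scalars.subset_span[of "f ` G"] in auto)
  then have "carrier T \<subseteq> fh.scalars.span (f ` G)" using surj G(3) by blast
  then show ?thesis using G(1) fG_subset fh.module_finite_via_iff_span by blast
qed

end

section \<open>Division by monic polynomials\<close>

lemma (in cring) ideal_finsum_closed:
  assumes "ideal I R" "\<And>i. i \<in> A \<Longrightarrow> f i \<in> I"
  shows "finsum R f A \<in> I"
  using assms(2)
proof (induction A rule: infinite_finite_induct)
  case (insert x A)
  have "f \<in> A \<rightarrow> carrier R" "f x \<in> carrier R" using insert.prems ideal.Icarr[OF assms(1)] by auto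
  then show ?case using insert ideal_add_closed[OF assms(1)] by auto
qed (simp_all add: ideal_zero_closed[OF assms(1)])

context UP_cring
begin

abbreviation pcoeff :: "(nat \<Rightarrow> 'a) \<Rightarrow> nat \<Rightarrow> 'a" where
  "pcoeff \<equiv> up_ring.coeff P"

abbreviation pconst :: "'a \<Rightarrow> nat \<Rightarrow> 'a" where
  "pconst c \<equiv> up_ring.monom P c 0"

abbreviation linear_factor :: "'a \<Rightarrow> nat \<Rightarrow> 'a" where
  "linear_factor c \<equiv> up_ring.monom P \<one> 1 \<ominus>\<^bsub>P\<^esub> pconst c"

definition monic :: "nat \<Rightarrow> (nat \<Rightarrow> 'a) \<Rightarrow> bool" where
  "monic n p \<longleftrightarrow> p \<in> carrier P \<and> pcoeff p n = \<one> \<and> (\<forall>i>n. pcoeff p i = \<zero>)"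

definition polys_below :: "nat \<Rightarrow> (nat \<Rightarrow> 'a) set" where
  "polys_below n = {p \<in> carrier P. \<forall>i\<ge>n. pcoeff p i = \<zero>}"

definition poly_ideal :: "'a set \<Rightarrow> (nat \<Rightarrow> 'a) set" where
  "poly_ideal I = {p \<in> carrier P. \<forall>i. pcoeff p i \<in> I}"

lemma monic_closed: "monic n p \<Longrightarrow> p \<in> carrier P"
  unfolding monic_def by blast

lemma exists_poly_with_coeffs:
  assumes "\<And>i. a i \<in> carrier R" "\<And>i. i \<ge> n \<Longrightarrow> a i = \<zero>"
  shows "\<exists>p\<in>carrier P. \<forall>i. pcoeff p i = a i"
proof -
  have "bound \<zero> n a" using assms(2) by (simp add: bound_def)
  then have "a \<in> up R" using assms(1) by auto
  then show ?thesis unfolding P_def by (intro bexI[of _ a]) (auto simp: UP_def)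
qed

lemma poly_ideal_ideal:
  assumes I_ideal: "ideal I R"
  shows "ideal (poly_ideal I) P"
proof (rule P.cring_idealI)
  fix p q assume p_closed: "p \<in> carrier P" and q: "q \<in> poly_ideal I"
  have "(\<Oplus>i\<in>{..n}. pcoeff p i \<otimes> pcoeff q (n - i)) \<in> I" for n
    by (rule R.ideal_finsum_closed[OF I_ideal])
      (use p_closed q ideal.I_l_closed[OF I_ideal] in \<open>auto simp: poly_ideal_def\<close>)
  then show "p \<otimes>\<^bsub>P\<^esub> q \<in> poly_ideal I" using p_closed q unfolding poly_ideal_def by simp
qed (auto simp: poly_ideal_def ideal_zero_closed[OF I_ideal] ideal_add_closed[OF I_ideal])

lemma poly_ideal_mono: "I \<subseteq> J \<Longrightarrow> poly_ideal I \<subseteq> poly_ideal J"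
  unfolding poly_ideal_def by auto

lemma poly_ideal_prod:
  assumes I_ideal: "ideal I R" and J_ideal: "ideal J R" and p: "p \<in> poly_ideal I"
    and q: "q \<in> poly_ideal J"
  shows "p \<otimes>\<^bsub>P\<^esub> q \<in> poly_ideal (I \<cdot> J)"
proof -
  have "(\<Oplus>i\<in>{..n}. pcoeff p i \<otimes> pcoeff q (n - i)) \<in> I \<cdot> J" for n
    by (rule R.ideal_finsum_closed[OF R.ideal_prod_is_ideal[OF I_ideal J_ideal]])
      (use p q in \<open>auto simp: poly_ideal_def intro: ideal_prod.prod\<close>)
  then show ?thesis using p q unfolding poly_ideal_def by simp
qed

lemma pconst_mem_poly_ideal: "ideal I R \<Longrightarrow> c \<in> I \<Longrightarrow> pconst c \<in> poly_ideal I"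
  unfolding poly_ideal_def using ideal.Icarr[of I R c] ideal_zero_closed[of I R] by auto

lemma monic_one: "monic 0 \<one>\<^bsub>P\<^esub>"
  unfolding monic_def by simp

lemma monic_linear_factor: "c \<in> carrier R \<Longrightarrow> monic 1 (linear_factor c)"
  unfolding monic_def by (auto simp: R.minus_eq)

lemma coeff_mult_monic:
  assumes g_monic: "monic n g" and q_closed: "q \<in> carrier P" and I_ideal: "ideal I R"
    and above: "\<And>j. j > k \<Longrightarrow> pcoeff q j \<in> I"
  shows "\<exists>b\<in>I. pcoeff (g \<otimes>\<^bsub>P\<^esub> q) (n + k) = pcoeff q k \<oplus> b"
proof -
  let ?t = "\<lambda>i. pcoeff g i \<otimes> pcoeff q (n + k - i)"
  have g_closed: "g \<in> carrier P" by (rule monic_closed[OF g_monic])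
  have "pcoeff (g \<otimes>\<^bsub>P\<^esub> q) (n + k) = (\<Oplus>i\<in>insert n ({..n + k} - {n}). ?t i)"
    using g_closed q_closed by (simp add: insert_absorb)
  also have "\<dots> = ?t n \<oplus> (\<Oplus>i\<in>{..n + k} - {n}. ?t i)"
    by (rule R.finsum_insert) (use g_closed q_closed in auto)
  also have "?t n = pcoeff q k" using g_monic q_closed unfolding monic_def by simp
  finally have "pcoeff (g \<otimes>\<^bsub>P\<^esub> q) (n + k) = pcoeff q k \<oplus> (\<Oplus>i\<in>{..n + k} - {n}. ?t i)" .
  moreover have "(\<Oplus>i\<in>{..n + k} - {n}. ?t i) \<in> I"
  proof (rule R.ideal_finsum_closed[OF I_ideal])
    fix i assume i: "i \<in> {..n + k} - {n}"
    show "?t i \<in> I"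
    proof (cases "i < n")
      case True
      then show ?thesis using above[of "n + k - i"] i g_closed ideal.I_l_closed[OF I_ideal] by simp
    next
      case False
      then show ?thesis
        using g_monic q_closed i ideal_zero_closed[OF I_ideal] unfolding monic_def by simp
    qed
  qed
  ultimately show ?thesis by blast
qed

lemma coeff_mem_if_coeff_mult_monic_mem:
  assumes g_monic: "monic n g" and q_closed: "q \<in> carrier P" and I_ideal: "ideal I R"
    and gq: "\<And>k. k \<ge> b \<Longrightarrow> pcoeff (g \<otimes>\<^bsub>P\<^esub> q) (n + k) \<in> I" and k: "k \<ge> b"
  shows "pcoeff q k \<in> I"
proof -
  have "pcoeff q k \<in> I" if "deg R q < k + m" "k \<ge> b" for k m
    using that
  proof (induction m arbitrary: k)
    case 0
    then show ?case using deg_aboveD[OF _ q_closed, of k] ideal_zero_closed[OF I_ideal] by simp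
  next
    case (Suc m)
    have "pcoeff q j \<in> I" if "j > k" for j using Suc.IH[of j] Suc.prems that by simp
    then obtain c where c: "c \<in> I" "pcoeff (g \<otimes>\<^bsub>P\<^esub> q) (n + k) = pcoeff q k \<oplus> c"
      using coeff_mult_monic[OF g_monic q_closed I_ideal] by blast
    have "c \<oplus> pcoeff q k \<in> I"
      using gq[OF Suc.prems(2)] c ideal.Icarr[OF I_ideal c(1)] q_closed by (simp add: R.a_comm)
    then show ?case using R.ideal_cancel_add[OF I_ideal _ c(1)] q_closed by simp
  qed
  from this[of k "Suc (deg R q)"] show ?thesis using k by simp
qed

lemma monic_cofactor:
  assumes g_monic: "monic a g" and q_closed: "q \<in> carrier P" and gq: "monic (a + b) (g \<otimes>\<^bsub>P\<^esub> q)"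
  shows "monic b q"
proof -
  have zero: "pcoeff q k = \<zero>" if "k > b" for k
    using coeff_mem_if_coeff_mult_monic_mem[OF g_monic q_closed R.zeroideal, of "Suc b" k] gq that
    unfolding monic_def by simp
  then have "pcoeff (g \<otimes>\<^bsub>P\<^esub> q) (a + b) = pcoeff q b"
    using coeff_mult_monic[OF g_monic q_closed R.zeroideal, of b] q_closed by auto
  then show ?thesis using q_closed gq zero unfolding monic_def by simp
qed

lemma poly_ideal_if_monic_division:
  assumes g_monic: "monic n g" and q_closed: "q \<in> carrier P" and r_below: "r \<in> polys_below n"
    and I_ideal: "ideal I R" and mem: "g \<otimes>\<^bsub>P\<^esub> q \<oplus>\<^bsub>P\<^esub> r \<in> poly_ideal I"
  shows "q \<in> poly_ideal I" "r \<in> poly_ideal I"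
proof -
  note g_closed = monic_closed[OF g_monic]
  have r_closed: "r \<in> carrier P" using r_below unfolding polys_below_def by blast
  have "pcoeff (g \<otimes>\<^bsub>P\<^esub> q) (n + k) = pcoeff (g \<otimes>\<^bsub>P\<^esub> q \<oplus>\<^bsub>P\<^esub> r) (n + k)" for k
    using g_closed q_closed r_below r_closed unfolding polys_below_def by (simp del: coeff_mult)
  then have "pcoeff q k \<in> I" for k
    using coeff_mem_if_coeff_mult_monic_mem[OF g_monic q_closed I_ideal, of 0 k]
      mem unfolding poly_ideal_def
    by simp
  then show q_mem: "q \<in> poly_ideal I" using q_closed unfolding poly_ideal_def by simp
  show "r \<in> poly_ideal I"
    by (rule P.ideal_cancel_add[OF poly_ideal_ideal[OF I_ideal] mem
          ideal.I_l_closed[OF poly_ideal_ideal[OF I_ideal] q_mem g_closed] r_closed])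
qed

lemma monic_division:
  assumes g_monic: "monic n g" and f_closed: "f \<in> carrier P"
  shows "\<exists>q\<in>carrier P. \<exists>r\<in>polys_below n. f = g \<otimes>\<^bsub>P\<^esub> q \<oplus>\<^bsub>P\<^esub> r"
proof (cases "\<one> = \<zero>")
  case True
  then have "pcoeff f i = \<zero>" for i using coeff_closed[OF f_closed, of i] R.one_zeroD by simp
  then show ?thesis
    using f_closed monic_closed[OF g_monic]
    by (intro bexI[of _ "\<zero>\<^bsub>P\<^esub>"] bexI[of _ f]) (auto simp: polys_below_def)
next
  case False
  note g_closed = monic_closed[OF g_monic]
  have deg: "deg R g = n"
    by (intro le_antisym deg_aboveI deg_belowI) (use g_monic False in \<open>auto simp: monic_def\<close>)
  have "g \<noteq> \<zero>\<^bsub>P\<^esub>" using g_monic False unfolding monic_def by auto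
  then obtain q r k where q: "q \<in> carrier P" "r \<in> carrier P"
    and eq: "lcoeff g [^] (k::nat) \<odot>\<^bsub>P\<^esub> f = g \<otimes>\<^bsub>P\<^esub> q \<oplus>\<^bsub>P\<^esub> r" "r = \<zero>\<^bsub>P\<^esub> \<or> deg R r < deg R g"
    using long_div_theorem[OF g_closed f_closed] by blast
  have "f = g \<otimes>\<^bsub>P\<^esub> q \<oplus>\<^bsub>P\<^esub> r" using eq(1) g_monic f_closed deg unfolding monic_def by simp
  moreover have "r \<in> polys_below n"
    using eq(2) q(2) deg unfolding polys_below_def by (auto intro: deg_aboveD)
  ultimately show ?thesis using q(1) by blast
qed

lemma monic_add_polys_below:
  assumes "monic n g" "r \<in> polys_below n"
  shows "monic n (g \<oplus>\<^bsub>P\<^esub> r)"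
  using assms unfolding monic_def polys_below_def by auto

end

section \<open>Hensel's lemma\<close>

text \<open>Division of \<open>v r\<close> by \<open>g\<close> produces the corrections \<open>d\<close> of \<open>g\<close> and \<open>w\<close> of \<open>h\<close>. If \<open>u g + v h = 1\<close>
  then the terms of the new error that are linear in the old error \<open>r\<close> cancel.\<close>

lemma (in cring) hensel_error:
  assumes closed: "f \<in> carrier R" "g \<in> carrier R" "h \<in> carrier R" "u \<in> carrier R" "v \<in> carrier R"
      "q \<in> carrier R" "d \<in> carrier R"
    and r: "r = f \<ominus> g \<otimes> h" and w: "w = u \<otimes> r \<oplus> q \<otimes> h" and e: "e = u \<otimes> g \<oplus> v \<otimes> h \<ominus> \<one>"
    and division: "v \<otimes> r = g \<otimes> q \<oplus> d"
  shows "f \<ominus> (g \<oplus> d) \<otimes> (h \<oplus> w) = \<ominus> (e \<otimes> r) \<ominus> d \<otimes> w"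
proof -
  have new_closed: "r \<in> carrier R" "w \<in> carrier R" "e \<in> carrier R"
    unfolding r w e using closed by auto
  have "g \<otimes> w \<oplus> d \<otimes> h = (g \<otimes> q \<oplus> d) \<otimes> h \<oplus> (u \<otimes> g) \<otimes> r"
    unfolding w using closed new_closed(1) by algebra
  also have "\<dots> = e \<otimes> r \<oplus> r"
    unfolding division[symmetric] e using closed new_closed(1) by algebra
  finally have linear: "g \<otimes> w \<oplus> d \<otimes> h = e \<otimes> r \<oplus> r" .
  have "f \<ominus> (g \<oplus> d) \<otimes> (h \<oplus> w) = r \<ominus> (g \<otimes> w \<oplus> d \<otimes> h) \<ominus> d \<otimes> w"
    unfolding r using closed new_closed(2) by algebra
  also have "\<dots> = \<ominus> (e \<otimes> r) \<ominus> d \<otimes> w"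
    unfolding linear using closed new_closed by algebra
  finally show ?thesis .
qed

locale adic_complete = cring R for R (structure) +
  fixes I
  assumes I_ideal: "ideal I R"
    and separated: "(\<Inter>k. ideal_pow R I k) = {\<zero>}"
    and cauchy_convergent: "\<And>x :: nat \<Rightarrow> 'a. \<lbrakk>\<And>n. x n \<in> carrier R;
        \<forall>k. \<exists>N. \<forall>p\<ge>N. \<forall>q\<ge>N. x p \<ominus> x q \<in> ideal_pow R I k\<rbrakk> \<Longrightarrow>
      \<exists>l\<in>carrier R. \<forall>k. \<exists>N. \<forall>n\<ge>N. x n \<ominus> l \<in> ideal_pow R I k"
begin

lemma pow_ideal: "ideal (ideal_pow R I k) R"
  by (rule ideal_pow_ideal[OF I_ideal])

lemma ideal_pow_decreasing: "k \<le> l \<Longrightarrow> ideal_pow R I l \<subseteq> ideal_pow R I k"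
  by (induction l rule: dec_induct) (use ideal_pow_Suc_subset[OF I_ideal] in blast)+

lemma ideal_pow_1: "ideal_pow R I (Suc 0) = I"
  by (simp add: ideal_prod_one[OF I_ideal])

lemma eq_zero_if_mem_all_ideal_pow: "(\<And>k. a \<in> ideal_pow R I k) \<Longrightarrow> a = \<zero>"
  using separated by blast

lemma exists_limit:
  assumes x_closed: "\<And>k. x k \<in> carrier R" and step: "\<And>k. x (Suc k) \<ominus> x k \<in> ideal_pow R I k"
  shows "\<exists>l\<in>carrier R. \<forall>k. x k \<ominus> l \<in> ideal_pow R I k"
proof -
  have tail: "x p \<ominus> x k \<in> ideal_pow R I k" if "k \<le> p" for p k
    using that
  proof (induction p rule: dec_induct)
    case base
    then show ?case using x_closed ideal_zero_closed[OF pow_ideal] by (simp add: a_minus_def r_neg)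
  next
    case (step p)
    have "x (Suc p) \<ominus> x k = (x (Suc p) \<ominus> x p) \<oplus> (x p \<ominus> x k)"
      using x_closed[of p] x_closed[of k] x_closed[of "Suc p"] by algebra
    moreover have "x (Suc p) \<ominus> x p \<in> ideal_pow R I k"
      using assms(2)[of p] ideal_pow_decreasing[OF step.hyps(1)] by blast
    ultimately show ?case using ideal_add_closed[OF pow_ideal] step.IH by simp
  qed
  have "x p \<ominus> x q \<in> ideal_pow R I k" if "p \<ge> k" "q \<ge> k" for p q k
  proof -
    have "x p \<ominus> x q = (x p \<ominus> x k) \<ominus> (x q \<ominus> x k)"
      using x_closed[of p] x_closed[of k] x_closed[of q] by algebra
    then show ?thesis using ideal_minus_closed[OF pow_ideal tail tail] that by simp
  qed
  then obtain l where l: "l \<in> carrier R" "\<forall>k. \<exists>N. \<forall>n\<ge>N. x n \<ominus> l \<in> ideal_pow R I k"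
    using cauchy_convergent[of x, OF x_closed] by blast
  have "x k \<ominus> l \<in> ideal_pow R I k" for k
  proof -
    obtain N where N: "\<forall>n\<ge>N. x n \<ominus> l \<in> ideal_pow R I k" using l(2) by blast
    define n where "n = max N k"
    have "x k \<ominus> l = (x n \<ominus> l) \<ominus> (x n \<ominus> x k)" using x_closed[of n] x_closed[of k] l(1) by algebra
    then show ?thesis
      using ideal_minus_closed[OF pow_ideal _ tail[of k n]] N unfolding n_def by simp
  qed
  then show ?thesis using l(1) by blast
qed

end

locale adic_complete_UP = UP_cring R P + adic_complete R I for R (structure) and P (structure) and I
begin

lemma poly_pow_ideal: "ideal (poly_ideal (ideal_pow R I k)) P"
  by (rule poly_ideal_ideal[OF pow_ideal])

lemma poly_I_ideal: "ideal (poly_ideal I) P"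
  by (rule poly_ideal_ideal[OF I_ideal])

lemma poly_pow_Suc_subset: "poly_ideal (ideal_pow R I (Suc k)) \<subseteq> poly_ideal I"
  using poly_ideal_mono[OF ideal_pow_decreasing[of "Suc 0" "Suc k"]] ideal_pow_1 by simp

lemma mult_mem_poly_pow_Suc:
  "e \<in> poly_ideal I \<Longrightarrow> p \<in> poly_ideal (ideal_pow R I k) \<Longrightarrow> e \<otimes>\<^bsub>P\<^esub> p \<in> poly_ideal (ideal_pow R I (Suc k))"
  using poly_ideal_prod[OF I_ideal pow_ideal] by simp

lemma exists_monic_limit:
  assumes g_monic: "\<And>k. monic n (g k)"
    and step: "\<And>k. g (Suc k) \<ominus>\<^bsub>P\<^esub> g k \<in> poly_ideal (ideal_pow R I k)"
  shows "\<exists>G. monic n G \<and> (\<forall>k. g k \<ominus>\<^bsub>P\<^esub> G \<in> poly_ideal (ideal_pow R I k))"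
proof -
  note g_closed = monic_closed[OF g_monic]
  have "\<exists>l\<in>carrier R. \<forall>k. pcoeff (g k) i \<ominus> l \<in> ideal_pow R I k" for i
    by (rule exists_limit) (use step g_closed in \<open>auto simp: poly_ideal_def\<close>)
  then obtain l where l: "\<And>i. l i \<in> carrier R" "\<And>i k. pcoeff (g k) i \<ominus> l i \<in> ideal_pow R I k"
    by metis
  define a where "a i = (if i < n then l i else if i = n then \<one> else \<zero>)" for i
  have "a i \<in> carrier R" "i \<ge> Suc n \<Longrightarrow> a i = \<zero>" for i using l(1) unfolding a_def by auto
  then obtain G where G: "G \<in> carrier P" "\<And>i. pcoeff G i = a i"
    using exists_poly_with_coeffs[of a "Suc n"] by blast
  have "pcoeff (g k) i \<ominus> a i \<in> ideal_pow R I k" for i k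
  proof (cases "i < n")
    case True
    then show ?thesis using l(2) unfolding a_def by simp
  next
    case False
    then have "pcoeff (g k) i = a i" using g_monic[of k] unfolding monic_def a_def by auto
    then show ?thesis
      using g_closed[of k] ideal_zero_closed[OF pow_ideal] G(2)[symmetric] coeff_closed[OF G(1)]
      by (simp add: R.minus_eq R.r_neg)
  qed
  moreover have "monic n G" using G unfolding monic_def a_def by simp
  ultimately show ?thesis using g_closed G unfolding poly_ideal_def by auto
qed

definition bezout_factorization ::
  "(nat \<Rightarrow> 'a) \<Rightarrow> (nat \<Rightarrow> 'a) \<Rightarrow> (nat \<Rightarrow> 'a) \<Rightarrow> nat \<Rightarrow> (nat \<Rightarrow> 'a) \<Rightarrow> (nat \<Rightarrow> 'a) \<Rightarrow> bool" where
  "bezout_factorization f u v k g h \<longleftrightarrow> h \<in> carrier P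
    \<and> u \<otimes>\<^bsub>P\<^esub> g \<oplus>\<^bsub>P\<^esub> v \<otimes>\<^bsub>P\<^esub> h \<ominus>\<^bsub>P\<^esub> \<one>\<^bsub>P\<^esub> \<in> poly_ideal I
    \<and> f \<ominus>\<^bsub>P\<^esub> g \<otimes>\<^bsub>P\<^esub> h \<in> poly_ideal (ideal_pow R I k)"

lemma hensel_step:
  assumes f_closed: "f \<in> carrier P" and g_monic: "monic n g" and uv: "u \<in> carrier P" "v \<in> carrier P"
    and factorization: "bezout_factorization f u v (Suc k) g h"
  shows "\<exists>g' h'. monic n g' \<and> h' \<in> carrier P
    \<and> g' \<ominus>\<^bsub>P\<^esub> g \<in> poly_ideal (ideal_pow R I (Suc k)) \<and> h' \<ominus>\<^bsub>P\<^esub> h \<in> poly_ideal (ideal_pow R I (Suc k))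
    \<and> f \<ominus>\<^bsub>P\<^esub> g' \<otimes>\<^bsub>P\<^esub> h' \<in> poly_ideal (ideal_pow R I (Suc (Suc k)))"
proof -
  let ?K = "\<lambda>k. poly_ideal (ideal_pow R I k)"
  have h_closed: "h \<in> carrier P" and bezout: "u \<otimes>\<^bsub>P\<^esub> g \<oplus>\<^bsub>P\<^esub> v \<otimes>\<^bsub>P\<^esub> h \<ominus>\<^bsub>P\<^esub> \<one>\<^bsub>P\<^esub> \<in> poly_ideal I"
    and err: "f \<ominus>\<^bsub>P\<^esub> g \<otimes>\<^bsub>P\<^esub> h \<in> ?K (Suc k)"
    using factorization unfolding bezout_factorization_def by simp_all
  note K = poly_pow_ideal and g_closed = monic_closed[OF g_monic]
  note K_closed = ideal_add_closed[OF K] ideal_neg_closed[OF K] ideal.I_l_closed[OF K]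
    ideal.I_r_closed[OF K] P.ideal_minus_closed[OF K]
  define r where "r = f \<ominus>\<^bsub>P\<^esub> g \<otimes>\<^bsub>P\<^esub> h"
  have r: "r \<in> ?K (Suc k)" "r \<in> carrier P"
    using err f_closed g_closed h_closed unfolding r_def by auto
  obtain q d where q: "q \<in> carrier P" "d \<in> polys_below n" "v \<otimes>\<^bsub>P\<^esub> r = g \<otimes>\<^bsub>P\<^esub> q \<oplus>\<^bsub>P\<^esub> d"
    using monic_division[OF g_monic, of "v \<otimes>\<^bsub>P\<^esub> r"] uv r by auto
  have d_closed: "d \<in> carrier P" using q(2) unfolding polys_below_def by blast
  have "g \<otimes>\<^bsub>P\<^esub> q \<oplus>\<^bsub>P\<^esub> d \<in> ?K (Suc k)" using K_closed(3) r(1) uv(2) q(3) by metis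
  then have qd: "q \<in> ?K (Suc k)" "d \<in> ?K (Suc k)"
    using poly_ideal_if_monic_division[OF g_monic q(1,2) pow_ideal] by blast+
  define w where "w = u \<otimes>\<^bsub>P\<^esub> r \<oplus>\<^bsub>P\<^esub> q \<otimes>\<^bsub>P\<^esub> h"
  have w: "w \<in> ?K (Suc k)"
    unfolding w_def
    by (rule K_closed(1)[OF K_closed(3)[OF r(1) uv(1)] K_closed(4)[OF qd(1) h_closed]])
  have w_closed: "w \<in> carrier P" unfolding w_def using uv h_closed q(1) r(2) by simp
  define e where "e = u \<otimes>\<^bsub>P\<^esub> g \<oplus>\<^bsub>P\<^esub> v \<otimes>\<^bsub>P\<^esub> h \<ominus>\<^bsub>P\<^esub> \<one>\<^bsub>P\<^esub>"
  have e: "e \<in> poly_ideal I" "e \<in> carrier P"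
    using bezout uv g_closed h_closed unfolding e_def by auto
  have "f \<ominus>\<^bsub>P\<^esub> (g \<oplus>\<^bsub>P\<^esub> d) \<otimes>\<^bsub>P\<^esub> (h \<oplus>\<^bsub>P\<^esub> w) = \<ominus>\<^bsub>P\<^esub> (e \<otimes>\<^bsub>P\<^esub> r) \<ominus>\<^bsub>P\<^esub> d \<otimes>\<^bsub>P\<^esub> w"
    by (rule P.hensel_error[OF f_closed g_closed h_closed uv q(1) d_closed r_def w_def e_def q(3)])
  moreover have "e \<otimes>\<^bsub>P\<^esub> r \<in> ?K (Suc (Suc k))" "d \<otimes>\<^bsub>P\<^esub> w \<in> ?K (Suc (Suc k))"
    using mult_mem_poly_pow_Suc[OF e(1) r(1)] mult_mem_poly_pow_Suc[OF _ w, of d]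
      qd(2) poly_pow_Suc_subset[of k] by auto
  moreover have "(g \<oplus>\<^bsub>P\<^esub> d) \<ominus>\<^bsub>P\<^esub> g = d" "(h \<oplus>\<^bsub>P\<^esub> w) \<ominus>\<^bsub>P\<^esub> h = w"
    using g_closed d_closed h_closed w_closed by algebra+
  ultimately show ?thesis
    using monic_add_polys_below[OF g_monic q(2)] h_closed w w_closed qd(2) K_closed(2,5)
    by (intro exI[of _ "g \<oplus>\<^bsub>P\<^esub> d"] exI[of _ "h \<oplus>\<^bsub>P\<^esub> w"]) (simp del: ideal_pow.simps)
qed

lemma bezout_factorization_cong:
  assumes factorization: "bezout_factorization f u v k g h"
    and in_carrier: "u \<in> carrier P" "v \<in> carrier P" "g \<in> carrier P" "g' \<in> carrier P" "h' \<in> carrier P"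
    and close: "g' \<ominus>\<^bsub>P\<^esub> g \<in> poly_ideal I" "h' \<ominus>\<^bsub>P\<^esub> h \<in> poly_ideal I"
    and err: "f \<ominus>\<^bsub>P\<^esub> g' \<otimes>\<^bsub>P\<^esub> h' \<in> poly_ideal (ideal_pow R I l)"
  shows "bezout_factorization f u v l g' h'"
proof -
  note add = ideal_add_closed[OF poly_I_ideal] and mult = ideal.I_l_closed[OF poly_I_ideal]
  have h_closed: "h \<in> carrier P" and bezout: "u \<otimes>\<^bsub>P\<^esub> g \<oplus>\<^bsub>P\<^esub> v \<otimes>\<^bsub>P\<^esub> h \<ominus>\<^bsub>P\<^esub> \<one>\<^bsub>P\<^esub> \<in> poly_ideal I"
    using factorization unfolding bezout_factorization_def by simp_all
  have "u \<otimes>\<^bsub>P\<^esub> g' \<oplus>\<^bsub>P\<^esub> v \<otimes>\<^bsub>P\<^esub> h' \<ominus>\<^bsub>P\<^esub> \<one>\<^bsub>P\<^esub> = (u \<otimes>\<^bsub>P\<^esub> g \<oplus>\<^bsub>P\<^esub> v \<otimes>\<^bsub>P\<^esub> h \<ominus>\<^bsub>P\<^esub> \<one>\<^bsub>P\<^esub>)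
      \<oplus>\<^bsub>P\<^esub> (u \<otimes>\<^bsub>P\<^esub> (g' \<ominus>\<^bsub>P\<^esub> g) \<oplus>\<^bsub>P\<^esub> v \<otimes>\<^bsub>P\<^esub> (h' \<ominus>\<^bsub>P\<^esub> h))"
    using in_carrier h_closed by algebra
  also have "\<dots> \<in> poly_ideal I" by (intro add mult bezout close in_carrier)
  finally show ?thesis using in_carrier(5) err unfolding bezout_factorization_def by simp
qed

lemma exists_hensel_sequence:
  assumes f_closed: "f \<in> carrier P" and g_monic: "monic n g" and uv: "u \<in> carrier P" "v \<in> carrier P"
    and factorization: "bezout_factorization f u v (Suc 0) g h"
  shows "\<exists>s t. \<forall>k. monic n (s k) \<and> s k \<ominus>\<^bsub>P\<^esub> g \<in> poly_ideal I
    \<and> bezout_factorization f u v (Suc k) (s k) (t k)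
    \<and> s (Suc k) \<ominus>\<^bsub>P\<^esub> s k \<in> poly_ideal (ideal_pow R I (Suc k))"
proof -
  define approx where "approx k = (\<lambda>(g', h'). monic n g' \<and> g' \<ominus>\<^bsub>P\<^esub> g \<in> poly_ideal I
    \<and> bezout_factorization f u v (Suc k) g' h')" for k
  have "\<exists>x. \<forall>k. approx k (x k) \<and> fst (x (Suc k)) \<ominus>\<^bsub>P\<^esub> fst (x k) \<in> poly_ideal (ideal_pow R I (Suc k))"
  proof (rule dependent_nat_choice)
    have "g \<ominus>\<^bsub>P\<^esub> g \<in> poly_ideal I"
      using monic_closed[OF g_monic] ideal_zero_closed[OF poly_I_ideal]
      by (simp add: P.minus_eq P.r_neg)
    then show "\<exists>x. approx 0 x" unfolding approx_def using g_monic factorization by blast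
  next
    fix x k assume "approx k x"
    then obtain g1 h1 where x: "x = (g1, h1)" "monic n g1" "g1 \<ominus>\<^bsub>P\<^esub> g \<in> poly_ideal I"
      "bezout_factorization f u v (Suc k) g1 h1"
      unfolding approx_def by (cases x) auto
    obtain g2 h2 where y: "monic n g2" "h2 \<in> carrier P"
      "g2 \<ominus>\<^bsub>P\<^esub> g1 \<in> poly_ideal (ideal_pow R I (Suc k))"
        "h2 \<ominus>\<^bsub>P\<^esub> h1 \<in> poly_ideal (ideal_pow R I (Suc k))"
      "f \<ominus>\<^bsub>P\<^esub> g2 \<otimes>\<^bsub>P\<^esub> h2 \<in> poly_ideal (ideal_pow R I (Suc (Suc k)))"
      using hensel_step[OF f_closed x(2) uv x(4)] by blast
    note in_carrier = monic_closed[OF g_monic] monic_closed[OF x(2)] monic_closed[OF y(1)]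
    have close: "g2 \<ominus>\<^bsub>P\<^esub> g1 \<in> poly_ideal I" "h2 \<ominus>\<^bsub>P\<^esub> h1 \<in> poly_ideal I"
      using y(3,4) poly_pow_Suc_subset by blast+
    have "g2 \<ominus>\<^bsub>P\<^esub> g = (g1 \<ominus>\<^bsub>P\<^esub> g) \<oplus>\<^bsub>P\<^esub> (g2 \<ominus>\<^bsub>P\<^esub> g1)" using in_carrier by algebra
    then have "g2 \<ominus>\<^bsub>P\<^esub> g \<in> poly_ideal I"
      using ideal_add_closed[OF poly_I_ideal x(3) close(1)] by simp
    then have "approx (Suc k) (g2, h2)"
      unfolding approx_def
      using bezout_factorization_cong[OF x(4) uv in_carrier(2,3) y(2) close y(5)] y(1)
      by simp
    then show "\<exists>y. approx (Suc k) y \<and> fst y \<ominus>\<^bsub>P\<^esub> fst x \<in> poly_ideal (ideal_pow R I (Suc k))"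
      using x(1) y(3) by (metis fst_conv)
  qed
  then obtain x where x: "\<And>k. approx k (x k)"
    "\<And>k. fst (x (Suc k)) \<ominus>\<^bsub>P\<^esub> fst (x k) \<in> poly_ideal (ideal_pow R I (Suc k))" by blast
  then show ?thesis
    unfolding approx_def
    by (intro exI[of _ "\<lambda>k. fst (x k)"] exI[of _ "\<lambda>k. snd (x k)"]) (simp add: case_prod_unfold)
qed

lemma monic_dvd_if_dvd_mod_powers:
  assumes f_closed: "f \<in> carrier P" and g_monic: "monic n g"
    and approx: "\<And>k. \<exists>h\<in>carrier P. f \<ominus>\<^bsub>P\<^esub> g \<otimes>\<^bsub>P\<^esub> h \<in> poly_ideal (ideal_pow R I k)"
  shows "\<exists>h\<in>carrier P. f = g \<otimes>\<^bsub>P\<^esub> h"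
proof -
  note g_closed = monic_closed[OF g_monic]
  obtain q r where q: "q \<in> carrier P" "r \<in> polys_below n" "f = g \<otimes>\<^bsub>P\<^esub> q \<oplus>\<^bsub>P\<^esub> r"
    using monic_division[OF g_monic f_closed] by blast
  have r_closed: "r \<in> carrier P" using q(2) unfolding polys_below_def by blast
  have "r \<in> poly_ideal (ideal_pow R I k)" for k
  proof -
    obtain h where h: "h \<in> carrier P" "f \<ominus>\<^bsub>P\<^esub> g \<otimes>\<^bsub>P\<^esub> h \<in> poly_ideal (ideal_pow R I k)"
      using approx by blast
    have "f \<ominus>\<^bsub>P\<^esub> g \<otimes>\<^bsub>P\<^esub> h = g \<otimes>\<^bsub>P\<^esub> (q \<ominus>\<^bsub>P\<^esub> h) \<oplus>\<^bsub>P\<^esub> r"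
      unfolding q(3) using g_closed q(1) h(1) r_closed by algebra
    then show ?thesis
      using poly_ideal_if_monic_division(2)[OF g_monic _ q(2) pow_ideal, of "q \<ominus>\<^bsub>P\<^esub> h"] q(1) h
      by simp
  qed
  then have "pcoeff r i = \<zero>" for i
    by (intro eq_zero_if_mem_all_ideal_pow) (simp add: poly_ideal_def)
  then have "r = \<zero>\<^bsub>P\<^esub>" using r_closed by (intro up_eqI) auto
  then show ?thesis using q(1,3) g_closed by auto
qed

theorem hensel_factorization:
  assumes f_closed: "f \<in> carrier P" and g_monic: "monic n g" and h_closed: "h \<in> carrier P"
    and uv: "u \<in> carrier P" "v \<in> carrier P"
    and bezout: "u \<otimes>\<^bsub>P\<^esub> g \<oplus>\<^bsub>P\<^esub> v \<otimes>\<^bsub>P\<^esub> h \<ominus>\<^bsub>P\<^esub> \<one>\<^bsub>P\<^esub> \<in> poly_ideal I"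
    and fgh: "f \<ominus>\<^bsub>P\<^esub> g \<otimes>\<^bsub>P\<^esub> h \<in> poly_ideal I"
  shows "\<exists>G H. monic n G \<and> G \<ominus>\<^bsub>P\<^esub> g \<in> poly_ideal I \<and> H \<in> carrier P \<and> f = G \<otimes>\<^bsub>P\<^esub> H"
proof -
  have "bezout_factorization f u v (Suc 0) g h"
    unfolding bezout_factorization_def ideal_pow_1 using h_closed bezout fgh by simp
  then obtain s t where s: "\<And>k. monic n (s k)" "\<And>k. s k \<ominus>\<^bsub>P\<^esub> g \<in> poly_ideal I"
    "\<And>k. s (Suc k) \<ominus>\<^bsub>P\<^esub> s k \<in> poly_ideal (ideal_pow R I (Suc k))"
    and "\<And>k. bezout_factorization f u v (Suc k) (s k) (t k)"
    using exists_hensel_sequence[OF f_closed g_monic uv] by metis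
  then have t: "\<And>k. t k \<in> carrier P" "\<And>k. f \<ominus>\<^bsub>P\<^esub> s k \<otimes>\<^bsub>P\<^esub> t k \<in> poly_ideal (ideal_pow R I (Suc k))"
    unfolding bezout_factorization_def by blast+
  have pow_sub: "poly_ideal (ideal_pow R I (Suc k)) \<subseteq> poly_ideal (ideal_pow R I k)" for k
    by (rule poly_ideal_mono[OF R.ideal_pow_Suc_subset[OF I_ideal]])
  obtain G where G: "monic n G" "\<And>k. s k \<ominus>\<^bsub>P\<^esub> G \<in> poly_ideal (ideal_pow R I k)"
    using exists_monic_limit[of n s] s(1,3) pow_sub by blast
  note g_closed = monic_closed[OF g_monic] and G_closed = monic_closed[OF G(1)]
    and s_closed = monic_closed[OF s(1)]
  have "G \<ominus>\<^bsub>P\<^esub> g = (s 1 \<ominus>\<^bsub>P\<^esub> g) \<ominus>\<^bsub>P\<^esub> (s 1 \<ominus>\<^bsub>P\<^esub> G)" using g_closed G_closed s_closed[of 1] by algebra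
  moreover have "s 1 \<ominus>\<^bsub>P\<^esub> G \<in> poly_ideal I" using G(2)[of 1] ideal_pow_1 by simp
  ultimately have "G \<ominus>\<^bsub>P\<^esub> g \<in> poly_ideal I"
    using P.ideal_minus_closed[OF poly_I_ideal s(2)[of 1]] by simp
  moreover have "f \<ominus>\<^bsub>P\<^esub> G \<otimes>\<^bsub>P\<^esub> t k \<in> poly_ideal (ideal_pow R I k)" for k
  proof -
    have "f \<ominus>\<^bsub>P\<^esub> G \<otimes>\<^bsub>P\<^esub> t k = (f \<ominus>\<^bsub>P\<^esub> s k \<otimes>\<^bsub>P\<^esub> t k) \<oplus>\<^bsub>P\<^esub> (s k \<ominus>\<^bsub>P\<^esub> G) \<otimes>\<^bsub>P\<^esub> t k"
      using f_closed G_closed s_closed[of k] t(1)[of k] by algebra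
    then show ?thesis
      using ideal_add_closed[OF poly_pow_ideal] ideal.I_r_closed[OF poly_pow_ideal G(2) t(1)]
        t(2)[of k] pow_sub[of k] by auto
  qed
  then have "\<exists>H\<in>carrier P. f = G \<otimes>\<^bsub>P\<^esub> H"
    using monic_dvd_if_dvd_mod_powers[OF f_closed G(1)] t(1) by blast
  ultimately show ?thesis using G(1) by blast
qed

end

section \<open>Integral elements\<close>

definition monic_value :: "('b, 'm) ring_scheme \<Rightarrow> ('a \<Rightarrow> 'b) \<Rightarrow> nat \<Rightarrow> (nat \<Rightarrow> 'a) \<Rightarrow> 'b \<Rightarrow> 'b" where
  "monic_value S h n a x =
    x [^]\<^bsub>S\<^esub> n \<oplus>\<^bsub>S\<^esub> (\<Oplus>\<^bsub>S\<^esub>j\<in>{1..n}. h (a j) \<otimes>\<^bsub>S\<^esub> x [^]\<^bsub>S\<^esub> (n - j))"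

context ring_hom_cring
begin

lemma monic_value_closed:
  assumes "\<And>j. j \<in> {1..n} \<Longrightarrow> a j \<in> carrier R" "x \<in> carrier S"
  shows "monic_value S h n a x \<in> carrier S"
  unfolding monic_value_def using assms by (auto intro!: S.finsum_closed)

lemma hom_monic_value:
  assumes g_hom: "ring_hom_cring S T g" and a: "\<And>j. j \<in> {1..n} \<Longrightarrow> a j \<in> carrier R"
    and x_closed: "x \<in> carrier S"
  shows "g (monic_value S h n a x) = monic_value T (\<lambda>c. g (h c)) n a (g x)"
proof -
  interpret g: ring_hom_cring S T g by (rule g_hom)
  have terms: "(\<lambda>j. h (a j) \<otimes>\<^bsub>S\<^esub> x [^]\<^bsub>S\<^esub> (n - j)) \<in> {1..n} \<rightarrow> carrier S" using a x_closed by auto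
  have "g (\<Oplus>\<^bsub>S\<^esub>j\<in>{1..n}. h (a j) \<otimes>\<^bsub>S\<^esub> x [^]\<^bsub>S\<^esub> (n - j))
      = (\<Oplus>\<^bsub>T\<^esub>j\<in>{1..n}. g (h (a j) \<otimes>\<^bsub>S\<^esub> x [^]\<^bsub>S\<^esub> (n - j)))"
    using g.hom_finsum[OF terms] by (simp add: comp_def)
  also have "\<dots> = (\<Oplus>\<^bsub>T\<^esub>j\<in>{1..n}. g (h (a j)) \<otimes>\<^bsub>T\<^esub> g x [^]\<^bsub>T\<^esub> (n - j))"
    by (rule g.S.finsum_cong') (use a x_closed in auto)
  finally show ?thesis unfolding monic_value_def using S.finsum_closed[OF terms] x_closed by simp
qed

end

context UP_cring
begin

lemma monic_mult:
  assumes g_monic: "monic a g" and q_monic: "monic b q"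
  shows "monic (a + b) (g \<otimes>\<^bsub>P\<^esub> q)"
proof -
  have coeff: "pcoeff (g \<otimes>\<^bsub>P\<^esub> q) (a + k) = pcoeff q k" if "k \<ge> b" for k
    using coeff_mult_monic[OF g_monic monic_closed[OF q_monic] R.zeroideal, of k] q_monic that
    unfolding monic_def by auto
  have "pcoeff (g \<otimes>\<^bsub>P\<^esub> q) i = \<zero>" if "i > a + b" for i
    using coeff[of "i - a"] q_monic that unfolding monic_def by simp
  then show ?thesis using coeff[of b] monic_closed[OF g_monic] q_monic unfolding monic_def by simp
qed

lemma monic_linear_factor_pow: "c \<in> carrier R \<Longrightarrow> monic n (linear_factor c [^]\<^bsub>P\<^esub> n)"
  by (induction n) (use monic_one monic_mult monic_linear_factor in fastforce)+

lemma monic_0_eq_one: "monic 0 p \<Longrightarrow> p = \<one>\<^bsub>P\<^esub>"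
  unfolding monic_def by (auto intro: up_eqI)

definition value_at :: "'a \<Rightarrow> (nat \<Rightarrow> 'a) \<Rightarrow> 'a" where
  "value_at c = UnivPoly.eval R R id c"

lemma remainder_value_at:
  assumes "f \<in> carrier P" "c \<in> carrier R" "\<one> \<noteq> \<zero>"
  shows "\<exists>q\<in>carrier P. f = linear_factor c \<otimes>\<^bsub>P\<^esub> q \<oplus>\<^bsub>P\<^esub> pconst (value_at c f)"
  using remainder_theorem[OF assms(1,2)] assms(3) unfolding value_at_def by auto

lemma value_at_hom:
  assumes "c \<in> carrier R"
  shows "ring_hom_cring P R (value_at c)"
proof -
  interpret id: UP_pre_univ_prop R R id P by unfold_locales (auto simp: P_def)
  show ?thesis unfolding value_at_def by (rule id.ring_homD[OF id.eval_ring_hom[OF assms]])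
qed

lemma value_at_closed: "c \<in> carrier R \<Longrightarrow> p \<in> carrier P \<Longrightarrow> value_at c p \<in> carrier R"
  using ring_hom_closed[OF ring_hom_cring.homh[OF value_at_hom]] .

lemma exists_monic_remainder:
  assumes f: "monic (Suc n) f" and c_closed: "c \<in> carrier R" and nontrivial: "\<one> \<noteq> \<zero>"
  shows "\<exists>q. monic n q \<and> f = linear_factor c \<otimes>\<^bsub>P\<^esub> q \<oplus>\<^bsub>P\<^esub> pconst (value_at c f)"
proof -
  define r where "r = value_at c f"
  note f_closed = monic_closed[OF f]
    and linear_factor_closed = monic_closed[OF monic_linear_factor[OF c_closed]]
  obtain q where q: "q \<in> carrier P" "f = linear_factor c \<otimes>\<^bsub>P\<^esub> q \<oplus>\<^bsub>P\<^esub> pconst r"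
    using remainder_value_at[OF f_closed c_closed nontrivial] unfolding r_def by blast
  have r_closed: "r \<in> carrier R" unfolding r_def by (rule value_at_closed[OF c_closed f_closed])
  have "linear_factor c \<otimes>\<^bsub>P\<^esub> q = f \<ominus>\<^bsub>P\<^esub> pconst r"
    unfolding q(2) using linear_factor_closed q(1) monom_closed[OF r_closed, of 0] by algebra
  moreover have "monic (Suc n) (f \<ominus>\<^bsub>P\<^esub> pconst r)"
    using f f_closed r_closed unfolding monic_def by (simp add: R.minus_eq)
  ultimately have "monic n q"
    using monic_cofactor[OF monic_linear_factor[OF c_closed] q(1), of n] by simp
  then show ?thesis using q(2) unfolding r_def by blast
qed

lemma polys_below_if_monic_mult_add:
  assumes g_monic: "monic a g" and q_closed: "q \<in> carrier P" and r_below: "r \<in> polys_below a"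
    and mem: "g \<otimes>\<^bsub>P\<^esub> q \<oplus>\<^bsub>P\<^esub> r \<in> polys_below (a + b)"
  shows "q \<in> polys_below b"
proof -
  have r_closed: "r \<in> carrier P" using r_below unfolding polys_below_def by blast
  have "pcoeff (g \<otimes>\<^bsub>P\<^esub> q) (a + k) = \<zero>" if "k \<ge> b" for k
  proof -
    have "pcoeff (g \<otimes>\<^bsub>P\<^esub> q \<oplus>\<^bsub>P\<^esub> r) (a + k) = pcoeff (g \<otimes>\<^bsub>P\<^esub> q) (a + k) \<oplus> pcoeff r (a + k)"
      by (rule coeff_add) (use monic_closed[OF g_monic] q_closed r_closed in auto)
    moreover have "pcoeff (g \<otimes>\<^bsub>P\<^esub> q \<oplus>\<^bsub>P\<^esub> r) (a + k) = \<zero>" "pcoeff r (a + k) = \<zero>"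
      using mem r_below that unfolding polys_below_def by auto
    ultimately show ?thesis
      using coeff_closed[OF P.m_closed[OF monic_closed[OF g_monic] q_closed]] by simp
  qed
  then have "pcoeff q k = \<zero>" if "k \<ge> b" for k
    using coeff_mem_if_coeff_mult_monic_mem[OF g_monic q_closed R.zeroideal _ that] by simp
  then show ?thesis using q_closed unfolding polys_below_def by blast
qed

lemma polys_below_mult_X_add:
  assumes p_below: "p \<in> polys_below n" and r_below: "r \<in> polys_below 1"
  shows "up_ring.monom P \<one> 1 \<otimes>\<^bsub>P\<^esub> p \<oplus>\<^bsub>P\<^esub> r \<in> polys_below (Suc n)"
proof -
  have in_carrier: "p \<in> carrier P" "r \<in> carrier P"
    using p_below r_below unfolding polys_below_def by auto
  have "pcoeff (up_ring.monom P \<one> 1 \<otimes>\<^bsub>P\<^esub> p \<oplus>\<^bsub>P\<^esub> r) i = \<zero>" if i: "i \<ge> Suc n" for i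
  proof -
    obtain j where j: "i = j + 1" "j \<ge> n" using i by (cases i) auto
    then show ?thesis
      using coeff_monom_mult[OF R.one_closed in_carrier(1), of 1 j] p_below r_below in_carrier
      unfolding polys_below_def by (simp del: coeff_mult)
  qed
  then show ?thesis using in_carrier unfolding polys_below_def by simp
qed

end

context UP_pre_univ_prop
begin

abbreviation peval :: "'c \<Rightarrow> (nat \<Rightarrow> 'a) \<Rightarrow> 'c" where
  "peval \<equiv> UnivPoly.eval R S h"

lemma peval_hom: "s \<in> carrier S \<Longrightarrow> ring_hom_cring P S (peval s)"
  by (rule ring_homD[OF eval_ring_hom])

lemma peval_polys_below:
  assumes p_below: "p \<in> polys_below n" and s_closed: "s \<in> carrier S"
  shows "peval s p = (\<Oplus>\<^bsub>S\<^esub>i\<in>{..<n}. h (pcoeff p i) \<otimes>\<^bsub>S\<^esub> s [^]\<^bsub>S\<^esub> i)"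
proof -
  have p_closed: "p \<in> carrier P" using p_below unfolding polys_below_def by blast
  let ?t = "\<lambda>i. h (pcoeff p i) \<otimes>\<^bsub>S\<^esub> s [^]\<^bsub>S\<^esub> i"
  have vanish: "?t i = \<zero>\<^bsub>S\<^esub>" if "i > deg R p \<or> i \<ge> n" for i
    using that p_below deg_aboveD[OF _ p_closed] s_closed unfolding polys_below_def by auto
  have "peval s p = (\<Oplus>\<^bsub>S\<^esub>i\<in>{..deg R p} \<union> {..<n}. ?t i)"
    unfolding eval_on_carrier[OF p_closed]
    by (rule S.add.finprod_mono_neutral_cong_left) (use p_closed s_closed vanish in auto)
  also have "\<dots> = (\<Oplus>\<^bsub>S\<^esub>i\<in>{..<n}. ?t i)"
    by (rule S.add.finprod_mono_neutral_cong_right) (use p_closed s_closed vanish in auto)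
  finally show ?thesis .
qed

lemma peval_linear_factor:
  assumes "s \<in> carrier S" "c \<in> carrier R"
  shows "peval s (linear_factor c) = s \<ominus>\<^bsub>S\<^esub> h c"
proof -
  interpret ev: ring_hom_cring P S "peval s" by (rule peval_hom[OF assms(1)])
  show ?thesis using assms eval_monom1 eval_const by (simp add: a_minus_def)
qed

definition integral_over :: "'a set \<Rightarrow> nat \<Rightarrow> 'c \<Rightarrow> bool" where
  "integral_over I n x \<longleftrightarrow>
    (\<exists>p. monic n p \<and> p \<ominus>\<^bsub>P\<^esub> up_ring.monom P \<one> n \<in> poly_ideal I \<and> peval x p = \<zero>\<^bsub>S\<^esub>)"

lemma integral_over_imp_monic_value:
  assumes "integral_over I n x" and x_closed: "x \<in> carrier S"
  shows "\<exists>b. (\<forall>j\<in>{1..n}. b j \<in> I) \<and> monic_value S h n b x = \<zero>\<^bsub>S\<^esub>"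
proof -
  obtain p where p: "monic n p" "p \<ominus>\<^bsub>P\<^esub> up_ring.monom P \<one> n \<in> poly_ideal I" "peval x p = \<zero>\<^bsub>S\<^esub>"
    using assms(1) unfolding integral_over_def by blast
  note p_closed = monic_closed[OF p(1)]
  let ?t = "\<lambda>i. h (pcoeff p i) \<otimes>\<^bsub>S\<^esub> x [^]\<^bsub>S\<^esub> i"
  have mem: "pcoeff p i \<in> I" if "i < n" for i
  proof -
    have "pcoeff (p \<ominus>\<^bsub>P\<^esub> up_ring.monom P \<one> n) i = pcoeff p i"
      using p_closed that by (simp add: R.minus_eq)
    then show ?thesis
      using p(2) unfolding poly_ideal_def by (metis (mono_tags, lifting) mem_Collect_eq)
  qed
  have image: "{..<n} = (\<lambda>j. n - j) ` {1..n}"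
  proof (intro equalityI subsetI)
    show "i \<in> (\<lambda>j. n - j) ` {1..n}" if "i \<in> {..<n}" for i
      using that by (intro image_eqI[of _ _ "n - i"]) auto
  qed auto
  have "p \<in> polys_below (Suc n)" using p(1) unfolding monic_def polys_below_def by auto
  then have "peval x p = (\<Oplus>\<^bsub>S\<^esub>i\<in>insert n {..<n}. ?t i)"
    using peval_polys_below x_closed by (simp add: lessThan_Suc)
  also have "\<dots> = x [^]\<^bsub>S\<^esub> n \<oplus>\<^bsub>S\<^esub> (\<Oplus>\<^bsub>S\<^esub>i\<in>{..<n}. ?t i)"
    using p_closed x_closed p(1) by (subst S.finsum_insert) (auto simp: monic_def)
  also have "(\<Oplus>\<^bsub>S\<^esub>i\<in>{..<n}. ?t i) = (\<Oplus>\<^bsub>S\<^esub>j\<in>{1..n}. ?t (n - j))"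
    unfolding image by (rule S.finsum_reindex) (use p_closed x_closed in \<open>auto simp: inj_on_def\<close>)
  finally have "monic_value S h n (\<lambda>j. pcoeff p (n - j)) x = \<zero>\<^bsub>S\<^esub>"
    using p(3) unfolding monic_value_def by simp
  then show ?thesis using mem by (intro exI[of _ "\<lambda>j. pcoeff p (n - j)"]) auto
qed

lemma submodule_peval_polys_below:
  assumes x_closed: "x \<in> carrier S"
  shows "submodule (peval x ` polys_below n) R (restrict_scalars S h)"
proof (rule submodule_restrict_scalarsI)
  interpret ev: ring_hom_cring P S "peval x" by (rule peval_hom[OF x_closed])
  show "peval x ` polys_below n \<subseteq> carrier S" unfolding polys_below_def by auto
  show "\<zero>\<^bsub>S\<^esub> \<in> peval x ` polys_below n"
    by (rule image_eqI[of _ _ "\<zero>\<^bsub>P\<^esub>"]) (auto simp: polys_below_def)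
  show "a \<oplus>\<^bsub>S\<^esub> b \<in> peval x ` polys_below n"
    if ab: "a \<in> peval x ` polys_below n" "b \<in> peval x ` polys_below n" for a b
  proof -
    obtain p q where pq: "p \<in> polys_below n" "q \<in> polys_below n" "a = peval x p" "b = peval x q"
      using ab by blast
    then show ?thesis by (intro image_eqI[of _ _ "p \<oplus>\<^bsub>P\<^esub> q"]) (auto simp: polys_below_def)
  qed
  show "h c \<otimes>\<^bsub>S\<^esub> a \<in> peval x ` polys_below n"
    if c_closed: "c \<in> carrier R" and a: "a \<in> peval x ` polys_below n" for c a
  proof -
    obtain p where p: "p \<in> polys_below n" "p \<in> carrier P" "a = peval x p"
      using a unfolding polys_below_def by blast
    have "peval x (c \<odot>\<^bsub>P\<^esub> p) = h c \<otimes>\<^bsub>S\<^esub> a"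
      using c_closed p(2,3) eval_const[OF x_closed c_closed] by (simp flip: monom_mult_is_smult)
    then show ?thesis
      using c_closed p by (intro image_eqI[of _ _ "c \<odot>\<^bsub>P\<^esub> p"]) (auto simp: polys_below_def)
  qed
qed

theorem integral_over_carrier_if_module_finite:
  assumes noeth: "noetherian_ring R" and fin: "module_finite_via R S h"
    and x_closed: "x \<in> carrier S"
  shows "\<exists>n. integral_over (carrier R) n x"
proof -
  interpret ev: ring_hom_cring P S "peval x" by (rule peval_hom[OF x_closed])
  let ?N = "\<lambda>n. peval x ` polys_below n" and ?X = "\<lambda>n. up_ring.monom P \<one> n"
  obtain G where G: "finite G" "G \<subseteq> carrier S" "carrier S \<subseteq> scalars.span G"
    using fin module_finite_via_iff_span by blast
  have "\<exists>k. \<forall>n\<ge>k. ?N n = ?N k"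
  proof (rule scalars.ascending_submodules_stationary[OF noeth G(1)])
    show "?N n \<subseteq> scalars.span G" for n using G(3) unfolding polys_below_def by auto
    show "incseq ?N" by (rule incseq_SucI) (auto simp: polys_below_def)
  qed (use G(2) submodule_peval_polys_below[OF x_closed] in auto)
  then obtain n where n: "?N (Suc n) = ?N n" by (metis le_SucI order_refl)
  have "?X n \<in> polys_below (Suc n)" unfolding polys_below_def by simp
  then obtain q where q: "q \<in> polys_below n" "q \<in> carrier P" "peval x (?X n) = peval x q"
    using n unfolding polys_below_def by blast
  have "monic n (?X n \<ominus>\<^bsub>P\<^esub> q)"
    using q unfolding monic_def polys_below_def by (auto simp: R.minus_eq)
  moreover have "?X n \<ominus>\<^bsub>P\<^esub> q \<ominus>\<^bsub>P\<^esub> ?X n \<in> poly_ideal (carrier R)"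
    using q(2) unfolding poly_ideal_def by simp
  moreover have "peval x (?X n \<ominus>\<^bsub>P\<^esub> q) = \<zero>\<^bsub>S\<^esub>" using q(2,3) by (simp add: P.minus_eq S.r_neg)
  ultimately show ?thesis unfolding integral_over_def by blast
qed

lemma peval_monic_notin_primeideal:
  assumes Q_prime: "primeideal Q S" and J: "ideal J S" "Q \<subseteq> J"
    and contract: "\<And>c. c \<in> carrier R \<Longrightarrow> h c \<in> J \<Longrightarrow> h c \<in> Q"
    and x: "x \<in> J" "x \<notin> Q" and p_monic: "monic n p"
  shows "peval x p \<notin> Q"
  using p_monic
proof (induction n arbitrary: p)
  case 0
  interpret ev: ring_hom_cring P S "peval x" by (rule peval_hom[OF ideal.Icarr[OF J(1) x(1)]])
  show ?case using monic_0_eq_one[OF 0] S.primeideal_one_notin[OF Q_prime] by simp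
next
  case (Suc n)
  note Q_ideal = primeideal.axioms(1)[OF Q_prime]
  have x_closed: "x \<in> carrier S" by (rule ideal.Icarr[OF J(1) x(1)])
  interpret ev: ring_hom_cring P S "peval x" by (rule peval_hom[OF x_closed])
  have "\<one>\<^bsub>S\<^esub> \<noteq> \<zero>\<^bsub>S\<^esub>" using S.primeideal_one_notin[OF Q_prime] ideal_zero_closed[OF Q_ideal] by metis
  then have nontrivial: "\<one> \<noteq> \<zero>" using hom_one hom_zero by metis
  obtain q r where q: "monic n q" "r \<in> carrier R" "p = linear_factor \<zero> \<otimes>\<^bsub>P\<^esub> q \<oplus>\<^bsub>P\<^esub> pconst r"
    using exists_monic_remainder[OF Suc.prems R.zero_closed nontrivial]
      value_at_closed[OF R.zero_closed monic_closed[OF Suc.prems]] by blast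
  note q_closed = monic_closed[OF q(1)]
  have eq: "peval x p = x \<otimes>\<^bsub>S\<^esub> peval x q \<oplus>\<^bsub>S\<^esub> h r"
    unfolding q(3)
    using q_closed q(2) monic_closed[OF monic_linear_factor]
      peval_linear_factor[OF x_closed R.zero_closed] x_closed
      eval_const[OF x_closed q(2)] by (simp add: S.minus_eq)
  show ?case
  proof
    assume mem: "peval x p \<in> Q"
    have "x \<otimes>\<^bsub>S\<^esub> peval x q \<in> J" using ideal.I_r_closed[OF J(1) x(1)] q_closed by simp
    then have "h r \<in> J"
      using S.ideal_cancel_add[OF J(1), of "x \<otimes>\<^bsub>S\<^esub> peval x q" "h r"] mem J(2) q(2) unfolding eq
      by auto
    then have "h r \<in> Q" by (rule contract[OF q(2)])
    then have "x \<otimes>\<^bsub>S\<^esub> peval x q \<in> Q"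
      using S.ideal_cancel_add[OF Q_ideal, of "h r" "x \<otimes>\<^bsub>S\<^esub> peval x q"] mem q(2) x_closed q_closed
      unfolding eq by (simp add: S.a_comm)
    then show False
      using primeideal.I_prime[OF Q_prime x_closed] x(2) q_closed Suc.IH[OF q(1)] by auto
  qed
qed

lemma incomparability_if_integral:
  assumes Q_prime: "primeideal Q S" and J: "ideal J S" "Q \<subseteq> J"
    and contract: "\<And>c. c \<in> carrier R \<Longrightarrow> h c \<in> J \<Longrightarrow> h c \<in> Q"
    and integral: "\<And>x. x \<in> carrier S \<Longrightarrow> \<exists>n. integral_over (carrier R) n x"
  shows "J = Q"
proof (rule ccontr)
  assume "J \<noteq> Q"
  then obtain x where x: "x \<in> J" "x \<notin> Q" using J(2) by blast
  obtain n p where p: "monic n p" "peval x p = \<zero>\<^bsub>S\<^esub>"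
    using integral[OF ideal.Icarr[OF J(1) x(1)]] unfolding integral_over_def by blast
  show False
    using peval_monic_notin_primeideal[OF Q_prime J contract x p(1)] p(2)
      ideal_zero_closed[OF primeideal.axioms(1)[OF Q_prime]] by simp
qed

end

lemma (in ring_hom_cring) incomparability_if_module_finite:
  assumes "noetherian_ring R" "module_finite_via R S h"
    and "primeideal Q S" "ideal J S" "Q \<subseteq> J" "\<And>c. c \<in> carrier R \<Longrightarrow> h c \<in> J \<Longrightarrow> h c \<in> Q"
  shows "J = Q"
proof -
  interpret UP_pre_univ_prop R S h "UP R" by unfold_locales
  show ?thesis
    using incomparability_if_integral[OF assms(3-6)]
      integral_over_carrier_if_module_finite[OF assms(1,2)] by blast
qed

context UP_pre_univ_prop
begin

lemma peval_translated_step: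
  assumes c_closed: "c \<in> carrier R" and s_closed: "s \<in> carrier S"
    and q: "q \<in> carrier P" "q' \<in> carrier P"
    and b_closed: "b \<in> carrier R" and eq: "peval (s \<ominus>\<^bsub>S\<^esub> h c) q' = peval s q"
  shows "peval (s \<ominus>\<^bsub>S\<^esub> h c) (up_ring.monom P \<one> 1 \<otimes>\<^bsub>P\<^esub> q' \<oplus>\<^bsub>P\<^esub> pconst b)
    = peval s (linear_factor c \<otimes>\<^bsub>P\<^esub> q \<oplus>\<^bsub>P\<^esub> pconst b)"
proof -
  have t: "s \<ominus>\<^bsub>S\<^esub> h c \<in> carrier S" using s_closed c_closed by simp
  interpret ev: ring_hom_cring P S "peval s" by (rule peval_hom[OF s_closed])
  interpret ev': ring_hom_cring P S "peval (s \<ominus>\<^bsub>S\<^esub> h c)" by (rule peval_hom[OF t])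
  show ?thesis
    using q b_closed eq monic_closed[OF monic_linear_factor[OF c_closed]]
      peval_linear_factor[OF s_closed c_closed]
      eval_monom1[OF t] eval_const[OF t b_closed] eval_const[OF s_closed b_closed] by simp
qed

lemma exists_translated_poly:
  assumes c_closed: "c \<in> carrier R" and I_ideal: "ideal I R"
    and p: "p \<in> polys_below n" "p \<in> poly_ideal I"
  shows "\<exists>q\<in>polys_below n \<inter> poly_ideal I. \<forall>s\<in>carrier S. peval (s \<ominus>\<^bsub>S\<^esub> h c) q = peval s p"
  using p
proof (induction n arbitrary: p)
  case 0
  then have "p = \<zero>\<^bsub>P\<^esub>" unfolding polys_below_def by (auto intro: up_eqI)
  then show ?case
    using 0 c_closed ring_hom_cring.hom_zero[OF peval_hom] by (intro bexI[of _ "\<zero>\<^bsub>P\<^esub>"]) auto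
next
  case (Suc n)
  have p_closed: "p \<in> carrier P" using Suc.prems unfolding poly_ideal_def by blast
  note linear_factor_monic = monic_linear_factor[OF c_closed]
  obtain q r where q: "q \<in> carrier P" "r \<in> polys_below 1" "p = linear_factor c \<otimes>\<^bsub>P\<^esub> q \<oplus>\<^bsub>P\<^esub> r"
    using monic_division[OF linear_factor_monic p_closed] by blast
  define b where "b = pcoeff r 0"
  have r_closed: "r \<in> carrier P" using q(2) unfolding polys_below_def by blast
  then have b_closed: "b \<in> carrier R" unfolding b_def by simp
  have r_eq: "r = pconst b"
    using q(2) r_closed unfolding polys_below_def b_def by (intro up_eqI) auto
  have qr: "q \<in> poly_ideal I" "r \<in> poly_ideal I"
    using poly_ideal_if_monic_division[OF linear_factor_monic q(1,2) I_ideal] Suc.prems(2) q(3)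
    by auto
  have "q \<in> polys_below n"
    using polys_below_if_monic_mult_add[OF linear_factor_monic q(1,2), of n] Suc.prems(1) q(3)
    by simp
  then obtain q' where q': "q' \<in> polys_below n" "q' \<in> poly_ideal I"
    "\<forall>s\<in>carrier S. peval (s \<ominus>\<^bsub>S\<^esub> h c) q' = peval s q"
    using Suc.IH qr(1) by blast
  have q'_closed: "q' \<in> carrier P" using q'(2) unfolding poly_ideal_def by blast
  let ?p' = "up_ring.monom P \<one> 1 \<otimes>\<^bsub>P\<^esub> q' \<oplus>\<^bsub>P\<^esub> r"
  have "?p' \<in> poly_ideal I"
    using ideal_add_closed[OF poly_ideal_ideal[OF I_ideal]
      ideal.I_l_closed[OF poly_ideal_ideal[OF I_ideal] q'(2)] qr(2)]
    by simp
  moreover have "?p' \<in> polys_below (Suc n)" by (rule polys_below_mult_X_add[OF q'(1) q(2)])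
  moreover have "peval (s \<ominus>\<^bsub>S\<^esub> h c) ?p' = peval s p" if "s \<in> carrier S" for s
    unfolding q(3) r_eq using q'(3) that
    by (intro peval_translated_step[OF c_closed _ q(1) q'_closed b_closed]) auto
  ultimately show ?case by (intro bexI[of _ ?p']) auto
qed

lemma integral_over_shift_if_linear_power_cong:
  assumes I_ideal: "ideal I R" and c_closed: "c \<in> carrier R" and s_closed: "s \<in> carrier S"
    and g_monic: "monic e g"
    and cong: "g \<ominus>\<^bsub>P\<^esub> linear_factor c [^]\<^bsub>P\<^esub> e \<in> poly_ideal I" and root: "peval s g = \<zero>\<^bsub>S\<^esub>"
  shows "integral_over I e (s \<ominus>\<^bsub>S\<^esub> h c)"
proof -
  have t: "s \<ominus>\<^bsub>S\<^esub> h c \<in> carrier S" using s_closed c_closed by simp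
  interpret ev: ring_hom_cring P S "peval s" by (rule peval_hom[OF s_closed])
  interpret ev': ring_hom_cring P S "peval (s \<ominus>\<^bsub>S\<^esub> h c)" by (rule peval_hom[OF t])
  let ?Le = "linear_factor c [^]\<^bsub>P\<^esub> e" and ?X = "up_ring.monom P \<one> e"
  have power_monic: "monic e ?Le" by (rule monic_linear_factor_pow[OF c_closed])
  note in_carrier = monic_closed[OF g_monic] monic_closed[OF power_monic]
    monic_closed[OF monic_linear_factor[OF c_closed]]
  have "g \<ominus>\<^bsub>P\<^esub> ?Le \<in> polys_below e"
    unfolding polys_below_def using g_monic power_monic in_carrier unfolding monic_def
    by (auto simp: R.minus_eq R.r_neg le_less)
  then obtain q where q: "q \<in> polys_below e" "q \<in> poly_ideal I"
    "peval (s \<ominus>\<^bsub>S\<^esub> h c) q = peval s (g \<ominus>\<^bsub>P\<^esub> ?Le)"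
    using exists_translated_poly[OF c_closed I_ideal _ cong] s_closed by blast
  have q_closed: "q \<in> carrier P" using q(2) unfolding poly_ideal_def by blast
  have "peval (s \<ominus>\<^bsub>S\<^esub> h c) ?X = peval s ?Le"
    using eval_monom[OF R.one_closed t] t in_carrier peval_linear_factor[OF s_closed c_closed]
    by simp
  moreover have "peval s (g \<ominus>\<^bsub>P\<^esub> ?Le) = peval s g \<ominus>\<^bsub>S\<^esub> peval s ?Le"
    using ev.hom_closed[OF in_carrier(2)] in_carrier(1,2) unfolding P.minus_eq S.minus_eq
    by (simp only: ev.hom_add ev.hom_a_inv P.a_inv_closed)
  ultimately have "peval (s \<ominus>\<^bsub>S\<^esub> h c) (?X \<oplus>\<^bsub>P\<^esub> q) = peval s ?Le \<oplus>\<^bsub>S\<^esub> (\<zero>\<^bsub>S\<^esub> \<ominus>\<^bsub>S\<^esub> peval s ?Le)"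
    using q(3) q_closed root ev'.hom_add[OF monom_closed[OF R.one_closed] q_closed] by simp
  also have "\<dots> = \<zero>\<^bsub>S\<^esub>" using ev.hom_closed[OF in_carrier(2)] by (simp add: S.minus_eq S.r_neg)
  finally have "peval (s \<ominus>\<^bsub>S\<^esub> h c) (?X \<oplus>\<^bsub>P\<^esub> q) = \<zero>\<^bsub>S\<^esub>" .
  moreover have "monic e (?X \<oplus>\<^bsub>P\<^esub> q)"
    by (rule monic_add_polys_below[OF _ q(1)]) (simp add: monic_def)
  moreover have "(?X \<oplus>\<^bsub>P\<^esub> q) \<ominus>\<^bsub>P\<^esub> ?X = q"
    using q_closed monom_closed[OF R.one_closed, of e] by algebra
  ultimately show ?thesis using q(2) unfolding integral_over_def by metis
qed

end

section \<open>Integral elements over a complete local ring\<close>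

context cring
begin

definition comaximal :: "'a \<Rightarrow> 'a \<Rightarrow> bool" where
  "comaximal a b \<longleftrightarrow> (\<exists>u\<in>carrier R. \<exists>v\<in>carrier R. u \<otimes> a \<oplus> v \<otimes> b = \<one>)"

lemma comaximal_mult_left:
  assumes "comaximal a c" "comaximal b c"
    and in_carrier: "a \<in> carrier R" "b \<in> carrier R" "c \<in> carrier R"
  shows "comaximal (a \<otimes> b) c"
proof -
  obtain u v u' v' where uv: "u \<in> carrier R" "v \<in> carrier R" "u \<otimes> a \<oplus> v \<otimes> c = \<one>"
    and uv': "u' \<in> carrier R" "v' \<in> carrier R" "u' \<otimes> b \<oplus> v' \<otimes> c = \<one>"
    using assms(1,2) unfolding comaximal_def by blast
  have "(u \<otimes> u') \<otimes> (a \<otimes> b) \<oplus> (u \<otimes> a \<otimes> v' \<oplus> v) \<otimes> c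
      = u \<otimes> a \<otimes> (u' \<otimes> b \<oplus> v' \<otimes> c) \<oplus> v \<otimes> c"
    using uv(1,2) uv'(1,2) in_carrier by algebra
  also have "\<dots> = \<one>" unfolding uv'(3) using uv in_carrier by simp
  finally show ?thesis
    unfolding comaximal_def using uv uv' in_carrier
    by (intro bexI[of _ "u \<otimes> u'"] bexI[of _ "u \<otimes> a \<otimes> v' \<oplus> v"]) auto
qed

lemma comaximal_nat_pow_left:
  assumes "comaximal a c" "a \<in> carrier R" "c \<in> carrier R"
  shows "comaximal (a [^] (n::nat)) c"
proof (induction n)
  case 0
  have "\<one> \<otimes> \<one> \<oplus> \<zero> \<otimes> c = \<one>" using assms(3) by simp
  then show ?case unfolding comaximal_def nat_pow_0 by blast
next
  case (Suc n)
  then show ?case using comaximal_mult_left[OF Suc assms(1)] assms(2,3) by simp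
qed

end

lemma (in ring) eval_map_rev_upt:
  assumes "\<And>i. a i \<in> carrier R" "x \<in> carrier R"
  shows "eval (map a (rev [0..<n])) x = (\<Oplus>i\<in>{..<n}. a i \<otimes> x [^] i)"
  using assms by (induction n) (simp_all add: lessThan_Suc)

context UP_cring
begin

lemma comaximal_linear_factor:
  assumes c_closed: "c \<in> carrier R" and q_closed: "q \<in> carrier P" and unit: "value_at c q \<in> Units R"
  shows "P.comaximal (linear_factor c) q"
proof (cases "\<one> = \<zero>")
  case True
  then have "pcoeff \<one>\<^bsub>P\<^esub> i = pcoeff \<zero>\<^bsub>P\<^esub> i" for i by simp
  then have "\<zero>\<^bsub>P\<^esub> \<otimes>\<^bsub>P\<^esub> linear_factor c \<oplus>\<^bsub>P\<^esub> \<zero>\<^bsub>P\<^esub> \<otimes>\<^bsub>P\<^esub> q = \<one>\<^bsub>P\<^esub>"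
    using monic_closed[OF monic_linear_factor[OF c_closed]] q_closed by (intro up_eqI) auto
  then show ?thesis unfolding P.comaximal_def by blast
next
  case False
  define r where "r = value_at c q"
  note linear_factor_closed = monic_closed[OF monic_linear_factor[OF c_closed]]
  have r: "r \<in> carrier R" "inv r \<in> carrier R" "inv r \<otimes> r = \<one>"
    using unit unfolding r_def by auto
  obtain q' where q': "q' \<in> carrier P" "q = linear_factor c \<otimes>\<^bsub>P\<^esub> q' \<oplus>\<^bsub>P\<^esub> pconst r"
    using remainder_value_at[OF q_closed c_closed False] unfolding r_def by blast
  have inv: "pconst (inv r) \<otimes>\<^bsub>P\<^esub> pconst r = \<one>\<^bsub>P\<^esub>"
    using r by (simp flip: monom_mult)
  have closed: "pconst (inv r) \<in> carrier P" "pconst r \<in> carrier P" using r by auto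
  have "\<ominus>\<^bsub>P\<^esub> (pconst (inv r) \<otimes>\<^bsub>P\<^esub> q') \<otimes>\<^bsub>P\<^esub> linear_factor c \<oplus>\<^bsub>P\<^esub> pconst (inv r) \<otimes>\<^bsub>P\<^esub> q
      = pconst (inv r) \<otimes>\<^bsub>P\<^esub> pconst r"
    unfolding q'(2) using q'(1) linear_factor_closed closed by algebra
  then show ?thesis
    unfolding P.comaximal_def inv using q'(1) closed
    by (intro bexI[of _ "\<ominus>\<^bsub>P\<^esub> (pconst (inv r) \<otimes>\<^bsub>P\<^esub> q')"] bexI[of _ "pconst (inv r)"]) auto
qed

lemma exists_linear_factor_power_split:
  assumes I: "ideal I R" "\<one> \<notin> I" and f_monic: "monic n f" and c_closed: "c \<in> carrier R"
  shows "\<exists>e m q. n = e + m \<and> monic m q \<and> f \<ominus>\<^bsub>P\<^esub> linear_factor c [^]\<^bsub>P\<^esub> e \<otimes>\<^bsub>P\<^esub> q \<in> poly_ideal I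
    \<and> value_at c q \<notin> I \<and> (value_at c f \<in> I \<longrightarrow> e \<ge> 1)"
  using f_monic
proof (induction n arbitrary: f)
  case 0
  interpret ev: ring_hom_cring P R "value_at c" by (rule value_at_hom[OF c_closed])
  have "f = \<one>\<^bsub>P\<^esub>" using 0 by (rule monic_0_eq_one)
  then show ?case
    using I(2) monic_one ideal_zero_closed[OF poly_ideal_ideal[OF I(1)]]
    by (intro exI[of _ 0] exI[of _ "\<one>\<^bsub>P\<^esub>"]) (simp add: P.minus_eq P.r_neg)
next
  case (Suc n)
  note f_closed = monic_closed[OF Suc.prems]
    and linear_factor_closed = monic_closed[OF monic_linear_factor[OF c_closed]]
  define r where "r = value_at c f"
  show ?case
  proof (cases "r \<in> I")
    case False
    then show ?thesis
      using Suc.prems f_closed ideal_zero_closed[OF poly_ideal_ideal[OF I(1)]] unfolding r_def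
      by (intro exI[of _ 0] exI[of _ "Suc n"] exI[of _ f]) (simp add: P.minus_eq P.r_neg)
  next
    case True
    have "\<one> \<noteq> \<zero>" using I ideal_zero_closed by metis
    then obtain q where q: "monic n q" "f = linear_factor c \<otimes>\<^bsub>P\<^esub> q \<oplus>\<^bsub>P\<^esub> pconst r"
      using exists_monic_remainder[OF Suc.prems c_closed] unfolding r_def by blast
    obtain e m q' where q': "n = e + m" "monic m q'" "value_at c q' \<notin> I"
      "q \<ominus>\<^bsub>P\<^esub> linear_factor c [^]\<^bsub>P\<^esub> e \<otimes>\<^bsub>P\<^esub> q' \<in> poly_ideal I"
      using Suc.IH[OF q(1)] by blast
    note closed = monic_closed[OF q(1)] monic_closed[OF q'(2)] linear_factor_closed
      P.nat_pow_closed[OF linear_factor_closed, of e]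
      monom_closed[OF ideal.Icarr[OF I(1) True], of 0]
    have "f \<ominus>\<^bsub>P\<^esub> linear_factor c [^]\<^bsub>P\<^esub> Suc e \<otimes>\<^bsub>P\<^esub> q'
        = linear_factor c \<otimes>\<^bsub>P\<^esub> (q \<ominus>\<^bsub>P\<^esub> linear_factor c [^]\<^bsub>P\<^esub> e \<otimes>\<^bsub>P\<^esub> q') \<oplus>\<^bsub>P\<^esub> pconst r"
      unfolding q(2) P.nat_pow_Suc using closed by algebra
    also have "\<dots> \<in> poly_ideal I"
      by (intro ideal_add_closed[OF poly_ideal_ideal[OF I(1)]] pconst_mem_poly_ideal[OF I(1) True]
          ideal.I_l_closed[OF poly_ideal_ideal[OF I(1)] q'(4) linear_factor_closed])
    finally show ?thesis
      using q' by (intro exI[of _ "Suc e"] exI[of _ m] exI[of _ q']) simp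
  qed
qed

end

locale complete_local_ring = noetherian_cring R for R (structure) +
  assumes local: "local_ring R" and complete: "madic_complete R"
begin

abbreviation "\<mm> \<equiv> max_ideal R"

lemma m_maximal: "maximalideal \<mm> R"
  by (rule maximalideal_max_ideal[OF local])

lemma m_ideal: "ideal \<mm> R"
  by (rule maximalideal.axioms(1)[OF m_maximal])

lemma one_notin_m: "\<one> \<notin> \<mm>"
  by (rule primeideal_one_notin[OF maximalideal_prime[OF m_maximal]])

sublocale adic_complete R \<mm>
proof (intro adic_complete.intro adic_complete_axioms.intro is_cring m_ideal)
  show "(\<Inter>k. ideal_pow R \<mm> k) = {\<zero>}" using complete unfolding madic_complete_def by (rule conjunct1)
  fix x :: "nat \<Rightarrow> 'a"
  assume "\<And>n. x n \<in> carrier R" "\<forall>k. \<exists>N. \<forall>p\<ge>N. \<forall>q\<ge>N. x p \<ominus> x q \<in> ideal_pow R \<mm> k"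
  then have "(\<forall>n. x n \<in> carrier R) \<and> (\<forall>k. \<exists>N. \<forall>p\<ge>N. \<forall>q\<ge>N. x p \<ominus> x q \<in> ideal_pow R \<mm> k)" by simp
  then show "\<exists>l\<in>carrier R. \<forall>k. \<exists>N. \<forall>n\<ge>N. x n \<ominus> l \<in> ideal_pow R \<mm> k"
    by (rule complete[unfolded madic_complete_def, THEN conjunct2, THEN spec, THEN mp])
qed

end

locale complete_local_UP = UP_cring R P + complete_local_ring R for R (structure) and P (structure)
begin

sublocale adic_complete_UP R P \<mm> ..

lemma exists_root_mod_max_ideal:
  assumes closed: "algebraically_closed (R Quot \<mm>)" and f: "monic n f" "n \<ge> 1"
  shows "\<exists>c\<in>carrier R. value_at c f \<in> \<mm>"
proof -
  interpret k: algebraically_closed "R Quot \<mm>" by (rule closed)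
  interpret q: ring_hom_ring R "R Quot \<mm>" "(+>) \<mm>" by (rule ideal.rcos_ring_hom_ring[OF m_ideal])
  interpret id: UP_pre_univ_prop R R id P by unfold_locales (auto simp: P_def)
  note f_closed = monic_closed[OF f(1)]
  let ?l = "map (pcoeff f) (rev [0..<Suc n])"
  let ?p = "map ((+>) \<mm>) ?l"
  have l: "set ?l \<subseteq> carrier R" using f_closed by auto
  have "hd ?p = \<one>\<^bsub>R Quot \<mm>\<^esub>" using f(1) unfolding monic_def by simp
  then have p: "?p \<in> carrier (poly_ring (R Quot \<mm>))"
    unfolding univ_poly_carrier[symmetric] polynomial_def using l k.one_not_zero by auto
  have "k.splitted ?p" by (rule k.roots_over_carrier[OF p])
  then have "size (k.roots ?p) = n" unfolding k.splitted_def by simp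
  then obtain a where "a \<in># k.roots ?p"
    using f(2) by (metis multiset_nonemptyE not_one_le_zero size_empty)
  then have a: "a \<in> carrier (R Quot \<mm>)" "k.eval ?p a = \<zero>\<^bsub>R Quot \<mm>\<^esub>"
    using k.roots_mem_iff_is_root[OF p] unfolding k.is_root_def by auto
  obtain c where c: "c \<in> carrier R" "a = \<mm> +> c"
    using a(1) unfolding FactRing_def A_RCOSETS_def' by auto
  have "f \<in> polys_below (Suc n)" using f(1) unfolding monic_def polys_below_def by auto
  then have eval: "R.eval ?l c = value_at c f"
    using id.peval_polys_below c(1) R.eval_map_rev_upt[of "pcoeff f" c "Suc n"] f_closed
    unfolding value_at_def by simp
  have "\<mm> +> R.eval ?l c = \<zero>\<^bsub>R Quot \<mm>\<^esub>"
    using q.eval_hom'[OF c(1) l] a(2) c(2) by simp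
  then have "\<mm> +> R.eval ?l c = \<mm>" unfolding FactRing_def by simp
  then have "R.eval ?l c \<in> \<mm>"
    by (rule ideal.rcos_const_imp_mem[OF m_ideal R.eval_in_carrier[OF l c(1)]])
  then show ?thesis using c(1) unfolding eval by blast
qed

lemma exists_factor_cong_linear_power:
  assumes closed: "algebraically_closed (R Quot \<mm>)" and f: "monic n f" "n \<ge> 1"
  shows "\<exists>c e m G H. c \<in> carrier R \<and> e \<ge> 1 \<and> n = e + m \<and> monic e G \<and> monic m H \<and> f = G \<otimes>\<^bsub>P\<^esub> H
    \<and> G \<ominus>\<^bsub>P\<^esub> linear_factor c [^]\<^bsub>P\<^esub> e \<in> poly_ideal \<mm>"
proof -
  obtain c where c: "c \<in> carrier R" "value_at c f \<in> \<mm>"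
    using exists_root_mod_max_ideal[OF closed f] by auto
  define L where "L = linear_factor c"
  obtain e m q where q: "n = e + m" "monic m q" "f \<ominus>\<^bsub>P\<^esub> L [^]\<^bsub>P\<^esub> e \<otimes>\<^bsub>P\<^esub> q \<in> poly_ideal \<mm>"
    "value_at c q \<notin> \<mm>" and e: "e \<ge> 1"
    using exists_linear_factor_power_split[OF m_ideal one_notin_m f(1) c(1)] c(2)
    unfolding L_def by blast
  note f_closed = monic_closed[OF f(1)] and q_closed = monic_closed[OF q(2)]
  have L_closed: "L \<in> carrier P"
    unfolding L_def by (rule monic_closed[OF monic_linear_factor[OF c(1)]])
  have power_monic: "monic e (L [^]\<^bsub>P\<^esub> e)"
    unfolding L_def by (rule monic_linear_factor_pow[OF c(1)])
  have "value_at c q \<in> Units R"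
    using R.Units_if_notin_max_ideal[OF local _ q(4)] value_at_closed[OF c(1) q_closed] by blast
  then have "P.comaximal (L [^]\<^bsub>P\<^esub> e) q"
    using comaximal_linear_factor[OF c(1) q_closed] L_closed q_closed unfolding L_def
    by (intro P.comaximal_nat_pow_left)
  then obtain u v where uv: "u \<in> carrier P" "v \<in> carrier P"
    "u \<otimes>\<^bsub>P\<^esub> L [^]\<^bsub>P\<^esub> e \<oplus>\<^bsub>P\<^esub> v \<otimes>\<^bsub>P\<^esub> q = \<one>\<^bsub>P\<^esub>"
    unfolding P.comaximal_def by blast
  have "u \<otimes>\<^bsub>P\<^esub> L [^]\<^bsub>P\<^esub> e \<oplus>\<^bsub>P\<^esub> v \<otimes>\<^bsub>P\<^esub> q \<ominus>\<^bsub>P\<^esub> \<one>\<^bsub>P\<^esub> \<in> poly_ideal \<mm>"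
    unfolding uv(3) using ideal_zero_closed[OF poly_I_ideal] by (simp add: P.minus_eq P.r_neg)
  then obtain G H where G: "monic e G" "G \<ominus>\<^bsub>P\<^esub> L [^]\<^bsub>P\<^esub> e \<in> poly_ideal \<mm>"
    "H \<in> carrier P" "f = G \<otimes>\<^bsub>P\<^esub> H"
    using hensel_factorization[OF f_closed power_monic q_closed uv(1,2) _ q(3)] by blast
  moreover have "monic m H" using monic_cofactor[OF G(1,3)] f(1) q(1) G(4) by simp
  ultimately show ?thesis using c(1) e q(1) unfolding L_def by blast
qed

end

locale complete_local_extension =
  complete_local_UP R P + UP_pre_univ_prop R S h P + S: domain S
  for R (structure) and S (structure) and h and P (structure)
begin

lemma exists_root_of_linear_power_mod_max_ideal:
  assumes closed: "algebraically_closed (R Quot \<mm>)" and s_closed: "s \<in> carrier S"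
    and f: "monic n f" "peval s f = \<zero>\<^bsub>S\<^esub>"
  shows "\<exists>c\<in>carrier R. \<exists>e\<ge>1. \<exists>g. monic e g \<and> g \<ominus>\<^bsub>P\<^esub> linear_factor c [^]\<^bsub>P\<^esub> e \<in> poly_ideal \<mm>
    \<and> peval s g = \<zero>\<^bsub>S\<^esub>"
  using f
proof (induction n arbitrary: f rule: less_induct)
  case (less n)
  interpret ev: ring_hom_cring P S "peval s" by (rule peval_hom[OF s_closed])
  have "n \<noteq> 0" using less.prems monic_0_eq_one ev.hom_one S.one_not_zero by metis
  then have "n \<ge> 1" by simp
  then obtain c e m G H where c: "c \<in> carrier R" "e \<ge> 1" "n = e + m"
    and G: "monic e G" "monic m H" "f = G \<otimes>\<^bsub>P\<^esub> H" "G \<ominus>\<^bsub>P\<^esub> linear_factor c [^]\<^bsub>P\<^esub> e \<in> poly_ideal \<mm>"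
    using exists_factor_cong_linear_power[OF closed less.prems(1)] by metis
  have "peval s G = \<zero>\<^bsub>S\<^esub> \<or> peval s H = \<zero>\<^bsub>S\<^esub>"
    using less.prems(2) G(3) monic_closed[OF G(1)] monic_closed[OF G(2)] S.integral by auto
  then show ?case
  proof
    assume "peval s G = \<zero>\<^bsub>S\<^esub>"
    then show ?thesis using c(1,2) G(1,4) by blast
  next
    assume "peval s H = \<zero>\<^bsub>S\<^esub>"
    then show ?thesis using less.IH[of m H] c(2,3) G(2) by simp
  qed
qed

theorem exists_shift_integral_over_max_ideal:
  assumes closed: "algebraically_closed (R Quot \<mm>)" and s_closed: "s \<in> carrier S"
    and integral: "integral_over (carrier R) n s"
  shows "\<exists>c\<in>carrier R. \<exists>k\<ge>1. integral_over \<mm> k (s \<ominus>\<^bsub>S\<^esub> h c)"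
proof -
  obtain f where "monic n f" "peval s f = \<zero>\<^bsub>S\<^esub>" using integral unfolding integral_over_def by blast
  then obtain c e g where c: "c \<in> carrier R" "e \<ge> 1" and g: "monic e g"
    "g \<ominus>\<^bsub>P\<^esub> linear_factor c [^]\<^bsub>P\<^esub> e \<in> poly_ideal \<mm>" "peval s g = \<zero>\<^bsub>S\<^esub>"
    using exists_root_of_linear_power_mod_max_ideal[OF closed s_closed] by blast
  then show ?thesis
    using integral_over_shift_if_linear_power_cong[OF m_ideal c(1) s_closed g] by blast
qed

end

section \<open>Polynomial rings in several variables\<close>

lemma finite_le_monomial:
  assumes "m \<in> monomials r"
  shows "finite {a. a \<le> m}"
proof (rule finite_subset)
  let ?bound = "Max (m ` {..<r})"
  show "{a. a \<le> m} \<subseteq> {a. \<forall>i. (i \<in> {..<r} \<longrightarrow> a i \<in> {..?bound}) \<and> (i \<notin> {..<r} \<longrightarrow> a i = 0)}"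
  proof (intro subsetI CollectI allI conjI impI)
    fix a i assume "a \<in> {a. a \<le> m}"
    then have a_le: "a i \<le> m i" by (simp add: le_fun_def)
    show "a i \<in> {..?bound}" if "i \<in> {..<r}"
      using le_trans[OF a_le Max_ge[of "m ` {..<r}" "m i"]] that by simp
    show "a i = 0" if "i \<notin> {..<r}" using a_le that assms by (auto simp: monomials_def)
  qed
  show "finite {a. \<forall>i. (i \<in> {..<r} \<longrightarrow> a i \<in> {..?bound}) \<and> (i \<notin> {..<r} \<longrightarrow> a i = (0::nat))}"
    by (rule finite_set_of_finite_funs) auto
qed

lemma zero_monomial: "(\<lambda>i. 0) \<in> monomials r"
  by (simp add: monomials_def)

lemma var_monomial: "i < r \<Longrightarrow> (\<lambda>j. if j = i then k else 0) \<in> monomials r"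
  by (auto simp: monomials_def)

lemma monomials_add: "a \<in> monomials r \<Longrightarrow> b \<in> monomials r \<Longrightarrow> (\<lambda>i. a i + b i) \<in> monomials r"
  by (simp add: monomials_def)

locale mpoly_cring = cring R for R (structure) + fixes r :: nat
begin

abbreviation P :: "((nat \<Rightarrow> nat) \<Rightarrow> 'a) ring" where
  "P \<equiv> mpoly_ring R r"

definition mp_term :: "'a \<Rightarrow> (nat \<Rightarrow> nat) \<Rightarrow> ((nat \<Rightarrow> nat) \<Rightarrow> 'a)" where
  "mp_term c a = (\<lambda>m. if m = a then c else \<zero>)"

lemma mp_const_eq_term: "mp_const R c = mp_term c (\<lambda>i. 0)"
  by (simp add: mp_const_def mp_term_def)

lemma mp_var_eq_term: "mp_var R i = mp_term \<one> (\<lambda>j. if j = i then 1 else 0)"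
  by (simp add: mp_var_def mp_term_def)

lemma mpoly_ring_simps:
  "p \<oplus>\<^bsub>P\<^esub> q = (\<lambda>m. p m \<oplus> q m)" "\<zero>\<^bsub>P\<^esub> = (\<lambda>m. \<zero>)" "\<one>\<^bsub>P\<^esub> = mp_term \<one> (\<lambda>i. 0)"
  by (simp_all add: mpoly_ring_def mp_term_def)

lemma mpoly_mult: "(p \<otimes>\<^bsub>P\<^esub> q) m = (if m \<in> monomials r
    then (\<Oplus>a\<in>{a. a \<le> m}. p a \<otimes> q (\<lambda>i. m i - a i)) else \<zero>)"
  by (simp add: mpoly_ring_def)

lemma mpoly_carrier_iff: "p \<in> carrier P \<longleftrightarrow>
    (\<forall>m. p m \<in> carrier R) \<and> (\<forall>m. m \<notin> monomials r \<longrightarrow> p m = \<zero>) \<and> finite {m. p m \<noteq> \<zero>}"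
  by (simp add: mpoly_ring_def)

lemma mpoly_coeff_closed: "p \<in> carrier P \<Longrightarrow> p m \<in> carrier R"
  by (simp add: mpoly_carrier_iff)

lemma mp_term_closed:
  assumes "c \<in> carrier R" "a \<in> monomials r"
  shows "mp_term c a \<in> carrier P"
proof -
  have "finite {m. mp_term c a m \<noteq> \<zero>}"
    by (rule finite_subset[of _ "{a}"]) (auto simp: mp_term_def)
  then show ?thesis using assms unfolding mpoly_carrier_iff mp_term_def by auto
qed

lemma mpoly_zero_closed: "\<zero>\<^bsub>P\<^esub> \<in> carrier P"
  by (simp add: mpoly_carrier_iff mpoly_ring_simps)

lemma mpoly_add_closed:
  assumes "p \<in> carrier P" "q \<in> carrier P"
  shows "p \<oplus>\<^bsub>P\<^esub> q \<in> carrier P"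
proof -
  have "finite {m. p m \<oplus> q m \<noteq> \<zero>}"
    by (rule finite_subset[of _ "{m. p m \<noteq> \<zero>} \<union> {m. q m \<noteq> \<zero>}"])
      (use assms in \<open>auto simp: mpoly_carrier_iff\<close>)
  then show ?thesis using assms by (simp add: mpoly_carrier_iff mpoly_ring_simps)
qed

lemma mpoly_abelian_group: "abelian_group P"
proof (rule abelian_groupI)
  fix p assume p_closed: "p \<in> carrier P"
  have "{m. \<ominus> p m \<noteq> \<zero>} = {m. p m \<noteq> \<zero>}" using mpoly_coeff_closed[OF p_closed] by auto
  then have "(\<lambda>m. \<ominus> p m) \<in> carrier P" using p_closed by (simp add: mpoly_carrier_iff)
  moreover have "(\<lambda>m. \<ominus> p m) \<oplus>\<^bsub>P\<^esub> p = \<zero>\<^bsub>P\<^esub>"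
    using mpoly_coeff_closed[OF p_closed] by (simp add: mpoly_ring_simps l_neg)
  ultimately show "\<exists>q\<in>carrier P. q \<oplus>\<^bsub>P\<^esub> p = \<zero>\<^bsub>P\<^esub>" by auto
qed (auto simp: mpoly_add_closed mpoly_zero_closed mpoly_coeff_closed mpoly_ring_simps a_ac
    intro: mpoly_add_closed[unfolded mpoly_ring_simps] mpoly_zero_closed[unfolded mpoly_ring_simps])

lemma mpoly_mult_closed:
  assumes p_closed: "p \<in> carrier P" and q_closed: "q \<in> carrier P"
  shows "p \<otimes>\<^bsub>P\<^esub> q \<in> carrier P"
proof -
  let ?A = "{m. p m \<noteq> \<zero>}" and ?B = "{m. q m \<noteq> \<zero>}"
  have fin: "finite ?A" "finite ?B" using p_closed q_closed by (auto simp: mpoly_carrier_iff)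
  note c = mpoly_coeff_closed[OF p_closed] mpoly_coeff_closed[OF q_closed]
  have "{m. (p \<otimes>\<^bsub>P\<^esub> q) m \<noteq> \<zero>} \<subseteq> (\<lambda>(a, b) i. a i + b i) ` (?A \<times> ?B)"
  proof
    fix m assume "m \<in> {m. (p \<otimes>\<^bsub>P\<^esub> q) m \<noteq> \<zero>}"
    then have m: "(\<Oplus>a\<in>{a. a \<le> m}. p a \<otimes> q (\<lambda>i. m i - a i)) \<noteq> \<zero>"
      by (auto simp: mpoly_mult split: if_splits)
    obtain a where a: "a \<le> m" "p a \<otimes> q (\<lambda>i. m i - a i) \<noteq> \<zero>"
    proof (rule ccontr)
      assume "\<not> thesis"
      then have "(\<Oplus>a\<in>{a. a \<le> m}. p a \<otimes> q (\<lambda>i. m i - a i)) = (\<Oplus>a\<in>{a. a \<le> m}. \<zero>)"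
        using that by (intro finsum_cong') auto
      then show False using m by simp
    qed
    then have "p a \<noteq> \<zero>" "q (\<lambda>i. m i - a i) \<noteq> \<zero>" using c by auto
    moreover have "m = (\<lambda>i. a i + (m i - a i))" using a(1) by (auto simp: le_fun_def)
    ultimately show "m \<in> (\<lambda>(a, b) i. a i + b i) ` (?A \<times> ?B)"
      by (intro image_eqI[of _ _ "(a, \<lambda>i. m i - a i)"]) auto
  qed
  then have "finite {m. (p \<otimes>\<^bsub>P\<^esub> q) m \<noteq> \<zero>}" by (rule finite_subset) (use fin in auto)
  then show ?thesis
    unfolding mpoly_carrier_iff using c by (auto simp: mpoly_mult intro!: finsum_closed)
qed

lemma mpoly_l_distr:
  assumes "p \<in> carrier P" "q \<in> carrier P" "s \<in> carrier P"
  shows "(p \<oplus>\<^bsub>P\<^esub> q) \<otimes>\<^bsub>P\<^esub> s = p \<otimes>\<^bsub>P\<^esub> s \<oplus>\<^bsub>P\<^esub> q \<otimes>\<^bsub>P\<^esub> s"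
proof
  fix m
  note c = assms[THEN mpoly_coeff_closed]
  have "(\<Oplus>a\<in>{a. a \<le> m}. (p a \<oplus> q a) \<otimes> s (\<lambda>i. m i - a i))
      = (\<Oplus>a\<in>{a. a \<le> m}. p a \<otimes> s (\<lambda>i. m i - a i) \<oplus> q a \<otimes> s (\<lambda>i. m i - a i))"
    by (rule finsum_cong') (use c in \<open>auto simp: l_distr\<close>)
  also have "\<dots> = (\<Oplus>a\<in>{a. a \<le> m}. p a \<otimes> s (\<lambda>i. m i - a i)) \<oplus> (\<Oplus>a\<in>{a. a \<le> m}. q a \<otimes> s (\<lambda>i. m i - a i))"
    by (rule finsum_addf) (use c in auto)
  finally show "((p \<oplus>\<^bsub>P\<^esub> q) \<otimes>\<^bsub>P\<^esub> s) m = (p \<otimes>\<^bsub>P\<^esub> s \<oplus>\<^bsub>P\<^esub> q \<otimes>\<^bsub>P\<^esub> s) m"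
    by (simp add: mpoly_mult mpoly_ring_simps(1))
qed

lemma mpoly_mult_comm:
  assumes "p \<in> carrier P" "q \<in> carrier P"
  shows "p \<otimes>\<^bsub>P\<^esub> q = q \<otimes>\<^bsub>P\<^esub> p"
proof
  fix m :: "nat \<Rightarrow> nat"
  note coeff_closed = assms[THEN mpoly_coeff_closed]
  define compl where "compl a = (\<lambda>i. m i - a i)" for a
  have involution: "compl (compl a) = a" if "a \<le> m" for a
    using that unfolding compl_def by (auto simp: fun_eq_iff le_fun_def)
  have compl_le: "compl a \<le> m" for a unfolding compl_def by (simp add: le_fun_def)
  have bij: "bij_betw compl {a. a \<le> m} {a. a \<le> m}"
    by (rule bij_betw_byWitness[of _ compl]) (use involution compl_le in auto)
  have "(\<Oplus>a\<in>{a. a \<le> m}. p a \<otimes> q (compl a)) = (\<Oplus>a\<in>{a. a \<le> m}. p (compl a) \<otimes> q (compl (compl a)))"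
    using finsum_reindex[of "\<lambda>a. p a \<otimes> q (compl a)" compl "{a. a \<le> m}"] bij coeff_closed
    by (auto simp: bij_betw_def)
  also have "\<dots> = (\<Oplus>a\<in>{a. a \<le> m}. q a \<otimes> p (compl a))"
    by (rule finsum_cong') (use involution coeff_closed m_comm in auto)
  finally show "(p \<otimes>\<^bsub>P\<^esub> q) m = (q \<otimes>\<^bsub>P\<^esub> p) m" by (simp add: mpoly_mult compl_def)
qed

lemma mpoly_r_distr:
  assumes "p \<in> carrier P" "q \<in> carrier P" "s \<in> carrier P"
  shows "s \<otimes>\<^bsub>P\<^esub> (p \<oplus>\<^bsub>P\<^esub> q) = s \<otimes>\<^bsub>P\<^esub> p \<oplus>\<^bsub>P\<^esub> s \<otimes>\<^bsub>P\<^esub> q"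
  using mpoly_l_distr[OF assms] assms by (simp add: mpoly_mult_comm[of s] mpoly_add_closed)

lemma mpoly_zero_mult:
  assumes "p \<in> carrier P"
  shows "\<zero>\<^bsub>P\<^esub> \<otimes>\<^bsub>P\<^esub> p = \<zero>\<^bsub>P\<^esub>" "p \<otimes>\<^bsub>P\<^esub> \<zero>\<^bsub>P\<^esub> = \<zero>\<^bsub>P\<^esub>"
  using mpoly_coeff_closed[OF assms] by (auto simp: fun_eq_iff mpoly_mult mpoly_ring_simps(2))

lemma mp_term_mult:
  assumes c: "c \<in> carrier R" "d \<in> carrier R" and a_monomial: "a \<in> monomials r"
    and b_monomial: "b \<in> monomials r"
  shows "mp_term c a \<otimes>\<^bsub>P\<^esub> mp_term d b = mp_term (c \<otimes> d) (\<lambda>i. a i + b i)"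
proof
  fix m
  show "(mp_term c a \<otimes>\<^bsub>P\<^esub> mp_term d b) m = mp_term (c \<otimes> d) (\<lambda>i. a i + b i) m"
  proof (cases "m \<in> monomials r")
    case False
    then have "m \<noteq> (\<lambda>i. a i + b i)" using monomials_add[OF a_monomial b_monomial] by auto
    then show ?thesis using False by (simp add: mpoly_mult mp_term_def)
  next
    case True
    have eq: "(mp_term c a \<otimes>\<^bsub>P\<^esub> mp_term d b) m
        = (\<Oplus>x\<in>{x. x \<le> m}. if a = x then c \<otimes> mp_term d b (\<lambda>i. m i - x i) else \<zero>)"
      using True c unfolding mpoly_mult by (auto intro!: finsum_cong' simp: mp_term_def)
    show ?thesis
    proof (cases "a \<le> m")
      case le: True
      then have "(\<lambda>i. m i - a i) = b \<longleftrightarrow> m = (\<lambda>i. a i + b i)"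
        by (auto simp: fun_eq_iff le_fun_def) (metis le_add_diff_inverse)
      moreover have "(mp_term c a \<otimes>\<^bsub>P\<^esub> mp_term d b) m = c \<otimes> mp_term d b (\<lambda>i. m i - a i)"
        unfolding eq
        by (rule finsum_singleton[OF _ finite_le_monomial[OF True]])
          (use le c in \<open>auto simp: mp_term_def\<close>)
      ultimately show ?thesis using c by (auto simp: mp_term_def)
    next
      case nle: False
      then have "m \<noteq> (\<lambda>i. a i + b i)" by (auto simp: le_fun_def)
      moreover have "(mp_term c a \<otimes>\<^bsub>P\<^esub> mp_term d b) m = (\<Oplus>x\<in>{x. x \<le> m}. \<zero>)"
        unfolding eq by (rule finsum_cong') (use nle in auto)
      ultimately show ?thesis by (simp add: mp_term_def)
    qed
  qed
qed

lemma mpoly_induct [consumes 1, case_names zero add]: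
  assumes p_closed: "p \<in> carrier P" and zero: "Q \<zero>\<^bsub>P\<^esub>"
    and add: "\<And>c a p. c \<in> carrier R \<Longrightarrow> a \<in> monomials r \<Longrightarrow> p \<in> carrier P \<Longrightarrow> Q p
      \<Longrightarrow> Q (mp_term c a \<oplus>\<^bsub>P\<^esub> p)"
  shows "Q p"
proof -
  have "Q p" if "finite A" "p \<in> carrier P" "{m. p m \<noteq> \<zero>} \<subseteq> A" for A p
    using that
  proof (induction A arbitrary: p)
    case empty
    then have "p = \<zero>\<^bsub>P\<^esub>" by (auto simp: mpoly_ring_simps(2))
    then show ?case using zero by simp
  next
    case (insert a A)
    show ?case
    proof (cases "p a = \<zero>")
      case True
      then show ?thesis using insert by auto
    next
      case False
      define q where "q = p(a := \<zero>)"
      have a_monomial: "a \<in> monomials r"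
        using False insert.prems(1) by (auto simp: mpoly_carrier_iff)
      have "finite {m. q m \<noteq> \<zero>}"
        by (rule finite_subset[of _ "{m. p m \<noteq> \<zero>}"])
          (use insert.prems(1) in \<open>auto simp: q_def mpoly_carrier_iff\<close>)
      then have q_closed: "q \<in> carrier P"
        using insert.prems(1) by (auto simp: mpoly_carrier_iff q_def)
      have "Q q" by (rule insert.IH[OF q_closed]) (use insert.prems(2) in \<open>auto simp: q_def\<close>)
      moreover have "p = mp_term (p a) a \<oplus>\<^bsub>P\<^esub> q"
        using mpoly_coeff_closed[OF insert.prems(1)]
        by (auto simp: mpoly_ring_simps(1) mp_term_def q_def)
      ultimately show ?thesis
        using add[OF mpoly_coeff_closed[OF insert.prems(1)] a_monomial q_closed] by metis
    qed
  qed
  then show ?thesis using p_closed by (auto simp: mpoly_carrier_iff)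
qed

lemma additive_eq_if_eq_on_terms:
  assumes "p \<in> carrier P" and zero: "F \<zero>\<^bsub>P\<^esub> = G \<zero>\<^bsub>P\<^esub>"
    and "term": "\<And>c a. c \<in> carrier R \<Longrightarrow> a \<in> monomials r \<Longrightarrow> F (mp_term c a) = G (mp_term c a)"
    and add: "\<And>p q. p \<in> carrier P \<Longrightarrow> q \<in> carrier P \<Longrightarrow> F (p \<oplus>\<^bsub>P\<^esub> q) = F p \<oplus>\<^bsub>A\<^esub> F q"
      "\<And>p q. p \<in> carrier P \<Longrightarrow> q \<in> carrier P \<Longrightarrow> G (p \<oplus>\<^bsub>P\<^esub> q) = G p \<oplus>\<^bsub>A\<^esub> G q"
  shows "F p = G p"
  using assms(1) by (induction p rule: mpoly_induct) (simp_all add: zero "term" add mp_term_closed)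

lemma mpoly_mult_assoc:
  assumes "p \<in> carrier P" "q \<in> carrier P" "s \<in> carrier P"
  shows "p \<otimes>\<^bsub>P\<^esub> q \<otimes>\<^bsub>P\<^esub> s = p \<otimes>\<^bsub>P\<^esub> (q \<otimes>\<^bsub>P\<^esub> s)"
proof (rule additive_eq_if_eq_on_terms[OF assms(1), of "\<lambda>p. p \<otimes>\<^bsub>P\<^esub> q \<otimes>\<^bsub>P\<^esub> s"
  "\<lambda>p. p \<otimes>\<^bsub>P\<^esub> (q \<otimes>\<^bsub>P\<^esub> s)" P])
  note distr = mpoly_l_distr mpoly_r_distr mpoly_zero_mult mpoly_mult_closed mpoly_zero_closed
  fix c a assume ca: "c \<in> carrier R" "a \<in> monomials r"
  note t = mp_term_closed[OF ca]
  show "mp_term c a \<otimes>\<^bsub>P\<^esub> q \<otimes>\<^bsub>P\<^esub> s = mp_term c a \<otimes>\<^bsub>P\<^esub> (q \<otimes>\<^bsub>P\<^esub> s)"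
  proof (rule additive_eq_if_eq_on_terms[OF assms(2), of "\<lambda>q. mp_term c a \<otimes>\<^bsub>P\<^esub> q \<otimes>\<^bsub>P\<^esub> s" _ P])
    fix d b assume db: "d \<in> carrier R" "b \<in> monomials r"
    note t' = mp_term_closed[OF db]
    show "mp_term c a \<otimes>\<^bsub>P\<^esub> mp_term d b \<otimes>\<^bsub>P\<^esub> s = mp_term c a \<otimes>\<^bsub>P\<^esub> (mp_term d b \<otimes>\<^bsub>P\<^esub> s)"
      by (rule additive_eq_if_eq_on_terms[OF assms(3), of
        "\<lambda>s. mp_term c a \<otimes>\<^bsub>P\<^esub> mp_term d b \<otimes>\<^bsub>P\<^esub> s" _ P])
        (use ca db t t' in \<open>simp_all add: distr mp_term_closed mp_term_mult
          monomials_add m_assoc add.assoc\<close>)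
  qed (simp_all add: t assms distr)
qed (simp_all add: assms mpoly_l_distr mpoly_zero_mult mpoly_mult_closed)

lemma mpoly_l_one:
  assumes "p \<in> carrier P"
  shows "\<one>\<^bsub>P\<^esub> \<otimes>\<^bsub>P\<^esub> p = p"
proof (rule additive_eq_if_eq_on_terms[OF assms, of "\<lambda>p. \<one>\<^bsub>P\<^esub> \<otimes>\<^bsub>P\<^esub> p" "\<lambda>p. p" P])
qed (simp_all add: mpoly_ring_simps(3) mp_term_closed zero_monomial mpoly_zero_mult mpoly_r_distr
    mp_term_mult)

lemma mpoly_cring: "cring P"
proof (rule cringI[OF mpoly_abelian_group])
  have "\<one>\<^bsub>P\<^esub> \<in> carrier P" by (simp add: mpoly_ring_simps(3) mp_term_closed zero_monomial)
  then show "comm_monoid P"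
    by (intro comm_monoidI)
      (auto intro: mpoly_mult_closed mpoly_mult_assoc mpoly_l_one mpoly_mult_comm)
qed (rule mpoly_l_distr)

sublocale P: cring P by (rule mpoly_cring)

sublocale const: ring_hom_cring R P "mp_const R"
proof (intro ring_hom_cring.intro ring_hom_cring_axioms.intro is_cring mpoly_cring ring_hom_memI)
  fix x y assume xy: "x \<in> carrier R" "y \<in> carrier R"
  show "mp_const R x \<in> carrier P"
    unfolding mp_const_eq_term by (rule mp_term_closed[OF xy(1) zero_monomial])
  show "mp_const R (x \<otimes> y) = mp_const R x \<otimes>\<^bsub>P\<^esub> mp_const R y"
    unfolding mp_const_eq_term using xy by (simp add: mp_term_mult zero_monomial)
  show "mp_const R (x \<oplus> y) = mp_const R x \<oplus>\<^bsub>P\<^esub> mp_const R y"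
    unfolding mp_const_eq_term mpoly_ring_simps(1) mp_term_def by auto
next
  show "mp_const R \<one> = \<one>\<^bsub>P\<^esub>" unfolding mp_const_eq_term mpoly_ring_simps(3) ..
qed

lemma mp_var_closed: "i < r \<Longrightarrow> mp_var R i \<in> carrier P"
  unfolding mp_var_eq_term by (rule mp_term_closed[OF one_closed var_monomial])

lemma mp_var_pow:
  assumes "i < r"
  shows "mp_var R i [^]\<^bsub>P\<^esub> (k::nat) = mp_term \<one> (\<lambda>j. if j = i then k else 0)"
proof (induction k)
  case 0
  have "(\<lambda>j. if j = i then 0 else 0) = (\<lambda>j. 0::nat)" by auto
  then show ?case using mpoly_ring_simps(3) by simp
next
  case (Suc k)
  have "(\<lambda>j. (if j = i then k else 0) + (if j = i then 1 else 0)) = (\<lambda>j. if j = i then Suc k else 0)"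
    by auto
  then show ?case
    using Suc mp_term_mult[OF one_closed one_closed var_monomial[OF assms]
      var_monomial[OF assms], of k 1]
    by (simp add: mp_var_eq_term)
qed

lemma mp_term_eq_const_mult:
  assumes "c \<in> carrier R" "a \<in> monomials r"
  shows "mp_term c a = mp_const R c \<otimes>\<^bsub>P\<^esub> mp_term \<one> a"
  unfolding mp_const_eq_term using assms by (simp add: mp_term_mult zero_monomial)

end

locale mpoly_eval = mpoly_cring R r + ring_hom_cring R S h for R (structure) and S (structure) and h
  and r +
  fixes t :: "nat \<Rightarrow> 'c"
  assumes t_closed: "\<And>i. i < r \<Longrightarrow> t i \<in> carrier S"
begin

definition monomial_value :: "(nat \<Rightarrow> nat) \<Rightarrow> 'c" where
  "monomial_value m = (\<Otimes>\<^bsub>S\<^esub>i\<in>{..<r}. t i [^]\<^bsub>S\<^esub> m i)"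

definition mp_eval :: "((nat \<Rightarrow> nat) \<Rightarrow> 'a) \<Rightarrow> 'c" where
  "mp_eval p = (\<Oplus>\<^bsub>S\<^esub>m\<in>{m. p m \<noteq> \<zero>}. h (p m) \<otimes>\<^bsub>S\<^esub> monomial_value m)"

lemma monomial_value_closed: "monomial_value m \<in> carrier S"
  unfolding monomial_value_def using t_closed by (auto intro!: S.finprod_closed)

lemma monomial_value_add:
  "monomial_value (\<lambda>i. a i + b i) = monomial_value a \<otimes>\<^bsub>S\<^esub> monomial_value b"
proof -
  have "monomial_value (\<lambda>i. a i + b i) = (\<Otimes>\<^bsub>S\<^esub>i\<in>{..<r}. t i [^]\<^bsub>S\<^esub> a i \<otimes>\<^bsub>S\<^esub> t i [^]\<^bsub>S\<^esub> b i)"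
    unfolding monomial_value_def
    by (rule S.finprod_cong') (use t_closed in \<open>auto simp: S.nat_pow_mult\<close>)
  also have "\<dots> = monomial_value a \<otimes>\<^bsub>S\<^esub> monomial_value b"
    unfolding monomial_value_def by (rule S.finprod_multf) (use t_closed in auto)
  finally show ?thesis .
qed

lemma monomial_value_zero: "monomial_value (\<lambda>i. 0) = \<one>\<^bsub>S\<^esub>"
  unfolding monomial_value_def by simp

lemma monomial_value_var:
  assumes "i < r"
  shows "monomial_value (\<lambda>j. if j = i then 1 else 0) = t i"
proof -
  have "monomial_value (\<lambda>j. if j = i then 1 else 0) = (\<Otimes>\<^bsub>S\<^esub>j\<in>{..<r}. if i = j then t j else \<one>\<^bsub>S\<^esub>)"
    unfolding monomial_value_def by (rule S.finprod_cong') (use t_closed in auto)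
  also have "\<dots> = t i" by (rule S.finprod_singleton) (use assms t_closed in auto)
  finally show ?thesis .
qed

lemma mp_eval_superset:
  assumes "p \<in> carrier P" "finite A" "{m. p m \<noteq> \<zero>} \<subseteq> A"
  shows "mp_eval p = (\<Oplus>\<^bsub>S\<^esub>m\<in>A. h (p m) \<otimes>\<^bsub>S\<^esub> monomial_value m)"
  unfolding mp_eval_def
  by (rule S.add.finprod_mono_neutral_cong_left)
    (use assms mpoly_coeff_closed[OF assms(1)] monomial_value_closed in auto)

lemma mp_eval_closed: "p \<in> carrier P \<Longrightarrow> mp_eval p \<in> carrier S"
  unfolding mp_eval_def using mpoly_coeff_closed monomial_value_closed
  by (auto intro!: S.finsum_closed)

lemma mp_eval_zero: "mp_eval \<zero>\<^bsub>P\<^esub> = \<zero>\<^bsub>S\<^esub>"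
  by (simp add: mp_eval_def mpoly_ring_simps)

lemma mp_eval_add:
  assumes "p \<in> carrier P" "q \<in> carrier P"
  shows "mp_eval (p \<oplus>\<^bsub>P\<^esub> q) = mp_eval p \<oplus>\<^bsub>S\<^esub> mp_eval q"
proof -
  let ?A = "{m. p m \<noteq> \<zero>} \<union> {m. q m \<noteq> \<zero>}"
  have A: "finite ?A" using assms by (auto simp: mpoly_carrier_iff)
  note c = assms[THEN mpoly_coeff_closed] monomial_value_closed
  have "mp_eval (p \<oplus>\<^bsub>P\<^esub> q) = (\<Oplus>\<^bsub>S\<^esub>m\<in>?A. h ((p \<oplus>\<^bsub>P\<^esub> q) m) \<otimes>\<^bsub>S\<^esub> monomial_value m)"
    by (rule mp_eval_superset[OF mpoly_add_closed[OF assms] A]) (auto simp: mpoly_ring_simps)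
  also have "\<dots> = (\<Oplus>\<^bsub>S\<^esub>m\<in>?A. h (p m) \<otimes>\<^bsub>S\<^esub> monomial_value m \<oplus>\<^bsub>S\<^esub> h (q m) \<otimes>\<^bsub>S\<^esub> monomial_value m)"
    by (rule S.finsum_cong') (use c in \<open>auto simp: mpoly_ring_simps S.l_distr\<close>)
  also have "\<dots> = (\<Oplus>\<^bsub>S\<^esub>m\<in>?A. h (p m) \<otimes>\<^bsub>S\<^esub> monomial_value m) \<oplus>\<^bsub>S\<^esub>
    (\<Oplus>\<^bsub>S\<^esub>m\<in>?A. h (q m) \<otimes>\<^bsub>S\<^esub> monomial_value m)"
    by (rule S.finsum_addf) (use c in auto)
  also have "\<dots> = mp_eval p \<oplus>\<^bsub>S\<^esub> mp_eval q"
    using mp_eval_superset[OF assms(1) A] mp_eval_superset[OF assms(2) A] by simp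
  finally show ?thesis .
qed

lemma mp_eval_term:
  assumes "c \<in> carrier R" "a \<in> monomials r"
  shows "mp_eval (mp_term c a) = h c \<otimes>\<^bsub>S\<^esub> monomial_value a"
proof -
  have "mp_eval (mp_term c a) = (\<Oplus>\<^bsub>S\<^esub>m\<in>{a}. h (mp_term c a m) \<otimes>\<^bsub>S\<^esub> monomial_value m)"
    by (rule mp_eval_superset[OF mp_term_closed[OF assms]]) (auto simp: mp_term_def)
  then show ?thesis using assms monomial_value_closed by (simp add: mp_term_def)
qed

lemma mp_eval_mult:
  assumes "p \<in> carrier P" "q \<in> carrier P"
  shows "mp_eval (p \<otimes>\<^bsub>P\<^esub> q) = mp_eval p \<otimes>\<^bsub>S\<^esub> mp_eval q"
proof (rule additive_eq_if_eq_on_terms[OF assms(1), of "\<lambda>p. mp_eval (p \<otimes>\<^bsub>P\<^esub> q)" _ S])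
  note simps = mp_eval_add mp_eval_zero mp_eval_closed P.l_distr P.r_distr S.l_distr S.r_distr
  fix c a assume ca: "c \<in> carrier R" "a \<in> monomials r"
  note t = mp_term_closed[OF ca]
  show "mp_eval (mp_term c a \<otimes>\<^bsub>P\<^esub> q) = mp_eval (mp_term c a) \<otimes>\<^bsub>S\<^esub> mp_eval q"
  proof (rule additive_eq_if_eq_on_terms[OF assms(2), of "\<lambda>q. mp_eval (mp_term c a \<otimes>\<^bsub>P\<^esub> q)" _ S])
    fix d b assume db: "d \<in> carrier R" "b \<in> monomials r"
    have "h (c \<otimes> d) \<otimes>\<^bsub>S\<^esub> (monomial_value a \<otimes>\<^bsub>S\<^esub> monomial_value b)
        = (h c \<otimes>\<^bsub>S\<^esub> monomial_value a) \<otimes>\<^bsub>S\<^esub> (h d \<otimes>\<^bsub>S\<^esub> monomial_value b)"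
      using ca db monomial_value_closed by (simp add: S.m_ac)
    then show "mp_eval (mp_term c a \<otimes>\<^bsub>P\<^esub> mp_term d b) = mp_eval (mp_term c a) \<otimes>\<^bsub>S\<^esub> mp_eval (mp_term d b)"
      using ca db by (simp add: mp_term_mult mp_eval_term monomials_add monomial_value_add)
  qed (use t in \<open>simp_all add: simps\<close>)
qed (use assms in \<open>simp_all add: mp_eval_add mp_eval_zero mp_eval_closed P.l_distr S.l_distr\<close>)

sublocale mp_eval: ring_hom_cring P S mp_eval
  by (intro ring_hom_cring.intro ring_hom_cring_axioms.intro S.is_cring mpoly_cring ring_hom_memI)
    (simp_all add: mp_eval_closed mp_eval_mult mp_eval_add mpoly_ring_simps(3) mp_eval_term
      zero_monomial monomial_value_zero)

lemma mp_eval_const: "c \<in> carrier R \<Longrightarrow> mp_eval (mp_const R c) = h c"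
  unfolding mp_const_eq_term by (simp add: mp_eval_term zero_monomial monomial_value_zero)

lemma mp_eval_var: "i < r \<Longrightarrow> mp_eval (mp_var R i) = t i"
  unfolding mp_var_eq_term using monomial_value_var t_closed
  by (simp add: mp_eval_term var_monomial)

lemma mp_eval_surj:
  assumes span: "carrier S \<subseteq> scalars.span G"
    and gens: "\<And>g. g \<in> G \<Longrightarrow> \<exists>i<r. \<exists>c\<in>carrier R. g = t i \<oplus>\<^bsub>S\<^esub> h c"
  shows "carrier S \<subseteq> mp_eval ` carrier P"
proof -
  have "submodule (mp_eval ` carrier P) R (restrict_scalars S h)"
  proof (rule submodule_restrict_scalarsI)
    show "\<zero>\<^bsub>S\<^esub> \<in> mp_eval ` carrier P" by (rule image_eqI[of _ _ "\<zero>\<^bsub>P\<^esub>"]) auto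
    show "x \<oplus>\<^bsub>S\<^esub> y \<in> mp_eval ` carrier P"
      if xy: "x \<in> mp_eval ` carrier P" "y \<in> mp_eval ` carrier P" for x y
    proof -
      obtain p q where "p \<in> carrier P" "q \<in> carrier P" "x = mp_eval p" "y = mp_eval q"
        using xy by blast
      then show ?thesis by (intro image_eqI[of _ _ "p \<oplus>\<^bsub>P\<^esub> q"]) auto
    qed
    show "h c \<otimes>\<^bsub>S\<^esub> x \<in> mp_eval ` carrier P" if c_closed: "c \<in> carrier R"
      and x: "x \<in> mp_eval ` carrier P" for c x
    proof -
      obtain p where "p \<in> carrier P" "x = mp_eval p" using x by blast
      then show ?thesis
        using c_closed mp_eval_const by (intro image_eqI[of _ _ "mp_const R c \<otimes>\<^bsub>P\<^esub> p"]) auto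
    qed
  qed auto
  moreover have "G \<subseteq> mp_eval ` carrier P"
  proof
    fix g assume "g \<in> G"
    then obtain i c where "i < r" "c \<in> carrier R" "g = t i \<oplus>\<^bsub>S\<^esub> h c" using gens by blast
    then show "g \<in> mp_eval ` carrier P"
      using mp_eval_var mp_eval_const mp_var_closed
      by (intro image_eqI[of _ _ "mp_var R i \<oplus>\<^bsub>P\<^esub> mp_const R c"]) auto
  qed
  ultimately show ?thesis using span scalars.span_minimal by blast
qed

end

section \<open>Quotients by monic polynomials\<close>

lemma ring_hom_factor_through_surj:
  assumes f_hom: "ring_hom_cring A B f" and surj: "carrier B \<subseteq> f ` carrier A"
    and g_hom: "ring_hom_cring A C g"
    and kernel: "\<And>a. a \<in> carrier A \<Longrightarrow> f a = \<zero>\<^bsub>B\<^esub> \<Longrightarrow> g a = \<zero>\<^bsub>C\<^esub>"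
  shows "\<exists>\<phi>. ring_hom_cring B C \<phi> \<and> (\<forall>a\<in>carrier A. \<phi> (f a) = g a)"
proof -
  interpret f: ring_hom_cring A B f by (rule f_hom)
  interpret g: ring_hom_cring A C g by (rule g_hom)
  define lift where "lift b = (SOME a. a \<in> carrier A \<and> f a = b)" for b
  have lift: "lift b \<in> carrier A" "f (lift b) = b" if "b \<in> carrier B" for b
  proof -
    have "\<exists>a. a \<in> carrier A \<and> f a = b" using surj that by blast
    then have "lift b \<in> carrier A \<and> f (lift b) = b" unfolding lift_def by (rule someI_ex)
    then show "lift b \<in> carrier A" "f (lift b) = b" by simp_all
  qed
  have factor: "g (lift (f a)) = g a" if a_closed: "a \<in> carrier A" for a
  proof -
    note l = lift[OF f.hom_closed[OF a_closed]]
    have "f (lift (f a) \<ominus>\<^bsub>A\<^esub> a) = \<zero>\<^bsub>B\<^esub>" using a_closed l by (simp add: f.R.minus_eq f.S.r_neg)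
    then have "g (lift (f a) \<ominus>\<^bsub>A\<^esub> a) = \<zero>\<^bsub>C\<^esub>" using kernel a_closed l(1) by simp
    then have "g (lift (f a)) \<ominus>\<^bsub>C\<^esub> g a = \<zero>\<^bsub>C\<^esub>"
      using a_closed l(1) by (simp add: f.R.minus_eq g.S.minus_eq)
    then show ?thesis using a_closed l(1) by (simp add: g.S.r_right_minus_eq)
  qed
  have "(\<lambda>b. g (lift b)) \<in> ring_hom B C"
  proof (rule ring_hom_memI)
    fix x y assume xy: "x \<in> carrier B" "y \<in> carrier B"
    show "g (lift x) \<in> carrier C" using lift(1)[OF xy(1)] by simp
    show "g (lift (x \<otimes>\<^bsub>B\<^esub> y)) = g (lift x) \<otimes>\<^bsub>C\<^esub> g (lift y)"
      using factor[of "lift x \<otimes>\<^bsub>A\<^esub> lift y"] xy lift by simp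
    show "g (lift (x \<oplus>\<^bsub>B\<^esub> y)) = g (lift x) \<oplus>\<^bsub>C\<^esub> g (lift y)"
      using factor[of "lift x \<oplus>\<^bsub>A\<^esub> lift y"] xy lift by simp
  next
    show "g (lift \<one>\<^bsub>B\<^esub>) = \<one>\<^bsub>C\<^esub>" using factor[OF f.R.one_closed] by simp
  qed
  then have "ring_hom_cring B C (\<lambda>b. g (lift b))"
    by (intro ring_hom_cring.intro ring_hom_cring_axioms.intro f.S.is_cring g.S.is_cring)
  then show ?thesis using factor by blast
qed

locale monic_quotient = mpoly_cring R r for R (structure) and r +
  fixes n :: "nat \<Rightarrow> nat" and a :: "nat \<Rightarrow> nat \<Rightarrow> 'a"
  assumes coeff_closed: "\<And>i j. i < r \<Longrightarrow> j \<in> {1..n i} \<Longrightarrow> a i j \<in> carrier R"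
begin

abbreviation T :: "((nat \<Rightarrow> nat) \<Rightarrow> 'a) set ring" where
  "T \<equiv> T_ring R r n a"

abbreviation relation_poly :: "nat \<Rightarrow> ((nat \<Rightarrow> nat) \<Rightarrow> 'a)" where
  "relation_poly i \<equiv> monic_in_var R r i (n i) (a i)"

definition relation_ideal :: "((nat \<Rightarrow> nat) \<Rightarrow> 'a) set" where
  "relation_ideal = Idl\<^bsub>P\<^esub> {relation_poly i | i. i < r}"

definition proj :: "((nat \<Rightarrow> nat) \<Rightarrow> 'a) \<Rightarrow> ((nat \<Rightarrow> nat) \<Rightarrow> 'a) set" where
  "proj p = relation_ideal +>\<^bsub>P\<^esub> p"

definition const_T :: "'a \<Rightarrow> ((nat \<Rightarrow> nat) \<Rightarrow> 'a) set" where
  "const_T c = proj (mp_const R c)"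

lemma relation_poly_eq_monic_value:
  "relation_poly i = monic_value P (mp_const R) (n i) (a i) (mp_var R i)"
  unfolding monic_in_var_def monic_value_def Let_def ..

lemma relation_poly_closed: "i < r \<Longrightarrow> relation_poly i \<in> carrier P"
  unfolding relation_poly_eq_monic_value
  by (intro const.monic_value_closed coeff_closed mp_var_closed)

lemma T_eq: "T = P Quot relation_ideal"
  unfolding T_ring_def relation_ideal_def ..

lemma relation_ideal_ideal: "ideal relation_ideal P"
  unfolding relation_ideal_def by (rule P.genideal_ideal) (use relation_poly_closed in auto)

lemma relation_ideal_minimal:
  "ideal K P \<Longrightarrow> (\<And>i. i < r \<Longrightarrow> relation_poly i \<in> K) \<Longrightarrow> relation_ideal \<subseteq> K"
  unfolding relation_ideal_def by (rule P.genideal_minimal) auto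

lemma relation_poly_mem: "i < r \<Longrightarrow> relation_poly i \<in> relation_ideal"
  unfolding relation_ideal_def
  using P.genideal_self[of "{relation_poly i | i. i < r}"] relation_poly_closed by blast

sublocale proj: ring_hom_cring P T proj
  unfolding T_eq proj_def using ideal.rcos_ring_hom_cring[OF relation_ideal_ideal mpoly_cring]
  by simp

lemma T_cring: "cring T"
  by (rule proj.S.is_cring)

lemma proj_surj: "carrier T \<subseteq> proj ` carrier P"
  unfolding T_eq FactRing_def A_RCOSETS_def' proj_def by auto

lemma proj_eq_zero_iff:
  assumes "p \<in> carrier P"
  shows "proj p = \<zero>\<^bsub>T\<^esub> \<longleftrightarrow> p \<in> relation_ideal"
proof -
  have "proj p = proj \<zero>\<^bsub>P\<^esub> \<longleftrightarrow> p \<ominus>\<^bsub>P\<^esub> \<zero>\<^bsub>P\<^esub> \<in> relation_ideal"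
    unfolding proj_def
    using P.quotient_eq_iff_same_a_r_cos[OF relation_ideal_ideal assms P.zero_closed] by simp
  then show ?thesis using assms by (simp add: a_minus_def)
qed

sublocale const_T: ring_hom_cring R T const_T
  by (intro ring_hom_cring.intro ring_hom_cring_axioms.intro is_cring T_cring ring_hom_memI)
    (simp_all add: const_T_def)

lemma T_quot_map_eq: "T_quot_map R r n a J x = J +>\<^bsub>T\<^esub> const_T x"
  unfolding T_quot_map_def const_T_def proj_def relation_ideal_def ..

lemma monic_value_proj_var:
  assumes "i < r"
  shows "monic_value T const_T (n i) (a i) (proj (mp_var R i)) = \<zero>\<^bsub>T\<^esub>"
proof -
  have "monic_value T const_T (n i) (a i) (proj (mp_var R i)) = proj (relation_poly i)"
    unfolding relation_poly_eq_monic_value const_T_def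
    using const.hom_monic_value[OF proj.ring_hom_cring_axioms coeff_closed mp_var_closed] assms
    by simp
  also have "\<dots> = \<zero>\<^bsub>T\<^esub>"
    using proj_eq_zero_iff[OF relation_poly_closed] relation_poly_mem assms by simp
  finally show ?thesis .
qed

lemma proj_monomial_reduce:
  assumes i_less: "i < r" and m: "m \<in> monomials r" "n i \<le> m i"
  shows "proj (mp_term \<one> m)
    = \<ominus>\<^bsub>T\<^esub> (\<Oplus>\<^bsub>T\<^esub>j\<in>{1..n i}. const_T (a i j) \<otimes>\<^bsub>T\<^esub> proj (mp_term \<one> (m(i := m i - j))))"
proof -
  define y where "y = proj (mp_var R i)"
  define m' where "m' = m(i := m i - n i)"
  have m'_monomial: "m' \<in> monomials r" using m i_less unfolding m'_def monomials_def by auto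
  define w where "w = proj (mp_term \<one> m')"
  have y_closed: "y \<in> carrier T" unfolding y_def using mp_var_closed[OF i_less] by simp
  have w_closed: "w \<in> carrier T"
    unfolding w_def using mp_term_closed[OF one_closed m'_monomial] by simp
  have factor: "proj (mp_term \<one> (m(i := m i - j))) = w \<otimes>\<^bsub>T\<^esub> y [^]\<^bsub>T\<^esub> (n i - j)" if "j \<le> n i" for j
  proof -
    have "(\<lambda>l. m' l + (if l = i then n i - j else 0)) = m(i := m i - j)"
      using that m(2) unfolding m'_def by auto
    then have "mp_term \<one> (m(i := m i - j)) = mp_term \<one> m' \<otimes>\<^bsub>P\<^esub> mp_var R i [^]\<^bsub>P\<^esub> (n i - j)"
      unfolding mp_var_pow[OF i_less]
      using mp_term_mult[OF one_closed one_closed m'_monomial var_monomial[OF i_less]]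
      by simp
    then show ?thesis
      unfolding w_def y_def using mp_term_closed[OF one_closed m'_monomial] mp_var_closed[OF i_less]
      by simp
  qed
  let ?s = "\<Oplus>\<^bsub>T\<^esub>j\<in>{1..n i}. const_T (a i j) \<otimes>\<^bsub>T\<^esub> y [^]\<^bsub>T\<^esub> (n i - j)"
  have s: "?s \<in> carrier T"
    using coeff_closed[OF i_less] y_closed by (auto intro!: proj.S.finsum_closed)
  have "y [^]\<^bsub>T\<^esub> n i \<oplus>\<^bsub>T\<^esub> ?s = \<zero>\<^bsub>T\<^esub>"
    using monic_value_proj_var[OF i_less] unfolding monic_value_def y_def .
  then have "y [^]\<^bsub>T\<^esub> n i = \<ominus>\<^bsub>T\<^esub> ?s" using y_closed s by (simp add: proj.S.minus_equality)
  then have "proj (mp_term \<one> m) = \<ominus>\<^bsub>T\<^esub> (w \<otimes>\<^bsub>T\<^esub> ?s)"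
    using factor[of 0] w_closed s by (simp add: proj.S.r_minus)
  also have "w \<otimes>\<^bsub>T\<^esub> ?s = (\<Oplus>\<^bsub>T\<^esub>j\<in>{1..n i}. w \<otimes>\<^bsub>T\<^esub> (const_T (a i j) \<otimes>\<^bsub>T\<^esub> y [^]\<^bsub>T\<^esub> (n i - j)))"
    by (rule proj.S.finsum_rdistr) (use w_closed y_closed coeff_closed[OF i_less] in auto)
  also have "\<dots> = (\<Oplus>\<^bsub>T\<^esub>j\<in>{1..n i}. const_T (a i j) \<otimes>\<^bsub>T\<^esub> proj (mp_term \<one> (m(i := m i - j))))"
    by (rule proj.S.finsum_cong')
      (use w_closed y_closed coeff_closed[OF i_less] factor in \<open>auto simp: proj.S.m_lcomm\<close>)
  finally show ?thesis .
qed

definition reduced_monomials :: "(nat \<Rightarrow> nat) set" where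
  "reduced_monomials = {m \<in> monomials r. \<forall>i<r. m i < n i}"

lemma finite_reduced_monomials: "finite reduced_monomials"
proof (rule finite_subset)
  show "reduced_monomials \<subseteq> {m. m \<le> (\<lambda>i. if i < r then n i else 0)}"
    unfolding reduced_monomials_def monomials_def by (auto simp: le_fun_def intro: less_imp_le)
  show "finite {m. m \<le> (\<lambda>i. if i < r then n i else 0)}"
    by (rule finite_le_monomial[of _ r]) (simp add: monomials_def)
qed

abbreviation T_span :: "((nat \<Rightarrow> nat) \<Rightarrow> 'a) set set" where
  "T_span \<equiv> const_T.scalars.span ((\<lambda>m. proj (mp_term \<one> m)) ` reduced_monomials)"

lemma T_span_submodule: "submodule T_span R (restrict_scalars T const_T)"
  by (rule const_T.scalars.span_submodule) (use mp_term_closed in \<open>auto simp: reduced_monomials_def\<close>)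

lemma proj_monomial_mem_span:
  assumes "m \<in> monomials r"
  shows "proj (mp_term \<one> m) \<in> T_span"
  using assms
proof (induction "\<Sum>i<r. m i" arbitrary: m rule: less_induct)
  case less
  note span = T_span_submodule
  show ?case
  proof (cases "m \<in> reduced_monomials")
    case True
    then show ?thesis by (intro subsetD[OF const_T.scalars.subset_span] imageI)
  next
    case False
    then obtain i where i: "i < r" "n i \<le> m i"
      using less.prems unfolding reduced_monomials_def by (auto simp: not_less)
    have "proj (mp_term \<one> (m(i := m i - j))) \<in> T_span" if j: "j \<in> {1..n i}" for j
    proof (rule less.hyps)
      show "m(i := m i - j) \<in> monomials r" using less.prems i(1) by (auto simp: monomials_def)
      show "(\<Sum>l<r. (m(i := m i - j)) l) < (\<Sum>l<r. m l)"
        by (rule sum_strict_mono_ex1) (use i j in auto)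
    qed
    then have "(\<Oplus>\<^bsub>T\<^esub>j\<in>{1..n i}. const_T (a i j) \<otimes>\<^bsub>T\<^esub> proj (mp_term \<one> (m(i := m i - j)))) \<in> T_span"
      using const_T.scalars.submoduleE(4)[OF span coeff_closed[OF i(1)]]
      by (intro const_T.scalars.submodule_finsum_closed[OF span, unfolded finsum_restrict_scalars]) simp
    then show ?thesis
      unfolding proj_monomial_reduce[OF i(1) less.prems i(2)]
      using const_T.scalars.submoduleE(3)[OF span] by simp
  qed
qed

lemma T_module_finite: "module_finite_via R T const_T"
proof -
  note span = T_span_submodule
  have "proj p \<in> T_span" if "p \<in> carrier P" for p
    using that
  proof (induction p rule: mpoly_induct)
    case zero
    then show ?case using const_T.scalars.submodule_zero_closed[OF span] by simp
  next
    case (add c m p)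
    have "proj (mp_term c m \<oplus>\<^bsub>P\<^esub> p) = const_T c \<otimes>\<^bsub>T\<^esub> proj (mp_term \<one> m) \<oplus>\<^bsub>T\<^esub> proj p"
      unfolding const_T_def mp_term_eq_const_mult[OF add(1,2)]
      using add mp_term_closed[OF one_closed add(2)] by simp
    then show ?case
      using const_T.scalars.submoduleE(4)[OF span add(1) proj_monomial_mem_span[OF add(2)]]
        const_T.scalars.submoduleE(5)[OF span] add.IH by simp
  qed
  then have "carrier T \<subseteq> T_span" using proj_surj by blast
  moreover have "(\<lambda>m. proj (mp_term \<one> m)) ` reduced_monomials \<subseteq> carrier T"
    using mp_term_closed by (auto simp: reduced_monomials_def)
  ultimately show ?thesis
    using const_T.module_finite_via_iff_span finite_reduced_monomials by blast
qed

lemma exists_hom_from_T: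
  assumes eval: "mpoly_eval R S h r t"
    and relations: "\<And>i. i < r \<Longrightarrow> monic_value S h (n i) (a i) (t i) = \<zero>\<^bsub>S\<^esub>"
  shows "\<exists>\<phi>. ring_hom_cring T S \<phi> \<and> (\<forall>p\<in>carrier P. \<phi> (proj p) = mpoly_eval.mp_eval R S h r t p)"
proof -
  interpret mpoly_eval R S h r t by (rule eval)
  have "relation_ideal \<subseteq> {p \<in> carrier P. mp_eval p \<in> {\<zero>\<^bsub>S\<^esub>}}"
  proof (rule relation_ideal_minimal)
    show "ideal {p \<in> carrier P. mp_eval p \<in> {\<zero>\<^bsub>S\<^esub>}} P"
      by (rule mp_eval.ring.ideal_vimage[OF S.zeroideal])
    fix i assume i_less: "i < r"
    have "mp_eval (relation_poly i) = monic_value S (\<lambda>c. mp_eval (mp_const R c)) (n i) (a i) (t i)"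
      unfolding relation_poly_eq_monic_value
      using const.hom_monic_value[OF mp_eval.ring_hom_cring_axioms coeff_closed[OF i_less]
        mp_var_closed[OF i_less]]
        mp_eval_var[OF i_less] by simp
    also have "\<dots> = monic_value S h (n i) (a i) (t i)"
      unfolding monic_value_def using mp_eval_const coeff_closed[OF i_less] t_closed[OF i_less]
      by (auto intro!: arg_cong2[where f = "(\<oplus>\<^bsub>S\<^esub>)"] S.finsum_cong')
    finally show "relation_poly i \<in> {p \<in> carrier P. mp_eval p \<in> {\<zero>\<^bsub>S\<^esub>}}"
      using relations[OF i_less] relation_poly_closed[OF i_less] by simp
  qed
  then show ?thesis
    using proj_eq_zero_iff
    by (intro ring_hom_factor_through_surj[OF proj.ring_hom_cring_axioms
      proj_surj mp_eval.ring_hom_cring_axioms]) auto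
qed

end

locale monic_presentation =
  monic_quotient R r n a + \<phi>: ring_hom_cring "T_ring R r n a" S \<phi> + S: domain S
  for R (structure) and r n a and S (structure) and \<phi> +
  assumes inj_const: "inj_on (\<lambda>c. \<phi> (const_T c)) (carrier R)"
    and surj: "carrier S \<subseteq> \<phi> ` carrier (T_ring R r n a)"
    and noetherian: "noetherian_ring R"
begin

definition kernel :: "((nat \<Rightarrow> nat) \<Rightarrow> 'a) set set" where
  "kernel = {x \<in> carrier T. \<phi> x \<in> {\<zero>\<^bsub>S\<^esub>}}"

lemma kernel_primeideal: "primeideal kernel T"
  unfolding kernel_def by (rule \<phi>.ring.primeideal_vimage[OF T_cring S.zeroprimeideal])

lemma kernel_ideal: "ideal kernel T"
  by (rule primeideal.axioms(1)[OF kernel_primeideal])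

lemma const_T_mem_kernel:
  assumes "c \<in> carrier R" "const_T c \<in> kernel"
  shows "c = \<zero>"
  by (rule inj_onD[OF inj_const]) (use assms in \<open>auto simp: kernel_def\<close>)

lemma ideal_height_kernel: "ideal_height T kernel = 0"
proof (rule proj.S.ideal_height_eq_zero_if_minimal_prime[OF kernel_primeideal])
  fix Q assume Q: "primeideal Q T" "Q \<subseteq> kernel"
  have "kernel = Q"
  proof (rule const_T.incomparability_if_module_finite[OF noetherian T_module_finite
    Q(1) kernel_ideal Q(2)])
    show "const_T c \<in> Q" if "c \<in> carrier R" "const_T c \<in> kernel" for c
      using const_T_mem_kernel[OF that] ideal_zero_closed[OF primeideal.axioms(1)[OF Q(1)]] by simp
  qed
  then show "Q = kernel" ..
qed

lemma inj_T_quot_map: "inj_on (T_quot_map R r n a kernel) (carrier R)"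
proof (rule inj_onI)
  fix x y assume xy: "x \<in> carrier R" "y \<in> carrier R"
    "T_quot_map R r n a kernel x = T_quot_map R r n a kernel y"
  then have "const_T x \<ominus>\<^bsub>T\<^esub> const_T y \<in> kernel"
    using proj.S.quotient_eq_iff_same_a_r_cos[OF kernel_ideal] unfolding T_quot_map_eq by simp
  then have "const_T (x \<ominus> y) \<in> kernel" using xy by (simp add: a_minus_def)
  then have "x \<ominus> y = \<zero>" by (rule const_T_mem_kernel[rotated]) (use xy in simp)
  then show "x = y" using xy by simp
qed

lemma exists_hom_to_quotient:
  "\<exists>\<psi>\<in>ring_hom S (T Quot kernel). \<forall>c\<in>carrier R. \<psi> (\<phi> (const_T c)) = T_quot_map R r n a kernel c"
proof -
  interpret quot: ring_hom_cring T "T Quot kernel" "(+>\<^bsub>T\<^esub>) kernel"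
    by (rule ideal.rcos_ring_hom_cring[OF kernel_ideal T_cring])
  have "kernel +>\<^bsub>T\<^esub> x = \<zero>\<^bsub>T Quot kernel\<^esub>" if "x \<in> carrier T" "\<phi> x = \<zero>\<^bsub>S\<^esub>" for x
    using proj.S.a_rcos_zero[OF kernel_ideal, of x] that unfolding kernel_def FactRing_def by simp
  then obtain \<psi> where "ring_hom_cring S (T Quot kernel) \<psi>" "\<forall>x\<in>carrier T. \<psi> (\<phi> x) = kernel +>\<^bsub>T\<^esub> x"
    using ring_hom_factor_through_surj[OF \<phi>.ring_hom_cring_axioms surj quot.ring_hom_cring_axioms]
    by blast
  then show ?thesis
    unfolding T_quot_map_eq by (intro bexI[of _ \<psi>]) (auto intro: ring_hom_cring.homh)
qed

end

section \<open>Reduction to quotients by monic polynomials\<close>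

lemma direct_summand_via_if_ring_hom:
  assumes \<psi>: "\<psi> \<in> ring_hom S S'" and \<iota>: "\<And>x. x \<in> carrier R \<Longrightarrow> \<iota> x \<in> carrier S"
    and \<kappa>: "\<And>x. x \<in> carrier R \<Longrightarrow> \<psi> (\<iota> x) = \<kappa> x" and summand: "direct_summand_via R S' \<kappa>"
  shows "direct_summand_via R S \<iota>"
proof -
  obtain \<rho> where \<rho>: "\<forall>s\<in>carrier S'. \<rho> s \<in> carrier R"
    "\<forall>s\<in>carrier S'. \<forall>t\<in>carrier S'. \<rho> (s \<oplus>\<^bsub>S'\<^esub> t) = \<rho> s \<oplus>\<^bsub>R\<^esub> \<rho> t"
    "\<forall>x\<in>carrier R. \<forall>s\<in>carrier S'. \<rho> (\<kappa> x \<otimes>\<^bsub>S'\<^esub> s) = x \<otimes>\<^bsub>R\<^esub> \<rho> s" "\<rho> \<one>\<^bsub>S'\<^esub> = \<one>\<^bsub>R\<^esub>"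
    using summand unfolding direct_summand_via_def by (elim exE conjE)
  show ?thesis
    unfolding direct_summand_via_def
    by (rule exI[of _ "\<lambda>s. \<rho> (\<psi> s)"])
      (use \<rho> \<iota> \<kappa> ring_hom_closed[OF \<psi>] ring_hom_add[OF \<psi>]
        ring_hom_mult[OF \<psi>] ring_hom_one[OF \<psi>] in simp)
qed

lemma (in ring_hom_cring) exists_primeideal_contracting_to_zero:
  assumes R_domain: "domain R" and inj: "inj_on h (carrier R)"
  shows "\<exists>Q. primeideal Q S \<and> (\<forall>x\<in>carrier R. h x \<in> Q \<longrightarrow> x = \<zero>)"
proof -
  interpret R: domain R by (rule R_domain)
  define U where "U = h ` (carrier R - {\<zero>})"
  have zero: "x = \<zero>" if "x \<in> carrier R" "h x = \<zero>\<^bsub>S\<^esub>" for x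
    by (rule inj_onD[OF inj]) (use that in auto)
  have "submonoid U S"
  proof
    show "U \<subseteq> carrier S" unfolding U_def by auto
    show "\<one>\<^bsub>S\<^esub> \<in> U" unfolding U_def by (rule image_eqI[of _ _ \<one>]) auto
    fix x y assume "x \<in> U" "y \<in> U"
    then obtain x' y' where xy: "x' \<in> carrier R" "x' \<noteq> \<zero>" "x = h x'"
      "y' \<in> carrier R" "y' \<noteq> \<zero>" "y = h y'"
      unfolding U_def by auto
    then show "x \<otimes>\<^bsub>S\<^esub> y \<in> U"
      unfolding U_def using R.integral by (intro image_eqI[of _ _ "x' \<otimes> y'"]) auto
  qed
  moreover have "{\<zero>\<^bsub>S\<^esub>} \<inter> U = {}" unfolding U_def using zero by force
  ultimately obtain Q where "primeideal Q S" "Q \<inter> U = {}"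
    using S.exists_primeideal_disjoint[OF S.zeroideal] by blast
  then show ?thesis unfolding U_def by blast
qed

lemma (in ring_hom_cring) exists_module_finite_domain_quotient:
  assumes R_domain: "domain R" and inj: "inj_on h (carrier R)" and fin: "module_finite_via R S h"
  shows "\<exists>Q. domain (S Quot Q) \<and> ring_hom_cring S (S Quot Q) ((+>\<^bsub>S\<^esub>) Q)
    \<and> inj_on (\<lambda>x. Q +>\<^bsub>S\<^esub> h x) (carrier R) \<and> module_finite_via R (S Quot Q) (\<lambda>x. Q +>\<^bsub>S\<^esub> h x)"
proof -
  obtain Q where Q: "primeideal Q S" "\<forall>x\<in>carrier R. h x \<in> Q \<longrightarrow> x = \<zero>"
    using exists_primeideal_contracting_to_zero[OF R_domain inj] by blast
  have proj: "ring_hom_cring S (S Quot Q) ((+>\<^bsub>S\<^esub>) Q)"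
    by (rule primeideal.rcos_ring_hom_cring[OF Q(1)])
  have "inj_on (\<lambda>x. Q +>\<^bsub>S\<^esub> h x) (carrier R)"
  proof (rule inj_onI)
    fix x y assume xy: "x \<in> carrier R" "y \<in> carrier R" "Q +>\<^bsub>S\<^esub> h x = Q +>\<^bsub>S\<^esub> h y"
    then have "h x \<ominus>\<^bsub>S\<^esub> h y \<in> Q"
      using S.quotient_eq_iff_same_a_r_cos[OF primeideal.axioms(1)[OF Q(1)]] by simp
    then have "h (x \<ominus> y) \<in> Q" using xy by (simp add: a_minus_def)
    then have "x \<ominus> y = \<zero>" using Q(2) xy(1,2) R.minus_closed by blast
    then show "x = y" using xy(1,2) by simp
  qed
  moreover have "carrier (S Quot Q) \<subseteq> (+>\<^bsub>S\<^esub>) Q ` carrier S"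
    unfolding FactRing_def A_RCOSETS_def' by auto
  ultimately show ?thesis
    using primeideal.quotient_is_domain[OF Q(1)] proj module_finite_via_surj[OF proj _ fin] by blast
qed

context complete_local_extension
begin

lemma exists_shifted_monic_equation:
  assumes closed: "algebraically_closed (R Quot \<mm>)" and fin: "module_finite_via R S h"
    and s_closed: "s \<in> carrier S"
  shows "\<exists>c k b. c \<in> carrier R \<and> k \<ge> 1 \<and> (\<forall>j\<in>{1..k}. b j \<in> \<mm>) \<and>
    monic_value S h k b (s \<ominus>\<^bsub>S\<^esub> h c) = \<zero>\<^bsub>S\<^esub>"
proof -
  obtain n where "integral_over (carrier R) n s"
    using integral_over_carrier_if_module_finite[OF noetherian_ring_axioms fin s_closed] by blast
  then obtain c k where c: "c \<in> carrier R" "k \<ge> 1" "integral_over \<mm> k (s \<ominus>\<^bsub>S\<^esub> h c)"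
    using exists_shift_integral_over_max_ideal[OF closed s_closed] by blast
  then show ?thesis using integral_over_imp_monic_value[OF c(3)] s_closed by blast
qed

lemma shifted_monic_generatorsE:
  assumes closed: "algebraically_closed (R Quot \<mm>)" and fin: "module_finite_via R S h"
  obtains r :: nat and n a t G where "r \<ge> 1" "\<forall>i<r. n i \<ge> 1"
    "\<forall>i<r. \<forall>j\<in>{1..n i}. a i j \<in> \<mm>" "\<forall>i<r. t i \<in> carrier S"
    "\<forall>i<r. monic_value S h (n i) (a i) (t i) = \<zero>\<^bsub>S\<^esub>"
    "carrier S \<subseteq> scalars.span G" "\<forall>g\<in>G. \<exists>i<r. \<exists>c\<in>carrier R. g = t i \<oplus>\<^bsub>S\<^esub> h c"
proof -
  obtain G where G: "finite G" "G \<subseteq> carrier S" "carrier S \<subseteq> scalars.span G"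
    using fin module_finite_via_iff_span by blast
  obtain gl where gl: "set gl = G" using finite_list[OF G(1)] by blast
  define gs where "gs = \<one>\<^bsub>S\<^esub> # gl"
  define r where "r = length gs"
  have gs: "gs ! i \<in> carrier S" if "i < r" for i
    using that G(2) gl nth_mem[of i gs] unfolding r_def gs_def by auto
  have "\<forall>i<r. \<exists>c k b. c \<in> carrier R \<and> k \<ge> 1 \<and> (\<forall>j\<in>{1..k}. b j \<in> \<mm>)
      \<and> monic_value S h k b (gs ! i \<ominus>\<^bsub>S\<^esub> h c) = \<zero>\<^bsub>S\<^esub>"
    using exists_shifted_monic_equation[OF closed fin] gs by blast
  then obtain c n a where c: "\<And>i. i < r \<Longrightarrow> c i \<in> carrier R"
    and equation: "\<And>i. i < r \<Longrightarrow> n i \<ge> 1 \<and> (\<forall>j\<in>{1..n i}. a i j \<in> \<mm>)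
      \<and> monic_value S h (n i) (a i) (gs ! i \<ominus>\<^bsub>S\<^esub> h (c i)) = \<zero>\<^bsub>S\<^esub>"
    by metis
  define t where "t i = gs ! i \<ominus>\<^bsub>S\<^esub> h (c i)" for i
  have "t i \<in> carrier S" if "i < r" for i unfolding t_def using gs c that by simp
  moreover have "\<exists>i<r. \<exists>c\<in>carrier R. g = t i \<oplus>\<^bsub>S\<^esub> h c" if g_mem: "g \<in> G" for g
  proof -
    obtain i where i: "i < r" "g = gs ! i"
      using gl g_mem unfolding r_def gs_def by (metis in_set_conv_nth list.set_intros(2))
    then have "g = t i \<oplus>\<^bsub>S\<^esub> h (c i)"
      unfolding t_def using gs c by (simp add: S.minus_eq S.a_assoc S.l_neg)
    then show ?thesis using i(1) c by blast
  qed
  moreover have "r \<ge> 1" unfolding r_def gs_def by simp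
  ultimately show thesis
    using equation G(3) unfolding t_def[symmetric] by (intro that[of r n a t G]) simp_all
qed

theorem exists_monic_presentation:
  assumes closed: "algebraically_closed (R Quot \<mm>)" and inj: "inj_on h (carrier R)"
    and fin: "module_finite_via R S h"
  shows "\<exists>r n a J \<psi>. r \<ge> 1 \<and> (\<forall>i<r. n i \<ge> 1) \<and> (\<forall>i<r. \<forall>j\<in>{1..n i}. a i j \<in> \<mm>)
    \<and> ideal J (T_ring R r n a) \<and> ideal_height (T_ring R r n a) J = 0
    \<and> inj_on (T_quot_map R r n a J) (carrier R)
    \<and> \<psi> \<in> ring_hom S (T_ring R r n a Quot J) \<and> (\<forall>x\<in>carrier R. \<psi> (h x) = T_quot_map R r n a J x)"
proof -
  obtain r :: nat and n a t G where r: "r \<ge> 1" and n: "\<forall>i<r. n i \<ge> 1"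
    and a: "\<forall>i<r. \<forall>j\<in>{1..n i}. a i j \<in> \<mm>" and t: "\<forall>i<r. t i \<in> carrier S"
    and equation: "\<forall>i<r. monic_value S h (n i) (a i) (t i) = \<zero>\<^bsub>S\<^esub>"
    and gens: "carrier S \<subseteq> scalars.span G" "\<forall>g\<in>G. \<exists>i<r. \<exists>c\<in>carrier R. g = t i \<oplus>\<^bsub>S\<^esub> h c"
    by (rule shifted_monic_generatorsE[OF closed fin])
  interpret E: mpoly_eval R S h r t by unfold_locales (use t in blast)
  interpret Q: monic_quotient R r n a by unfold_locales (use ideal.Icarr[OF m_ideal] a in blast)
  obtain \<phi> where \<phi>: "ring_hom_cring Q.T S \<phi>" "\<forall>p\<in>carrier E.P. \<phi> (Q.proj p) = E.mp_eval p"
    using Q.exists_hom_from_T[OF E.mpoly_eval_axioms] equation by blast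
  have \<phi>_const: "\<phi> (Q.const_T x) = h x" if "x \<in> carrier R" for x
    using \<phi>(2) that E.mp_eval_const unfolding Q.const_T_def by simp
  have "carrier S \<subseteq> E.mp_eval ` carrier E.P"
    by (rule E.mp_eval_surj[OF gens(1)]) (use gens(2) in blast)
  also have "E.mp_eval ` carrier E.P \<subseteq> \<phi> ` carrier Q.T" using \<phi>(2) by force
  finally interpret M: monic_presentation R r n a S \<phi>
    using \<phi>(1) \<phi>_const inj noetherian_ring_axioms
    by (intro monic_presentation.intro monic_presentation_axioms.intro
      Q.monic_quotient_axioms S.domain_axioms)
      (simp_all cong: inj_on_cong)
  obtain \<psi> where "\<psi> \<in> ring_hom S (Q.T Quot M.kernel)"
    "\<forall>x\<in>carrier R. \<psi> (\<phi> (Q.const_T x)) = T_quot_map R r n a M.kernel x"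
    using M.exists_hom_to_quotient by blast
  then show ?thesis
    using r n a M.kernel_ideal M.ideal_height_kernel M.inj_T_quot_map \<phi>_const
    by (intro exI[of _ r] exI[of _ n] exI[of _ a] exI[of _ M.kernel] exI[of _ \<psi>]) simp
qed

end

theorem theorem5:
  fixes R :: "('a, 'm) ring_scheme" and S :: "('b, 'n) ring_scheme" and \<iota> :: "'a \<Rightarrow> 'b"
  assumes reg: "regular_local_ring R"
    and compl: "madic_complete R"
    and alg_closed: "algebraically_closed (R Quot max_ideal R)"
    and hyp: "\<And>(r::nat) (n::nat \<Rightarrow> nat) (a::nat \<Rightarrow> nat \<Rightarrow> 'a) J.
      \<lbrakk> r \<ge> 1;
        \<forall>i<r. n i \<ge> 1;
        \<forall>i<r. \<forall>j\<in>{1..n i}. a i j \<in> max_ideal R;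
        ideal J (T_ring R r n a);
        ideal_height (T_ring R r n a) J = 0;
        inj_on (T_quot_map R r n a J) (carrier R) \<rbrakk>
      \<Longrightarrow> direct_summand_via R (T_ring R r n a Quot J) (T_quot_map R r n a J)"
    and S_ring: "cring S"
    and hom: "\<iota> \<in> ring_hom R S"
    and inj: "inj_on \<iota> (carrier R)"
    and fin: "module_finite_via R S \<iota>"
  shows "direct_summand_via R S \<iota>"
proof -
  interpret R: domain R by (rule regular_local_ring_domain[OF reg])
  interpret R: complete_local_ring R
    using reg compl R.is_cring unfolding regular_local_ring_def
    by (intro complete_local_ring.intro noetherian_cring.intro complete_local_ring_axioms.intro) auto
  interpret \<iota>: ring_hom_cring R S \<iota>
    by (intro ring_hom_cring.intro ring_hom_cring_axioms.intro R.is_cring S_ring hom)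
  obtain Q where domain: "domain (S Quot Q)" and proj: "ring_hom_cring S (S Quot Q) ((+>\<^bsub>S\<^esub>) Q)"
    and inj_Q: "inj_on (\<lambda>x. Q +>\<^bsub>S\<^esub> \<iota> x) (carrier R)"
    and fin_Q: "module_finite_via R (S Quot Q) (\<lambda>x. Q +>\<^bsub>S\<^esub> \<iota> x)"
    using \<iota>.exists_module_finite_domain_quotient[OF R.domain_axioms inj fin] by blast
  interpret proj: ring_hom_cring S "S Quot Q" "(+>\<^bsub>S\<^esub>) Q" by (rule proj)
  interpret Q: domain "S Quot Q" by (rule domain)
  interpret complete_local_extension R "S Quot Q" "\<lambda>x. Q +>\<^bsub>S\<^esub> \<iota> x" "UP R"
    by unfold_locales (auto intro!: ring_hom_memI)
  obtain r n a J \<psi> where "direct_summand_via R (T_ring R r n a Quot J) (T_quot_map R r n a J)"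
    and \<psi>: "\<psi> \<in> ring_hom (S Quot Q) (T_ring R r n a Quot J)"
      "\<forall>x\<in>carrier R. \<psi> (Q +>\<^bsub>S\<^esub> \<iota> x) = T_quot_map R r n a J x"
    using exists_monic_presentation[OF alg_closed inj_Q fin_Q] hyp by metis
  then have "direct_summand_via R (S Quot Q) (\<lambda>x. Q +>\<^bsub>S\<^esub> \<iota> x)"
    by (intro direct_summand_via_if_ring_hom[OF \<psi>(1)]) auto
  then show ?thesis
    by (intro direct_summand_via_if_ring_hom[OF proj.homh]) auto
qed

end
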